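(* Let $(M,\mathcal{O})$ be a formal manifold and let $\mathcal{F}$ be a sheaf of $\mathcal{O}$-modules. Then the precosheaf of complex vector spaces $$\mathrm{D}_c^\infty(\mathcal{F}):\ U\mapsto\mathrm{D}_c^\infty(U;\mathcal{F})\qquad(U\subset M\text{ open})$$ is a cosheaf on $M$.
   Context: Formal manifolds. For a smooth manifold $N$ and $k\in\mathbb{N}$, $N^{(k)}$ is the locally ringed space $(N,\mathcal{O}_N^{(k)})$ over $\mathrm{Spec}(\mathbb{C})$ with $\mathcal{O}_N^{(k)}(U)=\mathrm{C}^\infty(U)[[y_1,\dots,y_k]]$ (complex-valued smooth functions). A formal manifold is a locally ringed space $(M,\mathcal{O})$ over $\mathrm{Spec}(\mathbb{C})$ with $M$ paracompact Hausdorff such that every point has an open neighborhood $U$ with $(U,\mathcal{O}|_U)\cong(\mathbb{R}^n)^{(k)}$ for some $n,k\in\mathbb{N}$. For $f\in\mathcal{O}(U)$, $f(a)\in\mathbb{C}$ is the residue of the germ of $f$ at $a$. The reduction is the smooth manifold $\underline{M}=(M,\underline{\mathcal{O}})$, where $\underline{\mathcal{O}}$ is the quotient of $\mathcal{O}$ by the ideal sheaf of sections $f$ with $f(a)=0$ for all $a$. $\underline{\mathcal{D}}$ is the sheaf of complex-valued smooth densities on $\underline{M}$, an $\mathcal{O}$-module via $\mathcal{O}\to\underline{\mathcal{O}}$. Differential operators. For sheaves $\mathcal{F}_1,\mathcal{F}_2$ of $\mathcal{O}$-modules, a $\mathbb{C}$-linear sheaf homomorphism $D:\mathcal{F}_1\to\mathcal{F}_2$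 has order $\le r$ if for every open $U$ and $f_0,\dots,f_r\in\mathcal{O}(U)$, $[\cdots[[D|_U,f_0],f_1],\dots,f_r]=0$, where $[D,f]=D\circ f-f\circ D$. It is a differential operator if it is locally of finite order; $\mathrm{supp}\,D$ is the complement of the largest open set on which $D$ is zero. $\mathrm{Diff}_c$ denotes the space of differential operators with compact support. The precosheaf. For $U\subset M$ open, $\mathrm{D}_c^\infty(U;\mathcal{F})$ is the image of the linear map $\rho_U:\mathrm{Diff}_c(\mathcal{F}|_U,\underline{\mathcal{D}}|_U)\to\mathrm{Hom}_{\mathbb{C}}(\mathcal{F}(U),\mathbb{C})$, $\rho_U(D)(u)=\int_U D(u)$. For open $V\subset U$, the extension map $\mathrm{ext}_{U,V}:\mathrm{D}_c^\infty(V;\mathcal{F})\to\mathrm{D}_c^\infty(U;\mathcal{F})$ is the transpose of restriction, $\eta\mapsto(u\mapsto\eta(u|_V))$ (it does land in $\mathrm{D}_c^\infty(U;\mathcal{F})$). Cosheaf. A precosheaf $\mathcal{G}$ of vector spaces on $M$ (covariant functor on open sets) is a cosheaf if for every open $U$ and every open cover $\{U_i\}$ of $U$ the sequence $\bigoplus_{i,j}\mathcal{G}(U_i\cap U_j)\to\bigoplus_i\mathcal{G}(U_i)\to\mathcal{G}(U)\to0$ is exact, where the first map is the difference of the extension maps to $\mathcal{G}(U_i)$ and $\mathcal{G}(U_j)$, and the second is the sum of the extension maps. *)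

theory Defs
  imports "HOL-Analysis.Analysis" "HOL-Algebra.QuotRing" "HOL-Algebra.Module"
begin

text \<open>
  Topological spaces are values of type \<^typ>\<open>'m topology\<close>, and the algebraic structures are those of
  HOL-Algebra. Functions that live on a subset of a type (power series coefficients, functions on an
  open set, densities, linear functionals) are extended by zero, so that each has exactly one
  representative. An open subspace \<open>U\<close> of \<open>X\<close> is \<^term>\<open>subtopology X U\<close>; the restriction of a
  sheaf to \<open>U\<close> is given by the same data, used only on the open subsets of \<open>U\<close>.
\<close>

definition complex_field :: "complex ring" where
  "complex_field = \<lparr> carrier = UNIV, mult = (*), one = 1, zero = 0, add = (+) \<rparr>"

definition paracompact_space :: "'m topology \<Rightarrow> bool" where
  "paracompact_space X \<longleftrightarrow>
     (\<forall>\<U>. (\<forall>U\<in>\<U>. openin X U) \<and> \<Union>\<U> = topspace X \<longrightarrow>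
        (\<exists>\<V>. (\<forall>V\<in>\<V>. openin X V) \<and> \<Union>\<V> = topspace X \<and> (\<forall>V\<in>\<V>. \<exists>U\<in>\<U>. V \<subseteq> U) \<and>
             locally_finite_in X \<V>))"


section \<open>Sheaves of algebras and of modules\<close>

text \<open>
  One record serves for all (pre)sheaves: \<open>'a\<close> is the type of scalars. It is \<^typ>\<open>complex\<close> for a
  structure sheaf \<open>\<O>\<close> and the type of sections of \<open>\<O>\<close> for a sheaf of \<open>\<O>\<close>-modules; in the latter case
  the ring multiplication and unit of the record carry no information. The restriction map from
  \<open>U\<close> to \<open>V \<subseteq> U\<close> is \<open>restr S U V\<close>.
\<close>

record ('m, 'a, 's) presheaf =
  sections :: "'m set \<Rightarrow> ('a, 's) module"
  restr :: "'m set \<Rightarrow> 'm set \<Rightarrow> 's \<Rightarrow> 's"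

definition presheaf_on :: "'m topology \<Rightarrow> ('m, 'a, 's) presheaf \<Rightarrow> bool" where
  "presheaf_on X S \<longleftrightarrow>
     (\<forall>U V. openin X U \<and> openin X V \<and> V \<subseteq> U \<longrightarrow>
        restr S U V \<in> carrier (sections S U) \<rightarrow> carrier (sections S V)) \<and>
     (\<forall>U s. openin X U \<and> s \<in> carrier (sections S U) \<longrightarrow> restr S U U s = s) \<and>
     (\<forall>U V W s. openin X U \<and> openin X V \<and> openin X W \<and> W \<subseteq> V \<and> V \<subseteq> U \<and>
        s \<in> carrier (sections S U) \<longrightarrow> restr S V W (restr S U V s) = restr S U W s)"

definition sheaf_on :: "'m topology \<Rightarrow> ('m, 'a, 's) presheaf \<Rightarrow> bool" where
  "sheaf_on X S \<longleftrightarrow> presheaf_on X S \<and>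
     (\<forall>\<U> s. (\<forall>V\<in>\<U>. openin X V \<and> s V \<in> carrier (sections S V)) \<and>
        (\<forall>V\<in>\<U>. \<forall>W\<in>\<U>. restr S V (V \<inter> W) (s V) = restr S W (V \<inter> W) (s W)) \<longrightarrow>
        (\<exists>!t. t \<in> carrier (sections S (\<Union>\<U>)) \<and> (\<forall>V\<in>\<U>. restr S (\<Union>\<U>) V t = s V)))"

definition sheaf_of_algebras :: "'m topology \<Rightarrow> ('m, complex, 'o) presheaf \<Rightarrow> bool" where
  "sheaf_of_algebras X \<O> \<longleftrightarrow> sheaf_on X \<O> \<and>
     (\<forall>U. openin X U \<longrightarrow> Module.algebra complex_field (sections \<O> U)) \<and>
     (\<forall>U V. openin X U \<and> openin X V \<and> V \<subseteq> U \<longrightarrow>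
        restr \<O> U V \<in> ring_hom (sections \<O> U) (sections \<O> V) \<and>
        (\<forall>c. \<forall>f\<in>carrier (sections \<O> U).
           restr \<O> U V (c \<odot>\<^bsub>sections \<O> U\<^esub> f) = c \<odot>\<^bsub>sections \<O> V\<^esub> restr \<O> U V f))"

definition sheaf_of_modules ::
    "'m topology \<Rightarrow> ('m, complex, 'o) presheaf \<Rightarrow> ('m, 'o, 'f) presheaf \<Rightarrow> bool" where
  "sheaf_of_modules X \<O> \<F> \<longleftrightarrow> sheaf_on X \<F> \<and>
     (\<forall>U. openin X U \<longrightarrow> Module.module (sections \<O> U) (sections \<F> U)) \<and>
     (\<forall>U V. openin X U \<and> openin X V \<and> V \<subseteq> U \<longrightarrow>
        (\<forall>u\<in>carrier (sections \<F> U). \<forall>v\<in>carrier (sections \<F> U).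
           restr \<F> U V (u \<oplus>\<^bsub>sections \<F> U\<^esub> v) = restr \<F> U V u \<oplus>\<^bsub>sections \<F> V\<^esub> restr \<F> U V v) \<and>
        (\<forall>f\<in>carrier (sections \<O> U). \<forall>u\<in>carrier (sections \<F> U).
           restr \<F> U V (f \<odot>\<^bsub>sections \<F> U\<^esub> u) = restr \<O> U V f \<odot>\<^bsub>sections \<F> V\<^esub> restr \<F> U V u))"


section \<open>Stalks and locally ringed spaces over the complex numbers\<close>

definition germ ::
    "'m topology \<Rightarrow> ('m, 'a, 's) presheaf \<Rightarrow> 'm \<Rightarrow> 'm set \<Rightarrow> 's \<Rightarrow> ('m set \<times> 's) set" where
  "germ X S a U s =
     {(V, t). openin X V \<and> a \<in> V \<and> t \<in> carrier (sections S V) \<and>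
        (\<exists>W. openin X W \<and> a \<in> W \<and> W \<subseteq> U \<inter> V \<and> restr S U W s = restr S V W t)}"

text \<open>All the germs in the unions below agree, as for the operations of quotient rings.\<close>

definition stalk :: "'m topology \<Rightarrow> ('m, 'a, 's) presheaf \<Rightarrow> 'm \<Rightarrow> ('m set \<times> 's) set ring" where
  "stalk X S a =
     \<lparr> carrier = {germ X S a U s |U s. openin X U \<and> a \<in> U \<and> s \<in> carrier (sections S U)},
       mult = (\<lambda>g h. \<Union>(U, s)\<in>g. \<Union>(V, t)\<in>h.
         germ X S a (U \<inter> V) (restr S U (U \<inter> V) s \<otimes>\<^bsub>sections S (U \<inter> V)\<^esub> restr S V (U \<inter> V) t)),
       one = germ X S a (topspace X) \<one>\<^bsub>sections S (topspace X)\<^esub>,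
       zero = germ X S a (topspace X) \<zero>\<^bsub>sections S (topspace X)\<^esub>,
       add = (\<lambda>g h. \<Union>(U, s)\<in>g. \<Union>(V, t)\<in>h.
         germ X S a (U \<inter> V) (restr S U (U \<inter> V) s \<oplus>\<^bsub>sections S (U \<inter> V)\<^esub> restr S V (U \<inter> V) t)) \<rparr>"

definition local_ring :: "'r ring \<Rightarrow> bool" where
  "local_ring R \<longleftrightarrow> cring R \<and> (\<exists>!I. maximalideal I R)"

text \<open>A morphism to \<open>Spec(\<complex>)\<close> amounts to a \<open>\<complex>\<close>-algebra structure on the structure sheaf.\<close>

definition locally_ringed_space :: "'m topology \<Rightarrow> ('m, complex, 'o) presheaf \<Rightarrow> bool" where
  "locally_ringed_space X \<O> \<longleftrightarrow>
     sheaf_of_algebras X \<O> \<and> (\<forall>a\<in>topspace X. local_ring (stalk X \<O> a))"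

text \<open>
  Isomorphisms of (locally) ringed spaces over \<open>\<complex>\<close>; for an isomorphism of ringed spaces the maps on
  stalks are isomorphisms, hence automatically local.
\<close>

definition isomorphic_ringed_spaces ::
    "'m topology \<Rightarrow> ('m, complex, 'o) presheaf \<Rightarrow> 'n topology \<Rightarrow> ('n, complex, 'p) presheaf \<Rightarrow> bool"
  where
  "isomorphic_ringed_spaces X \<O> Y \<P> \<longleftrightarrow>
     (\<exists>\<phi> \<theta>. homeomorphic_map X Y \<phi> \<and>
        (\<forall>V. openin Y V \<longrightarrow>
           \<theta> V \<in> ring_iso (sections \<P> V) (sections \<O> {a \<in> topspace X. \<phi> a \<in> V}) \<and>
           (\<forall>c. \<forall>f\<in>carrier (sections \<P> V).
              \<theta> V (c \<odot>\<^bsub>sections \<P> V\<^esub> f) = c \<odot>\<^bsub>sections \<O> {a \<in> topspace X. \<phi> a \<in> V}\<^esub> \<theta> V f)) \<and>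
        (\<forall>V W. openin Y V \<and> openin Y W \<and> W \<subseteq> V \<longrightarrow>
           (\<forall>f\<in>carrier (sections \<P> V).
              \<theta> W (restr \<P> V W f) =
              restr \<O> {a \<in> topspace X. \<phi> a \<in> V} {a \<in> topspace X. \<phi> a \<in> W} (\<theta> V f))))"

text \<open>The residue of the germ of \<open>f\<close> at \<open>a\<close>, provided the residue field at \<open>a\<close> is \<open>\<complex>\<close>.\<close>

definition eval_at ::
    "'m topology \<Rightarrow> ('m, complex, 'o) presheaf \<Rightarrow> 'm set \<Rightarrow> 'o \<Rightarrow> 'm \<Rightarrow> complex" where
  "eval_at X \<O> U f a =
     (THE c. germ X \<O> a U (f \<ominus>\<^bsub>sections \<O> U\<^esub> (c \<odot>\<^bsub>sections \<O> U\<^esub> \<one>\<^bsub>sections \<O> U\<^esub>))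
             \<in> (THE I. maximalideal I (stalk X \<O> a)))"


section \<open>Formal manifolds\<close>

text \<open>
  The dimension has to vary from point to point, so \<open>\<real>\<^sup>n\<close> is the space of functions on \<open>{..<n}\<close>
  (with the value \<^const>\<open>undefined\<close> outside of \<open>{..<n}\<close>).
\<close>

abbreviation Rn :: "nat \<Rightarrow> (nat \<Rightarrow> real) topology" where
  "Rn n \<equiv> powertop_real {..<n}"

primrec Ck_on :: "nat \<Rightarrow> nat \<Rightarrow> (nat \<Rightarrow> real) set \<Rightarrow> ((nat \<Rightarrow> real) \<Rightarrow> complex) \<Rightarrow> bool" where
  "Ck_on 0 n V f \<longleftrightarrow> continuous_map (subtopology (Rn n) V) euclidean f"
| "Ck_on (Suc k) n V f \<longleftrightarrow> continuous_map (subtopology (Rn n) V) euclidean f \<and>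
     (\<forall>i<n. \<exists>g. (\<forall>x\<in>V. ((\<lambda>t. f (x(i := t))) has_vector_derivative g x) (at (x i))) \<and>
                Ck_on k n V g)"

definition smooth_on_Rn :: "nat \<Rightarrow> (nat \<Rightarrow> real) set \<Rightarrow> ((nat \<Rightarrow> real) \<Rightarrow> complex) \<Rightarrow> bool" where
  "smooth_on_Rn n V f \<longleftrightarrow> (\<forall>k. Ck_on k n V f)"

definition multi_indices :: "nat \<Rightarrow> (nat \<Rightarrow> nat) set" where
  "multi_indices k = {\<alpha>. \<forall>i\<ge>k. \<alpha> i = 0}"

text \<open>
  The algebra \<open>C\<^sup>\<infinity>(V)[[y\<^sub>1, \<dots>, y\<^sub>k]]\<close>, for \<open>V\<close> open in \<open>\<real>\<^sup>n\<close>; a power series is the family of its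
  coefficients.
\<close>

definition formal_functions ::
    "nat \<Rightarrow> nat \<Rightarrow> (nat \<Rightarrow> real) set \<Rightarrow> (complex, (nat \<Rightarrow> nat) \<Rightarrow> (nat \<Rightarrow> real) \<Rightarrow> complex) module"
  where
  "formal_functions n k V =
     \<lparr> carrier = {f. (\<forall>\<alpha>\<in>multi_indices k. smooth_on_Rn n V (f \<alpha>)) \<and>
                     (\<forall>\<alpha> x. \<alpha> \<notin> multi_indices k \<or> x \<notin> V \<longrightarrow> f \<alpha> x = 0)},
       mult = (\<lambda>f g \<gamma> x. \<Sum>(\<alpha>, \<beta>) | (\<lambda>i. \<alpha> i + \<beta> i) = \<gamma>. f \<alpha> x * g \<beta> x),
       one = (\<lambda>\<alpha> x. if \<alpha> = (\<lambda>i. 0) \<and> x \<in> V then 1 else 0),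
       zero = (\<lambda>\<alpha> x. 0),
       add = (\<lambda>f g \<alpha> x. f \<alpha> x + g \<alpha> x),
       smult = (\<lambda>c f \<alpha> x. c * f \<alpha> x) \<rparr>"

definition formal_Rn ::
    "nat \<Rightarrow> nat \<Rightarrow> (nat \<Rightarrow> real, complex, (nat \<Rightarrow> nat) \<Rightarrow> (nat \<Rightarrow> real) \<Rightarrow> complex) presheaf" where
  "formal_Rn n k =
     \<lparr> sections = formal_functions n k,
       restr = (\<lambda>U V f \<alpha> x. if x \<in> V then f \<alpha> x else 0) \<rparr>"

definition formal_manifold :: "'m topology \<Rightarrow> ('m, complex, 'o) presheaf \<Rightarrow> bool" where
  "formal_manifold X \<O> \<longleftrightarrow>
     locally_ringed_space X \<O> \<and> paracompact_space X \<and> Hausdorff_space X \<and>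
     (\<forall>a\<in>topspace X. \<exists>U n k. openin X U \<and> a \<in> U \<and>
        isomorphic_ringed_spaces (subtopology X U) \<O> (Rn n) (formal_Rn n k))"


section \<open>The reduction\<close>

text \<open>
  The ideal sheaf of the sections vanishing at every point is the kernel of the map sending \<open>f\<close> to
  the function \<open>a \<mapsto> f(a)\<close>. So the quotient sheaf is the sheaf of the functions that are locally of
  this form; these are the smooth functions on the reduction.
\<close>

definition reduced_sections ::
    "'m topology \<Rightarrow> ('m, complex, 'o) presheaf \<Rightarrow> 'm set \<Rightarrow> ('m \<Rightarrow> complex) set" where
  "reduced_sections X \<O> U =
     {g. (\<forall>a. a \<notin> U \<longrightarrow> g a = 0) \<and>
         (\<forall>a\<in>U. \<exists>V f. openin X V \<and> a \<in> V \<and> V \<subseteq> U \<and> f \<in> carrier (sections \<O> V) \<and>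
                      (\<forall>b\<in>V. g b = eval_at X \<O> V f b))}"

record 'm chart =
  chart_dim :: nat
  chart_dom :: "'m set"
  chart_map :: "'m \<Rightarrow> nat \<Rightarrow> real"

abbreviation chart_inv :: "'m chart \<Rightarrow> (nat \<Rightarrow> real) \<Rightarrow> 'm" where
  "chart_inv c \<equiv> inv_into (chart_dom c) (chart_map c)"

text \<open>The charts of the reduction: isomorphisms from open subspaces onto open subspaces of \<open>\<real>\<^sup>n\<close>.\<close>

definition charts :: "'m topology \<Rightarrow> ('m, complex, 'o) presheaf \<Rightarrow> 'm chart set" where
  "charts X \<O> =
     {c. openin X (chart_dom c) \<and> openin (Rn (chart_dim c)) (chart_map c ` chart_dom c) \<and>
         chart_map c \<in> extensional (chart_dom c) \<and>
         homeomorphic_map (subtopology X (chart_dom c))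
           (subtopology (Rn (chart_dim c)) (chart_map c ` chart_dom c)) (chart_map c) \<and>
         (\<forall>V g. openin X V \<and> V \<subseteq> chart_dom c \<and> (\<forall>a. a \<notin> V \<longrightarrow> g a = 0) \<longrightarrow>
            (g \<in> reduced_sections X \<O> V \<longleftrightarrow>
             smooth_on_Rn (chart_dim c) (chart_map c ` V) (g \<circ> chart_inv c)))}"


section \<open>Densities and their integrals\<close>

text \<open>
  Leibniz formula, as in the definition of the determinant in HOL-Analysis, which applies only to
  matrices whose size is a type.
\<close>

definition determinant :: "nat \<Rightarrow> (nat \<Rightarrow> nat \<Rightarrow> real) \<Rightarrow> real" where
  "determinant n A = (\<Sum>p | p permutes {..<n}. of_int (sign p) * (\<Prod>i<n. A i (p i)))"

text \<open>Jacobian determinant, at the point \<open>a\<close>, of the coordinates of \<open>d\<close> with respect to those of \<open>c\<close>.\<close>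

definition jacobian :: "'m chart \<Rightarrow> 'm chart \<Rightarrow> 'm \<Rightarrow> real" where
  "jacobian c d a =
     determinant (chart_dim c)
       (\<lambda>i j. deriv (\<lambda>t. chart_map d (chart_inv c ((chart_map c a)(j := t))) i) (chart_map c a j))"

text \<open>
  A smooth density \<open>\<mu>\<close> on \<open>U\<close> is given by its coefficients in all charts: at a point \<open>a\<close> of the domain
  of the chart \<open>c = (x\<^sub>1, \<dots>, x\<^sub>n)\<close> it is \<open>\<mu> c a |dx\<^sub>1 \<and> \<dots> \<and> dx\<^sub>n|\<close>.
\<close>

definition densities_on ::
    "'m topology \<Rightarrow> ('m, complex, 'o) presheaf \<Rightarrow> 'm set \<Rightarrow> ('m chart \<Rightarrow> 'm \<Rightarrow> complex) set" where
  "densities_on X \<O> U =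
     {\<mu>. (\<forall>c a. c \<notin> charts X \<O> \<or> a \<notin> U \<inter> chart_dom c \<longrightarrow> \<mu> c a = 0) \<and>
         (\<forall>c\<in>charts X \<O>. \<mu> c \<in> reduced_sections X \<O> (U \<inter> chart_dom c)) \<and>
         (\<forall>c\<in>charts X \<O>. \<forall>d\<in>charts X \<O>. \<forall>a\<in>U \<inter> chart_dom c \<inter> chart_dom d.
            \<mu> c a = complex_of_real \<bar>jacobian c d a\<bar> * \<mu> d a)}"

definition densities ::
    "'m topology \<Rightarrow> ('m, complex, 'o) presheaf \<Rightarrow> ('m, 'o, 'm chart \<Rightarrow> 'm \<Rightarrow> complex) presheaf" where
  "densities X \<O> =
     \<lparr> sections = (\<lambda>U.
         \<lparr> carrier = densities_on X \<O> U,
           mult = undefined, one = undefined,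
           zero = (\<lambda>c a. 0),
           add = (\<lambda>\<mu> \<nu> c a. \<mu> c a + \<nu> c a),
           smult = (\<lambda>f \<mu> c a. if a \<in> U then eval_at X \<O> U f a * \<mu> c a else 0) \<rparr>),
       restr = (\<lambda>U V \<mu> c a. if a \<in> V then \<mu> c a else 0) \<rparr>"

text \<open>Partitions of unity subordinate to the cover of the reduction by all chart domains.\<close>

definition partition_of_unity ::
    "'m topology \<Rightarrow> ('m, complex, 'o) presheaf \<Rightarrow> ('m chart \<Rightarrow> 'm \<Rightarrow> complex) \<Rightarrow> bool" where
  "partition_of_unity X \<O> \<rho> \<longleftrightarrow>
     (\<forall>c\<in>charts X \<O>. \<rho> c \<in> reduced_sections X \<O> (topspace X) \<and>
        (\<forall>a\<in>topspace X. \<exists>t\<in>{0..1}. \<rho> c a = complex_of_real t) \<and>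
        Abstract_Topology.closure_of X {a \<in> topspace X. \<rho> c a \<noteq> 0} \<subseteq> chart_dom c) \<and>
     (\<forall>a\<in>topspace X. \<exists>W. openin X W \<and> a \<in> W \<and>
        finite {c \<in> charts X \<O>. \<exists>b\<in>W. \<rho> c b \<noteq> 0}) \<and>
     (\<forall>a\<in>topspace X. (\<Sum>c | c \<in> charts X \<O> \<and> \<rho> c a \<noteq> 0. \<rho> c a) = 1)"

text \<open>The integral over the domain of \<open>c\<close> of the density with coefficient \<open>h\<close> in the chart \<open>c\<close>.\<close>

definition chart_integral :: "'m chart \<Rightarrow> ('m \<Rightarrow> complex) \<Rightarrow> complex" where
  "chart_integral c h =
     (\<integral>x. (if x \<in> chart_map c ` chart_dom c then h (chart_inv c x) else 0)
        \<partial>(PiM {..<chart_dim c} (\<lambda>_. lborel)))"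

text \<open>
  The integral \<open>\<Sum>\<^sub>c \<integral> \<rho>\<^sub>c \<mu>\<close> of a compactly supported smooth density \<open>\<mu>\<close>, which does not depend on the
  partition of unity \<open>\<rho>\<close>; only finitely many summands are nonzero. The same formula
  computes the integral over \<open>U\<close> of a density that is compactly supported in an open subset \<open>U\<close>,
  because \<open>\<rho>\<close> restricts to a partition of unity on \<open>U\<close> subordinate to the restricted charts.
\<close>

definition density_integral ::
    "'m topology \<Rightarrow> ('m, complex, 'o) presheaf \<Rightarrow> ('m chart \<Rightarrow> 'm \<Rightarrow> complex) \<Rightarrow> complex" where
  "density_integral X \<O> \<mu> =
     (let \<rho> = (SOME \<rho>. partition_of_unity X \<O> \<rho>)
      in \<Sum>c | c \<in> charts X \<O> \<and> (\<exists>a. \<rho> c a * \<mu> c a \<noteq> 0). chart_integral c (\<lambda>a. \<rho> c a * \<mu> c a))"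


section \<open>Differential operators\<close>

text \<open>A sheaf homomorphism \<open>\<F> \<rightarrow> \<G>\<close> is a family of maps \<open>D U\<close>, only relevant on sections over open sets.\<close>

definition sheaf_hom ::
    "'m topology \<Rightarrow> ('m, complex, 'o) presheaf \<Rightarrow> ('m, 'o, 'f) presheaf \<Rightarrow> ('m, 'o, 'g) presheaf \<Rightarrow>
     ('m set \<Rightarrow> 'f \<Rightarrow> 'g) \<Rightarrow> bool" where
  "sheaf_hom X \<O> \<F> \<G> D \<longleftrightarrow>
     (\<forall>U. openin X U \<longrightarrow>
        D U \<in> carrier (sections \<F> U) \<rightarrow> carrier (sections \<G> U) \<and>
        (\<forall>u\<in>carrier (sections \<F> U). \<forall>v\<in>carrier (sections \<F> U).
           D U (u \<oplus>\<^bsub>sections \<F> U\<^esub> v) = D U u \<oplus>\<^bsub>sections \<G> U\<^esub> D U v) \<and>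
        (\<forall>c. \<forall>u\<in>carrier (sections \<F> U).
           D U ((c \<odot>\<^bsub>sections \<O> U\<^esub> \<one>\<^bsub>sections \<O> U\<^esub>) \<odot>\<^bsub>sections \<F> U\<^esub> u) =
           (c \<odot>\<^bsub>sections \<O> U\<^esub> \<one>\<^bsub>sections \<O> U\<^esub>) \<odot>\<^bsub>sections \<G> U\<^esub> D U u)) \<and>
     (\<forall>U V. openin X U \<and> openin X V \<and> V \<subseteq> U \<longrightarrow>
        (\<forall>u\<in>carrier (sections \<F> U). D V (restr \<F> U V u) = restr \<G> U V (D U u)))"

text \<open>The commutator \<open>[D|\<^sub>U, f]\<close> with \<open>f \<in> \<O>(U)\<close>, evaluated on sections over open subsets \<open>V\<close> of \<open>U\<close>.\<close>

definition commutator ::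
    "('m, complex, 'o) presheaf \<Rightarrow> ('m, 'o, 'f) presheaf \<Rightarrow> ('m, 'o, 'g) presheaf \<Rightarrow> 'm set \<Rightarrow>
     ('m set \<Rightarrow> 'f \<Rightarrow> 'g) \<Rightarrow> 'o \<Rightarrow> 'm set \<Rightarrow> 'f \<Rightarrow> 'g" where
  "commutator \<O> \<F> \<G> U D f =
     (\<lambda>V u. D V (restr \<O> U V f \<odot>\<^bsub>sections \<F> V\<^esub> u) \<ominus>\<^bsub>sections \<G> V\<^esub>
            (restr \<O> U V f \<odot>\<^bsub>sections \<G> V\<^esub> D V u))"

definition zero_on ::
    "'m topology \<Rightarrow> ('m, 'o, 'f) presheaf \<Rightarrow> ('m, 'o, 'g) presheaf \<Rightarrow> 'm set \<Rightarrow>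
     ('m set \<Rightarrow> 'f \<Rightarrow> 'g) \<Rightarrow> bool" where
  "zero_on X \<F> \<G> U D \<longleftrightarrow>
     (\<forall>V. openin X V \<and> V \<subseteq> U \<longrightarrow> (\<forall>u\<in>carrier (sections \<F> V). D V u = \<zero>\<^bsub>sections \<G> V\<^esub>))"

definition order_at_most ::
    "'m topology \<Rightarrow> ('m, complex, 'o) presheaf \<Rightarrow> ('m, 'o, 'f) presheaf \<Rightarrow> ('m, 'o, 'g) presheaf \<Rightarrow>
     nat \<Rightarrow> ('m set \<Rightarrow> 'f \<Rightarrow> 'g) \<Rightarrow> bool" where
  "order_at_most X \<O> \<F> \<G> r D \<longleftrightarrow>
     (\<forall>U fs. openin X U \<and> length fs = Suc r \<and> set fs \<subseteq> carrier (sections \<O> U) \<longrightarrow>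
        zero_on X \<F> \<G> U (foldl (commutator \<O> \<F> \<G> U) D fs))"

definition differential_operator ::
    "'m topology \<Rightarrow> ('m, complex, 'o) presheaf \<Rightarrow> ('m, 'o, 'f) presheaf \<Rightarrow> ('m, 'o, 'g) presheaf \<Rightarrow>
     ('m set \<Rightarrow> 'f \<Rightarrow> 'g) \<Rightarrow> bool" where
  "differential_operator X \<O> \<F> \<G> D \<longleftrightarrow> sheaf_hom X \<O> \<F> \<G> D \<and>
     (\<forall>a\<in>topspace X. \<exists>W r. openin X W \<and> a \<in> W \<and> order_at_most (subtopology X W) \<O> \<F> \<G> r D)"

definition support ::
    "'m topology \<Rightarrow> ('m, 'o, 'f) presheaf \<Rightarrow> ('m, 'o, 'g) presheaf \<Rightarrow> ('m set \<Rightarrow> 'f \<Rightarrow> 'g) \<Rightarrow> 'm set"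
  where
  "support X \<F> \<G> D = topspace X - \<Union>{W. openin X W \<and> zero_on X \<F> \<G> W D}"

definition Diff_c ::
    "'m topology \<Rightarrow> ('m, complex, 'o) presheaf \<Rightarrow> ('m, 'o, 'f) presheaf \<Rightarrow> ('m, 'o, 'g) presheaf \<Rightarrow>
     ('m set \<Rightarrow> 'f \<Rightarrow> 'g) set" where
  "Diff_c X \<O> \<F> \<G> = {D. differential_operator X \<O> \<F> \<G> D \<and> compactin X (support X \<F> \<G> D)}"


section \<open>Cosheaves\<close>

text \<open>The extension map from \<open>V \<subseteq> U\<close> to \<open>U\<close> is \<open>ext G U V\<close>.\<close>

record ('m, 'v) precosheaf =
  cosections :: "'m set \<Rightarrow> (complex, 'v) module"
  ext :: "'m set \<Rightarrow> 'm set \<Rightarrow> 'v \<Rightarrow> 'v"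

definition precosheaf_on :: "'m topology \<Rightarrow> ('m, 'v) precosheaf \<Rightarrow> bool" where
  "precosheaf_on X G \<longleftrightarrow>
     (\<forall>U. openin X U \<longrightarrow> Module.module complex_field (cosections G U)) \<and>
     (\<forall>U V. openin X U \<and> openin X V \<and> V \<subseteq> U \<longrightarrow>
        ext G U V \<in> carrier (cosections G V) \<rightarrow> carrier (cosections G U) \<and>
        (\<forall>\<eta>\<in>carrier (cosections G V). \<forall>\<theta>\<in>carrier (cosections G V).
           ext G U V (\<eta> \<oplus>\<^bsub>cosections G V\<^esub> \<theta>) = ext G U V \<eta> \<oplus>\<^bsub>cosections G U\<^esub> ext G U V \<theta>) \<and>
        (\<forall>c. \<forall>\<eta>\<in>carrier (cosections G V).
           ext G U V (c \<odot>\<^bsub>cosections G V\<^esub> \<eta>) = c \<odot>\<^bsub>cosections G U\<^esub> ext G U V \<eta>)) \<and>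
     (\<forall>U \<eta>. openin X U \<and> \<eta> \<in> carrier (cosections G U) \<longrightarrow> ext G U U \<eta> = \<eta>) \<and>
     (\<forall>U V W \<eta>. openin X U \<and> openin X V \<and> openin X W \<and> W \<subseteq> V \<and> V \<subseteq> U \<and>
        \<eta> \<in> carrier (cosections G W) \<longrightarrow> ext G U V (ext G V W \<eta>) = ext G U W \<eta>)"

definition direct_sum :: "'i set \<Rightarrow> ('i \<Rightarrow> (complex, 'v) module) \<Rightarrow> ('i \<Rightarrow> 'v) set" where
  "direct_sum I M =
     {\<eta> \<in> (\<Pi>\<^sub>E i\<in>I. carrier (M i)). finite {i \<in> I. \<eta> i \<noteq> \<zero>\<^bsub>M i\<^esub>}}"

text \<open>
  The two maps of the cosheaf sequence, for the family \<open>A i\<close>, \<open>i \<in> I\<close>, of open subsets of \<open>U\<close>. The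
  component \<open>\<zeta> (i, j)\<close> contributes its extension to \<open>A i\<close> with sign \<open>+\<close> and its extension to \<open>A j\<close>
  with sign \<open>-\<close>. The sums range over the nonzero components, since \<^const>\<open>finsum\<close> over an infinite
  set is zero.
\<close>

definition cosheaf_diff ::
    "('m, 'v) precosheaf \<Rightarrow> 'i set \<Rightarrow> ('i \<Rightarrow> 'm set) \<Rightarrow> ('i \<times> 'i \<Rightarrow> 'v) \<Rightarrow> 'i \<Rightarrow> 'v" where
  "cosheaf_diff G I A \<zeta> = (\<lambda>k\<in>I.
     finsum (cosections G (A k)) (\<lambda>j. ext G (A k) (A k \<inter> A j) (\<zeta> (k, j)))
       {j \<in> I. \<zeta> (k, j) \<noteq> \<zero>\<^bsub>cosections G (A k \<inter> A j)\<^esub>}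
     \<ominus>\<^bsub>cosections G (A k)\<^esub>
     finsum (cosections G (A k)) (\<lambda>i. ext G (A k) (A i \<inter> A k) (\<zeta> (i, k)))
       {i \<in> I. \<zeta> (i, k) \<noteq> \<zero>\<^bsub>cosections G (A i \<inter> A k)\<^esub>})"

definition cosheaf_sum ::
    "('m, 'v) precosheaf \<Rightarrow> 'i set \<Rightarrow> ('i \<Rightarrow> 'm set) \<Rightarrow> 'm set \<Rightarrow> ('i \<Rightarrow> 'v) \<Rightarrow> 'v" where
  "cosheaf_sum G I A U \<eta> =
     finsum (cosections G U) (\<lambda>i. ext G U (A i) (\<eta> i)) {i \<in> I. \<eta> i \<noteq> \<zero>\<^bsub>cosections G (A i)\<^esub>}"

text \<open>
  The type argument is the type of the indices of the open covers; HOL cannot quantify over it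
  inside the definition.
\<close>

definition cosheaf_on :: "'i itself \<Rightarrow> 'm topology \<Rightarrow> ('m, 'v) precosheaf \<Rightarrow> bool" where
  "cosheaf_on ty X G \<longleftrightarrow> precosheaf_on X G \<and>
     (\<forall>U (I :: 'i set) A. openin X U \<and> (\<forall>i\<in>I. openin X (A i)) \<and> (\<Union>i\<in>I. A i) = U \<longrightarrow>
        cosheaf_diff G I A ` direct_sum (I \<times> I) (\<lambda>(i, j). cosections G (A i \<inter> A j)) =
          {\<eta> \<in> direct_sum I (\<lambda>i. cosections G (A i)). cosheaf_sum G I A U \<eta> = \<zero>\<^bsub>cosections G U\<^esub>} \<and>
        cosheaf_sum G I A U ` direct_sum I (\<lambda>i. cosections G (A i)) = carrier (cosections G U))"


section \<open>The precosheaf of compactly supported formal densities\<close>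

definition rho ::
    "'m topology \<Rightarrow> ('m, complex, 'o) presheaf \<Rightarrow> ('m, 'o, 'f) presheaf \<Rightarrow> 'm set \<Rightarrow>
     ('m set \<Rightarrow> 'f \<Rightarrow> 'm chart \<Rightarrow> 'm \<Rightarrow> complex) \<Rightarrow> 'f \<Rightarrow> complex" where
  "rho X \<O> \<F> U D =
     (\<lambda>u. if u \<in> carrier (sections \<F> U) then density_integral X \<O> (D U u) else 0)"

definition Dc_infty ::
    "'m topology \<Rightarrow> ('m, complex, 'o) presheaf \<Rightarrow> ('m, 'o, 'f) presheaf \<Rightarrow>
     ('m, 'f \<Rightarrow> complex) precosheaf" where
  "Dc_infty X \<O> \<F> =
     \<lparr> cosections = (\<lambda>U.
         \<lparr> carrier = rho X \<O> \<F> U ` Diff_c (subtopology X U) \<O> \<F> (densities X \<O>),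
           mult = undefined, one = undefined,
           zero = (\<lambda>u. 0),
           add = (\<lambda>\<eta> \<theta> u. \<eta> u + \<theta> u),
           smult = (\<lambda>c \<eta> u. c * \<eta> u) \<rparr>),
       ext = (\<lambda>U V \<eta> u. if u \<in> carrier (sections \<F> U) then \<eta> (restr \<F> U V u) else 0) \<rparr>"

end

theory Submission
  imports Defs
begin

text \<open>
  A finite partition of unity near a compact set can be chosen in \<open>\<O>\<close> itself. Precomposing a
  differential operator with multiplication by \<open>f \<in> \<O>(U)\<close> gives a differential operator supported
  in the support of \<open>f\<close>, and on functionals it becomes \<open>(f \<eta>)(u) = \<eta> (f u)\<close>, which depends only on \<open>\<eta>\<close> and
  not on the operator that represents it. Hence compactly supported functionals can be cut into pieces
  supported in the members of a cover, and the usual argument for fine sheaves, with extension by zero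
  in place of restriction, gives exactness.

  Integration enters only through its linearity. For this a partition of unity subordinate to the
  charts has to exist, but the integral need not be shown to be independent of it, so no change of
  variables is involved.
\<close>


section \<open>Smooth functions on open subsets of Euclidean space\<close>

text \<open>The map \<open>rho\<close> is in general not injective: an operator whose values are
  total derivatives integrates to zero. A relation between functionals therefore gives no relation
  between operators that represent them, and the kernel of the second map of the sequence has to be
  studied by evaluating functionals on sections. Since \<F> is an arbitrary sheaf of modules, a
  section over a smaller open set need not extend; its product with some f in \<O> that is zero off
  a compact set does, by gluing with the zero section, and this supplies the test sections.

  For this gluing f has to be zero in \<O>, and equal to the unit near the support, not only in its
  residues, because a section with vanishing residues may still act nontrivially on \<F>. The
  cutoffs are therefore built in the local model, as power series without higher terms, from smooth
  bumps on Euclidean space.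

  Residues are defined through the abstract maximal ideal of a stalk. They have to be identified
  with constant terms of power series before charts, densities and integrals can be computed with.
  Normalisation by division takes place only among functions on the reduction.\<close>

lemma Ck_on_continuous: "Ck_on k n V f \<Longrightarrow> continuous_map (subtopology (Rn n) V) euclidean f"
  by (cases k) auto

lemma Ck_on_subset:
  assumes "Ck_on k n V f" "W \<subseteq> V"
  shows "Ck_on k n W f"
  using assms
proof (induction k arbitrary: f)
  case 0
  then show ?case using continuous_map_from_subtopology_mono by auto
next
  case (Suc k)
  then have "\<exists>g. (\<forall>x\<in>W. ((\<lambda>t. f (x(i := t))) has_vector_derivative g x) (at (x i))) \<and> Ck_on k n W g"
    if "i < n" for i
    using that unfolding Ck_on.simps by blast
  then show ?case using Suc.prems
    unfolding Ck_on.simps using continuous_map_from_subtopology_mono by blast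
qed

lemma Ck_on_SucD: "Ck_on (Suc k) n V f \<Longrightarrow> Ck_on k n V f"
proof (induction k arbitrary: f)
  case (Suc k)
  then show ?case by (simp only: Ck_on.simps) blast
qed auto

lemma continuous_map_fun_upd_Rn:
  assumes "x \<in> topspace (Rn n)" "i < n"
  shows "continuous_map euclideanreal (Rn n) (\<lambda>t. x(i := t))"
proof (rule continuous_map_coordinatewise_then_product)
  show "continuous_map euclideanreal euclideanreal (\<lambda>t. (x(i := t)) j)" for j
    by (cases "j = i") auto
  show "(x(i := t)) j = undefined" if "j \<notin> {..<n}" for j t
    using assms that by (auto simp: PiE_def extensional_def)
qed

text \<open>The derivatives in \<open>Ck_on\<close> are taken along full coordinate lines. Openness
  of this slice lets two functions that agree on \<open>V\<close> be exchanged inside such a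
  derivative.\<close>

lemma open_coordinate_line:
  assumes "openin (Rn n) V" "x \<in> V" "i < n"
  shows "open {t. x(i := t) \<in> V}"
proof -
  have "x \<in> topspace (Rn n)" using assms openin_subset by blast
  from openin_continuous_map_preimage[OF continuous_map_fun_upd_Rn[OF this assms(3)] assms(1)]
  show ?thesis by simp
qed

text \<open>The partial derivatives of \<open>f\<close> serve for \<open>g\<close> as well, so
  unfolding \<open>Ck_on\<close> once is enough and no induction occurs. Openness matters because a
  derivative sees values on an interval of the coordinate line.\<close>

lemma Ck_on_cong:
  assumes "openin (Rn n) V" "Ck_on k n V f" "\<And>x. x \<in> V \<Longrightarrow> f x = g x"
  shows "Ck_on k n V g"
proof -
  have cont: "continuous_map (subtopology (Rn n) V) euclidean g"
    using continuous_map_eq[OF Ck_on_continuous[OF assms(2)]] assms(3) by simp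
  have der: "((\<lambda>t. g (x(i := t))) has_vector_derivative d) (at (x i))"
    if "((\<lambda>t. f (x(i := t))) has_vector_derivative d) (at (x i))" "x \<in> V" "i < n" for x i d
    using has_vector_derivative_transform_within_open[OF that(1) open_coordinate_line[OF assms(1) that(2,3)]]
      that(2) assms(3) by auto
  show ?thesis
    using assms(2) cont der by (cases k) (auto, blast)
qed

lemma continuous_map_open_local:
  assumes "openin X V"
    and "\<And>x. x \<in> V \<Longrightarrow> \<exists>W. openin X W \<and> x \<in> W \<and> W \<subseteq> V \<and> continuous_map (subtopology X W) Y f"
  shows "continuous_map (subtopology X V) Y f"
proof -
  from assms(2) obtain W where W: "\<And>x. x \<in> V \<Longrightarrow> openin X (W x) \<and> x \<in> W x \<and> W x \<subseteq> V \<and> continuous_map (subtopology X (W x)) Y f"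
    by metis
  have V: "V \<subseteq> topspace X" using openin_subset[OF assms(1)] .
  have *: "openin X {x \<in> V. f x \<in> U}" if "openin Y U" for U
  proof -
    have "{x \<in> V. f x \<in> U} = (\<Union>y\<in>V. {x \<in> W y. f x \<in> U})" using W by blast
    moreover have "openin X {x \<in> W y. f x \<in> U}" if "y \<in> V" for y
    proof -
      have "openin (subtopology X (W y)) {x \<in> topspace (subtopology X (W y)). f x \<in> U}"
        using W[OF that] \<open>openin Y U\<close> openin_continuous_map_preimage by blast
      moreover have "topspace (subtopology X (W y)) = W y"
        using W[OF that] V by auto
      ultimately have "openin (subtopology X (W y)) {x \<in> W y. f x \<in> U}" by metis
      then show ?thesis using W[OF that] by (blast dest: openin_trans_full)
    qed
    ultimately show ?thesis by auto
  qed
  moreover have "f x \<in> topspace Y" if "x \<in> V" for x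
    using W[OF that] V that by (auto simp: continuous_map_def Pi_iff)
  ultimately show ?thesis
    using V assms(1) by (auto simp: continuous_map_def openin_open_subtopology Int_absorb1)
qed

lemma Ck_on_local:
  assumes "openin (Rn n) V"
    and "\<And>x. x \<in> V \<Longrightarrow> \<exists>W. openin (Rn n) W \<and> x \<in> W \<and> W \<subseteq> V \<and> Ck_on k n W f"
  shows "Ck_on k n V f"
  using assms(2)
proof (induction k arbitrary: f)
  case 0
  then have "\<exists>W. openin (Rn n) W \<and> x \<in> W \<and> W \<subseteq> V \<and> continuous_map (subtopology (Rn n) W) euclidean f"
    if "x \<in> V" for x
    using that by simp
  from continuous_map_open_local[OF assms(1) this] show ?case by simp
next
  case (Suc k)
  have "continuous_map (subtopology (Rn n) V) euclidean f"
    by (rule continuous_map_open_local[OF assms(1)]) (blast dest: Suc.prems Ck_on_continuous)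
  moreover have "\<exists>g. (\<forall>x\<in>V. ((\<lambda>t. f (x(i := t))) has_vector_derivative g x) (at (x i))) \<and> Ck_on k n V g"
    if "i < n" for i
  proof -
    \<comment> \<open>The local witnesses for the derivative are unrelated functions. By uniqueness
      of derivatives each of them agrees with this canonical choice, which therefore glues
      them.\<close>
    define g where "g x = vector_derivative (\<lambda>t. f (x(i := t))) (at (x i))" for x
    have loc: "\<exists>W. openin (Rn n) W \<and> x \<in> W \<and> W \<subseteq> V \<and> Ck_on k n W g \<and>
       ((\<lambda>t. f (x(i := t))) has_vector_derivative g x) (at (x i))" if "x \<in> V" for x
    proof -
      obtain W where W: "openin (Rn n) W" "x \<in> W" "W \<subseteq> V" "Ck_on (Suc k) n W f"
        using Suc.prems \<open>x \<in> V\<close> by blast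
      then obtain h where h: "\<forall>x\<in>W. ((\<lambda>t. f (x(i := t))) has_vector_derivative h x) (at (x i))" "Ck_on k n W h"
        using \<open>i < n\<close> by auto
      have "h y = g y" if "y \<in> W" for y
        using h(1) that vector_derivative_at unfolding g_def by fastforce
      then show ?thesis using W h Ck_on_cong by (metis (no_types, lifting))
    qed
    then have "Ck_on k n V g" using Suc.IH[of g] by meson
    then show ?thesis using loc by blast
  qed
  ultimately show ?case by simp
qed

lemma continuous_map_complex_pair:
  fixes f g :: "'a \<Rightarrow> complex" and h :: "complex \<times> complex \<Rightarrow> complex"
  assumes "continuous_map X euclidean f" "continuous_map X euclidean g" "continuous_on UNIV h"
  shows "continuous_map X euclidean (\<lambda>x. h (f x, g x))"
proof -
  have "continuous_map X (prod_topology euclidean euclidean) (\<lambda>x. (f x, g x))"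
    using assms by (intro continuous_map_pairedI)
  then have "continuous_map X euclidean (\<lambda>x. (f x, g x))" by (simp flip: euclidean_product_topology)
  then show ?thesis
    using continuous_map_compose[of X euclidean "\<lambda>x. (f x, g x)" euclidean h] assms(3) by (simp add: o_def)
qed

lemma Ck_on_const: "Ck_on k n V (\<lambda>_. c)"
proof (induction k arbitrary: c)
  case (Suc k)
  then show ?case by (auto intro!: exI[of _ "\<lambda>_. 0"])
qed auto

lemma Ck_on_add:
  assumes "Ck_on k n V f" "Ck_on k n V g"
  shows "Ck_on k n V (\<lambda>x. f x + g x)"
  using assms
proof (induction k arbitrary: f g)
  case 0
  then show ?case by (auto intro!: continuous_map_complex_pair[where h = "\<lambda>p. fst p + snd p", simplified] continuous_intros)
next
  case (Suc k)
  have "continuous_map (subtopology (Rn n) V) euclidean (\<lambda>x. f x + g x)"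
    using Ck_on_continuous[OF Suc.prems(1)] Ck_on_continuous[OF Suc.prems(2)]
    by (auto intro!: continuous_map_complex_pair[where h = "\<lambda>p. fst p + snd p", simplified] continuous_intros)
  moreover have "\<exists>h. (\<forall>x\<in>V. ((\<lambda>t. f (x(i := t)) + g (x(i := t))) has_vector_derivative h x) (at (x i))) \<and> Ck_on k n V h"
    if i: "i < n" for i
  proof -
    obtain f' g' where "\<forall>x\<in>V. ((\<lambda>t. f (x(i := t))) has_vector_derivative f' x) (at (x i))" "Ck_on k n V f'"
      "\<forall>x\<in>V. ((\<lambda>t. g (x(i := t))) has_vector_derivative g' x) (at (x i))" "Ck_on k n V g'"
      using Suc.prems i unfolding Ck_on.simps by blast
    then show ?thesis using Suc.IH by (intro exI[of _ "\<lambda>x. f' x + g' x"]) (auto intro!: derivative_intros)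
  qed
  ultimately show ?case by simp
qed

lemma Ck_on_mult:
  assumes "Ck_on k n V f" "Ck_on k n V g"
  shows "Ck_on k n V (\<lambda>x. f x * g x)"
  using assms
proof (induction k arbitrary: f g)
  case 0
  then show ?case by (auto intro!: continuous_map_complex_pair[where h = "\<lambda>p. fst p * snd p", simplified] continuous_intros)
next
  case (Suc k)
  have "continuous_map (subtopology (Rn n) V) euclidean (\<lambda>x. f x * g x)"
    using Ck_on_continuous[OF Suc.prems(1)] Ck_on_continuous[OF Suc.prems(2)]
    by (auto intro!: continuous_map_complex_pair[where h = "\<lambda>p. fst p * snd p", simplified] continuous_intros)
  moreover have "\<exists>h. (\<forall>x\<in>V. ((\<lambda>t. f (x(i := t)) * g (x(i := t))) has_vector_derivative h x) (at (x i))) \<and> Ck_on k n V h"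
    if i: "i < n" for i
  proof -
    obtain f' g' where d: "\<forall>x\<in>V. ((\<lambda>t. f (x(i := t))) has_vector_derivative f' x) (at (x i))" "Ck_on k n V f'"
      "\<forall>x\<in>V. ((\<lambda>t. g (x(i := t))) has_vector_derivative g' x) (at (x i))" "Ck_on k n V g'"
      using Suc.prems i unfolding Ck_on.simps by blast
    show ?thesis
    \<comment> \<open>Each term of the Leibniz rule is a product of a derivative and an
      undifferentiated factor; the latter loses one order by \<open>Ck_on_SucD\<close>, so that the
      induction hypothesis covers both.\<close>
    proof (intro exI[of _ "\<lambda>x. f x * g' x + f' x * g x"] conjI ballI)
      fix x assume "x \<in> V"
      with d have "((\<lambda>t. f (x(i := t))) has_vector_derivative f' x) (at (x i))"
        "((\<lambda>t. g (x(i := t))) has_vector_derivative g' x) (at (x i))" by auto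
      from has_vector_derivative_mult[OF this]
      show "((\<lambda>t. f (x(i := t)) * g (x(i := t))) has_vector_derivative f x * g' x + f' x * g x) (at (x i))"
        by simp
    qed (use d Suc.prems in \<open>auto intro!: Ck_on_add Suc.IH dest: Ck_on_SucD simp del: Ck_on.simps\<close>)
  qed
  ultimately show ?case by simp
qed

text \<open>The derivative of 1/f involves only 1/f and f', so regularity of 1/f at one level yields
  the next.\<close>

lemma Ck_on_inverse:
  assumes "Ck_on k n V f" "\<And>x. x \<in> V \<Longrightarrow> f x \<noteq> 0"
  shows "Ck_on k n V (\<lambda>x. inverse (f x))"
proof -
  have cont: "continuous_map (subtopology (Rn n) V) euclidean (\<lambda>x. inverse (f x))"
  proof -
    have "continuous_map (subtopology (Rn n) V) (top_of_set (- {0})) f"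
      using Ck_on_continuous[OF assms(1)] assms(2) by (auto simp: continuous_map_in_subtopology)
    moreover have "continuous_on (- {0}) (inverse :: complex \<Rightarrow> complex)"
      by (intro continuous_on_inverse continuous_on_id) auto
    ultimately show ?thesis using continuous_map_compose[of _ "top_of_set (- {0})" f euclidean inverse]
      by (simp add: o_def)
  qed
  show ?thesis using assms(1)
  proof (induction k)
    case 0
    then show ?case using cont by simp
  next
    case (Suc k)
    have IH: "Ck_on k n V (\<lambda>x. inverse (f x))" using Suc Ck_on_SucD by blast
    have "\<exists>h. (\<forall>x\<in>V. ((\<lambda>t. inverse (f (x(i := t)))) has_vector_derivative h x) (at (x i))) \<and> Ck_on k n V h"
      if i: "i < n" for i
    proof -
      obtain f' where d: "\<forall>x\<in>V. ((\<lambda>t. f (x(i := t))) has_vector_derivative f' x) (at (x i))" "Ck_on k n V f'"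
        using Suc.prems i by auto
      show ?thesis
      \<comment> \<open>This is -f'/f^2, written as nested products so that
        \<open>Ck_on_mult\<close> and \<open>Ck_on_const\<close> apply.\<close>
      proof (intro exI[of _ "\<lambda>x. (-1) * (inverse (f x) * (f' x * inverse (f x)))"] conjI ballI)
        fix x assume x: "x \<in> V"
        with d have "((\<lambda>t. f (x(i := t))) has_vector_derivative f' x) (at (x i))" by auto
        then have "((\<lambda>t. f (x(i := t))) has_derivative (\<lambda>h. h *\<^sub>R f' x)) (at (x i))"
          by (simp add: has_vector_derivative_def)
        from Deriv.has_derivative_inverse[OF _ this] assms(2)[OF x]
        show "((\<lambda>t. inverse (f (x(i := t)))) has_vector_derivative (-1) * (inverse (f x) * (f' x * inverse (f x)))) (at (x i))"
          by (simp add: has_vector_derivative_def algebra_simps)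
      qed (intro Ck_on_mult Ck_on_const IH d)
    qed
    then show ?case using cont by simp
  qed
qed

lemma smooth_on_Rn_const: "smooth_on_Rn n V (\<lambda>_. c)"
  by (simp add: smooth_on_Rn_def Ck_on_const)

lemma smooth_on_Rn_add: "smooth_on_Rn n V f \<Longrightarrow> smooth_on_Rn n V g \<Longrightarrow> smooth_on_Rn n V (\<lambda>x. f x + g x)"
  by (simp add: smooth_on_Rn_def Ck_on_add)

lemma smooth_on_Rn_mult: "smooth_on_Rn n V f \<Longrightarrow> smooth_on_Rn n V g \<Longrightarrow> smooth_on_Rn n V (\<lambda>x. f x * g x)"
  by (simp add: smooth_on_Rn_def Ck_on_mult)

lemma smooth_on_Rn_inverse:
  "smooth_on_Rn n V f \<Longrightarrow> (\<And>x. x \<in> V \<Longrightarrow> f x \<noteq> 0) \<Longrightarrow> smooth_on_Rn n V (\<lambda>x. inverse (f x))"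
  by (simp add: smooth_on_Rn_def Ck_on_inverse)

lemma smooth_on_Rn_sum:
  "(\<And>i. i \<in> I \<Longrightarrow> smooth_on_Rn n V (f i)) \<Longrightarrow> smooth_on_Rn n V (\<lambda>x. \<Sum>i\<in>I. f i x)"
  by (induction I rule: infinite_finite_induct) (auto intro: smooth_on_Rn_const smooth_on_Rn_add)

lemma smooth_on_Rn_prod:
  "(\<And>i. i \<in> I \<Longrightarrow> smooth_on_Rn n V (f i)) \<Longrightarrow> smooth_on_Rn n V (\<lambda>x. \<Prod>i\<in>I. f i x)"
  by (induction I rule: infinite_finite_induct) (auto intro: smooth_on_Rn_const smooth_on_Rn_mult)

lemma smooth_on_Rn_subset: "smooth_on_Rn n V f \<Longrightarrow> W \<subseteq> V \<Longrightarrow> smooth_on_Rn n W f"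
  unfolding smooth_on_Rn_def by (blast intro: Ck_on_subset)

lemma smooth_on_Rn_cong:
  "openin (Rn n) V \<Longrightarrow> smooth_on_Rn n V f \<Longrightarrow> (\<And>x. x \<in> V \<Longrightarrow> f x = g x) \<Longrightarrow> smooth_on_Rn n V g"
  unfolding smooth_on_Rn_def by (blast intro: Ck_on_cong)

lemma smooth_on_Rn_local:
  assumes "openin (Rn n) V"
    and "\<And>x. x \<in> V \<Longrightarrow> \<exists>W. openin (Rn n) W \<and> x \<in> W \<and> W \<subseteq> V \<and> smooth_on_Rn n W f"
  shows "smooth_on_Rn n V f"
  using Ck_on_local[OF assms(1)] assms(2) unfolding smooth_on_Rn_def by meson

lemma smooth_on_Rn_continuous:
  "smooth_on_Rn n V f \<Longrightarrow> continuous_map (subtopology (Rn n) V) euclidean f"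
  by (auto simp: smooth_on_Rn_def dest: Ck_on_continuous)

text \<open>\<open>flat_fun 0\<close> is \<open>e\<^bsup>-1/t\<^esup>\<close>; dividing by \<open>t\<^bsup>m\<^esup>\<close> gives a family that is closed under derivatives.\<close>

definition flat_fun :: "nat \<Rightarrow> real \<Rightarrow> real" where
  "flat_fun m t = (if t \<le> 0 then 0 else exp (- 1 / t) / t ^ m)"

text \<open>Under the substitution s = 1/t this is the limit of s^m / e^s at infinity.\<close>

lemma flat_fun_tendsto_0: "(flat_fun m \<longlongrightarrow> 0) (at_right 0)"
proof -
  have "((\<lambda>s::real. s ^ m / exp s) \<longlongrightarrow> 0) at_top"
    by (rule tendsto_power_div_exp_0)
  then have "((\<lambda>t::real. inverse t ^ m / exp (inverse t)) \<longlongrightarrow> 0) (at_right 0)"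
    by (rule filterlim_compose[OF _ filterlim_inverse_at_top_right])
  moreover have "eventually (\<lambda>t::real. inverse t ^ m / exp (inverse t) = flat_fun m t) (at_right 0)"
    using eventually_at_right_less[of "0::real"]
    by eventually_elim (simp add: flat_fun_def exp_minus divide_simps)
  ultimately show ?thesis using tendsto_cong by force
qed

text \<open>For t > 0 this is the product rule. At 0 the difference quotient of
  \<open>flat_fun m\<close> from the right is \<open>flat_fun (m + 1)\<close>, which tends to 0; so
  differentiability at 0 is the limit statement for the next exponent.\<close>

lemma flat_fun_deriv:
  "(flat_fun m has_real_derivative (flat_fun (m + 2) t - real m * flat_fun (m + 1) t)) (at t)"
proof -
  consider "t < 0" | "t = 0" | "t > 0" by linarith
  then show ?thesis
  proof cases
    case 1
    have "((\<lambda>t. 0) has_real_derivative 0) (at t)" by simp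
    moreover have "open {..<0::real}" "t \<in> {..<0}" using 1 by auto
    ultimately have "(flat_fun m has_real_derivative 0) (at t)"
      by (rule has_field_derivative_transform_within_open) (auto simp: flat_fun_def)
    then show ?thesis using 1 by (simp add: flat_fun_def)
  next
    case 2
    have "((\<lambda>h. (flat_fun m (0 + h) - flat_fun m 0) / h) \<longlongrightarrow> 0) (at 0)"
    proof -
      have "eventually (\<lambda>h. flat_fun (m + 1) h = (flat_fun m (0 + h) - flat_fun m 0) / h) (at_right 0)"
        using eventually_at_right_less[of "0::real"]
        by eventually_elim (simp add: flat_fun_def)
      then have r: "((\<lambda>h. (flat_fun m (0 + h) - flat_fun m 0) / h) \<longlongrightarrow> 0) (at_right 0)"
        using flat_fun_tendsto_0[of "m + 1"] tendsto_cong by force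
      have "eventually (\<lambda>h::real. h < 0) (at_left 0)"
        by (simp add: eventually_at_filter)
      then have "eventually (\<lambda>h. 0 = (flat_fun m (0 + h) - flat_fun m 0) / h) (at_left 0)"
        by eventually_elim (simp add: flat_fun_def)
      then have "((\<lambda>h. (flat_fun m (0 + h) - flat_fun m 0) / h) \<longlongrightarrow> 0) (at_left 0)"
        by (rule Lim_transform_eventually[rotated]) simp
      with r show ?thesis by (simp add: filterlim_split_at_real)
    qed
    then show ?thesis using 2 by (simp add: DERIV_def flat_fun_def)
  next
    case 3
    have "((\<lambda>t. exp (- 1 / t) / t ^ m) has_real_derivative (flat_fun (m + 2) t - real m * flat_fun (m + 1) t)) (at t)"
      using 3
      apply (auto intro!: derivative_eq_intros simp: flat_fun_def)
      apply (cases m; simp add: field_simps power2_eq_square)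
      done
    moreover have "open {0::real<..}" "t \<in> {0<..}" using 3 by auto
    ultimately show ?thesis
      by (rule has_field_derivative_transform_within_open) (auto simp: flat_fun_def)
  qed
qed

lemma flat_fun_nonneg: "0 \<le> flat_fun m t"
  by (simp add: flat_fun_def)

lemma flat_fun_pos: "0 < t \<Longrightarrow> 0 < flat_fun m t"
  by (simp add: flat_fun_def)

text \<open>The induction runs over all \<open>m\<close> at once, as a derivative of
  \<open>flat_fun m\<close> is a combination of \<open>flat_fun (m + 2)\<close> and
  \<open>flat_fun (m + 1)\<close>. The affine argument admits both t and 1 - t, which
  \<open>smooth_step\<close> combines.\<close>

lemma smooth_on_Rn_flat_fun:
  assumes "i < n" "V \<subseteq> topspace (Rn n)"
  shows "smooth_on_Rn n V (\<lambda>x. complex_of_real (flat_fun m (a * x i + b)))"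
proof -
  have cont: "continuous_map (subtopology (Rn n) V) euclidean (\<lambda>x. complex_of_real (flat_fun m (a * x i + b)))" for m
  proof -
    have "continuous_on UNIV (flat_fun m)"
      using flat_fun_deriv DERIV_isCont continuous_at_imp_continuous_on by blast
    moreover have "continuous_on UNIV (\<lambda>t. a * t + b)"
      by (intro continuous_intros)
    ultimately have "continuous_on UNIV (\<lambda>t. flat_fun m (a * t + b))"
      by (rule continuous_on_compose2) simp
    then have "continuous_on UNIV (\<lambda>t. complex_of_real (flat_fun m (a * t + b)))"
      by (rule continuous_on_of_real)
    moreover have "continuous_map (subtopology (Rn n) V) euclideanreal (\<lambda>x. x i)"
      using assms by (intro continuous_map_from_subtopology continuous_map_product_projection) auto
    ultimately show ?thesis
      using continuous_map_compose[of _ _ "\<lambda>x. x i" _ "\<lambda>t. complex_of_real (flat_fun m (a * t + b))"]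
      by (simp add: o_def)
  qed
  have "Ck_on k n V (\<lambda>x. complex_of_real (flat_fun m (a * x i + b)))" for k
  proof (induction k arbitrary: m)
    case 0
    then show ?case using cont by simp
  next
    case (Suc k)
    have "\<exists>g. (\<forall>x\<in>V. ((\<lambda>t. complex_of_real (flat_fun m (a * (x(j := t)) i + b))) has_vector_derivative g x) (at (x j))) \<and>
                Ck_on k n V g" if "j < n" for j
    proof (cases "j = i")
      case False
      then show ?thesis by (intro exI[of _ "\<lambda>_. 0"]) (auto intro: Ck_on_const)
    next
      case True
      let ?g = "\<lambda>x. of_real a * (complex_of_real (flat_fun (m + 2) (a * x i + b)) + (- of_nat m) * complex_of_real (flat_fun (m + 1) (a * x i + b)))"
      have "((\<lambda>t. complex_of_real (flat_fun m (a * (x(j := t)) i + b))) has_vector_derivative ?g x) (at (x j))" for x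
      proof -
        have "((\<lambda>t. flat_fun m (a * t + b)) has_real_derivative
           (flat_fun (m + 2) (a * x i + b) - real m * flat_fun (m + 1) (a * x i + b)) * a) (at (x i))"
          by (rule DERIV_chain'[OF _ flat_fun_deriv]) (auto intro!: derivative_eq_intros)
        then have "((\<lambda>t. complex_of_real (flat_fun m (a * t + b))) has_vector_derivative
           of_real ((flat_fun (m + 2) (a * x i + b) - real m * flat_fun (m + 1) (a * x i + b)) * a)) (at (x i))"
          by (intro has_vector_derivative_of_real) (simp add: has_real_derivative_iff_has_vector_derivative)
        then show ?thesis using True by (simp add: algebra_simps)
      qed
      moreover have "Ck_on k n V ?g"
        by (intro Ck_on_mult Ck_on_add Ck_on_const Suc.IH)
      ultimately show ?thesis by (intro exI[of _ ?g]) simp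
    qed
    then show ?case using cont by simp
  qed
  then show ?thesis by (simp add: smooth_on_Rn_def)
qed

section \<open>Smooth steps and bumps on Euclidean space\<close>

text \<open>The standard smooth transition from 0 on t \<le> 0 to 1 on t \<ge> 1. The two terms of
  the denominator never vanish together.\<close>

definition smooth_step :: "real \<Rightarrow> real" where
  "smooth_step t = flat_fun 0 t / (flat_fun 0 t + flat_fun 0 (1 - t))"

lemma smooth_step_denom: "0 < flat_fun 0 t + flat_fun 0 (1 - t)"
  using flat_fun_pos[of t 0] flat_fun_pos[of "1 - t" 0] flat_fun_nonneg[of 0 t] flat_fun_nonneg[of 0 "1 - t"]
  by (cases "0 < t") auto

lemma smooth_step_01: "smooth_step t \<in> {0..1}"
  using smooth_step_denom[of t] flat_fun_nonneg[of 0 t] flat_fun_nonneg[of 0 "1 - t"]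
  by (auto simp: smooth_step_def divide_simps)

lemma smooth_step_eq_0: "t \<le> 0 \<Longrightarrow> smooth_step t = 0"
  by (simp add: smooth_step_def flat_fun_def)

lemma smooth_step_eq_1: "1 \<le> t \<Longrightarrow> smooth_step t = 1"
  using smooth_step_denom[of t] by (simp add: smooth_step_def flat_fun_def)

lemma smooth_on_Rn_smooth_step:
  assumes "i < n" "V \<subseteq> topspace (Rn n)"
  shows "smooth_on_Rn n V (\<lambda>x. complex_of_real (smooth_step (a * x i + b)))"
proof -
  have "smooth_on_Rn n V (\<lambda>x. complex_of_real (flat_fun 0 (a * x i + b)) *
     inverse (complex_of_real (flat_fun 0 (a * x i + b)) + complex_of_real (flat_fun 0 ((- a) * x i + (1 - b)))))"
  proof (intro smooth_on_Rn_mult smooth_on_Rn_inverse smooth_on_Rn_add smooth_on_Rn_flat_fun assms)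
    fix x
    have "flat_fun 0 (a * x i + b) + flat_fun 0 ((- a) * x i + (1 - b)) \<noteq> 0"
      using smooth_step_denom[of "a * x i + b"] by (simp add: algebra_simps)
    then show "complex_of_real (flat_fun 0 (a * x i + b)) + complex_of_real (flat_fun 0 ((- a) * x i + (1 - b))) \<noteq> 0"
      by (metis of_real_add of_real_eq_0_iff)
  qed
  then show ?thesis
    by (simp add: smooth_step_def divide_inverse algebra_simps)
qed

text \<open>A product over the coordinates of a rising and a falling step: the bump is 1 on the open
  cube \<open>N\<close> of half side r around \<open>a\<close> and 0 off the closed cube
  \<open>L\<close> of half side 2r.\<close>

lemma bump_on_Rn:
  assumes "openin (Rn n) V" "a \<in> V"
  obtains b N L where "smooth_on_Rn n (topspace (Rn n)) b" "openin (Rn n) N" "a \<in> N" "N \<subseteq> L"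
    "compactin (Rn n) L" "L \<subseteq> V" "\<And>x. x \<in> N \<Longrightarrow> b x = 1"
    "\<And>x. x \<in> topspace (Rn n) - L \<Longrightarrow> b x = 0" "\<And>x. \<exists>t\<in>{0..1}. b x = complex_of_real t"
proof -
  obtain U where U: "\<And>i. i < n \<Longrightarrow> open (U i)" "a \<in> PiE {..<n} U" "PiE {..<n} U \<subseteq> V"
  proof -
    from assms[unfolded openin_product_topology_alt] obtain U where
      "\<forall>i\<in>{..<n}. openin euclideanreal (U i)" "a \<in> PiE {..<n} U" "PiE {..<n} U \<subseteq> V"
      by blast
    then show thesis by (intro that[of U]) auto
  qed
  have "\<exists>e>0. cball (a i) e \<subseteq> U i" if "i < n" for i
  proof -
    have "a i \<in> U i" using PiE_mem[OF U(2)] that by simp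
    with U(1)[OF that] show ?thesis by (auto simp: open_contains_cball)
  qed
  then obtain e where e: "\<And>i. i < n \<Longrightarrow> e i > 0 \<and> cball (a i) (e i) \<subseteq> U i" by metis
  \<comment> \<open>Inserting 1 keeps the minimum defined for n = 0. Halving makes the closed cube
    of half side 2r fit into the product of the sets \<open>U i\<close>.\<close>
  define r where "r = Min (insert 1 (e ` {..<n})) / 2"
  have r: "r > 0" using e by (auto simp: r_def)
  have re: "2 * r \<le> e i" if "i < n" for i
    using that by (auto simp: r_def)
  define N where "N = PiE {..<n} (\<lambda>i. {a i - r<..<a i + r})"
  define L where "L = PiE {..<n} (\<lambda>i. {a i - 2 * r..a i + 2 * r})"
  \<comment> \<open>With s = (x i - a i) / r the arguments are s + 2 and 2 - s: both are at least 1
    for -1 \<le> s \<le> 1, and one of them is at most 0 as soon as s leaves the interval from -2 to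
    2.\<close>
  define b where "b x = (\<Prod>i<n. complex_of_real (smooth_step ((1 / r) * x i + (2 - a i / r))) *
      complex_of_real (smooth_step ((- 1 / r) * x i + (2 + a i / r))))" for x
  have aext: "a \<in> extensional {..<n}" using U(2) by (auto simp: PiE_def)
  show thesis
  proof (rule that)
    show "smooth_on_Rn n (topspace (Rn n)) b"
      unfolding b_def by (intro smooth_on_Rn_prod smooth_on_Rn_mult smooth_on_Rn_smooth_step) auto
    show "openin (Rn n) N" unfolding N_def by (simp add: openin_PiE)
    show "a \<in> N" using r aext by (auto simp: N_def PiE_def)
    show "N \<subseteq> L" unfolding N_def L_def using r by (intro PiE_mono) auto
    show "compactin (Rn n) L" unfolding L_def by (auto simp: compactin_PiE)
    have "{a i - 2 * r..a i + 2 * r} \<subseteq> U i" if "i < n" for i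
      using e[OF that] re[OF that] by (force simp: cball_def dist_real_def subset_iff)
    then have "L \<subseteq> PiE {..<n} U" unfolding L_def by (intro PiE_mono) auto
    with U show "L \<subseteq> V" by blast
    show "b x = 1" if "x \<in> N" for x
      unfolding b_def
    proof (intro prod.neutral ballI)
      fix i assume "i \<in> {..<n}"
      then have "x i \<in> {a i - r<..<a i + r}" using that by (auto simp: N_def PiE_def Pi_iff)
      then have "- 1 \<le> (x i - a i) / r" "(x i - a i) / r \<le> 1"
        using r by (simp_all add: pos_le_divide_eq pos_divide_le_eq)
      then have "1 \<le> (1 / r) * x i + (2 - a i / r)" "1 \<le> (- 1 / r) * x i + (2 + a i / r)"
        by (simp_all add: diff_divide_distrib)
      then show "complex_of_real (smooth_step ((1 / r) * x i + (2 - a i / r))) *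
         complex_of_real (smooth_step ((- 1 / r) * x i + (2 + a i / r))) = 1"
        using smooth_step_eq_1 by simp
    qed
    show "b x = 0" if "x \<in> topspace (Rn n) - L" for x
    proof -
      have "\<exists>i<n. x i \<notin> {a i - 2 * r..a i + 2 * r}"
        using that unfolding L_def by (auto simp: PiE_iff)
      then obtain i where i: "i < n" "x i \<notin> {a i - 2 * r..a i + 2 * r}" by blast
      then have "(x i - a i) / r \<le> - 2 \<or> 2 \<le> (x i - a i) / r"
        using r by (auto simp: pos_le_divide_eq pos_divide_le_eq)
      then have "(1 / r) * x i + (2 - a i / r) \<le> 0 \<or> (- 1 / r) * x i + (2 + a i / r) \<le> 0"
        by (auto simp: diff_divide_distrib)
      then have "complex_of_real (smooth_step ((1 / r) * x i + (2 - a i / r))) *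
         complex_of_real (smooth_step ((- 1 / r) * x i + (2 + a i / r))) = 0"
        using smooth_step_eq_0 by auto
      then show ?thesis unfolding b_def using i by (intro prod_zero) auto
    qed
    show "\<exists>t\<in>{0..1}. b x = complex_of_real t" for x
    proof
      let ?t = "\<Prod>i<n. smooth_step ((1 / r) * x i + (2 - a i / r)) * smooth_step ((- 1 / r) * x i + (2 + a i / r))"
      show "b x = complex_of_real ?t" by (simp add: b_def)
      show "?t \<in> {0..1}"
        using smooth_step_01 by (auto intro!: prod_nonneg prod_le_1 mult_le_one simp del: times_divide_eq_left)
    qed
  qed
qed

section \<open>Stalks and residues\<close>

locale formal_mfd =
  fixes X :: "'m topology" and \<O> :: "('m, complex, 'o) presheaf"
  assumes formal_manifold: "formal_manifold X \<O>"
begin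

lemma sheaf_O: "sheaf_on X \<O>"
  using formal_manifold by (simp add: formal_manifold_def locally_ringed_space_def sheaf_of_algebras_def)

lemma algebra_O: "openin X U \<Longrightarrow> Module.algebra complex_field (sections \<O> U)"
  using formal_manifold by (simp add: formal_manifold_def locally_ringed_space_def sheaf_of_algebras_def)

lemma cring_O: "openin X U \<Longrightarrow> cring (sections \<O> U)"
  using algebra_O algebra.M_cring by blast

lemma restr_hom: "openin X U \<Longrightarrow> openin X V \<Longrightarrow> V \<subseteq> U \<Longrightarrow> restr \<O> U V \<in> ring_hom (sections \<O> U) (sections \<O> V)"
  using formal_manifold by (simp add: formal_manifold_def locally_ringed_space_def sheaf_of_algebras_def)

lemma restr_smult:
  "openin X U \<Longrightarrow> openin X V \<Longrightarrow> V \<subseteq> U \<Longrightarrow> f \<in> carrier (sections \<O> U) \<Longrightarrow>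
   restr \<O> U V (c \<odot>\<^bsub>sections \<O> U\<^esub> f) = c \<odot>\<^bsub>sections \<O> V\<^esub> restr \<O> U V f"
  using formal_manifold by (simp add: formal_manifold_def locally_ringed_space_def sheaf_of_algebras_def)

lemma restr_closed [simp]:
  "openin X U \<Longrightarrow> openin X V \<Longrightarrow> V \<subseteq> U \<Longrightarrow> f \<in> carrier (sections \<O> U) \<Longrightarrow>
   restr \<O> U V f \<in> carrier (sections \<O> V)"
  using ring_hom_closed[OF restr_hom] by blast

lemma restr_self: "openin X U \<Longrightarrow> f \<in> carrier (sections \<O> U) \<Longrightarrow> restr \<O> U U f = f"
  using sheaf_O unfolding sheaf_on_def presheaf_on_def by blast

lemma restr_restr:
  "openin X U \<Longrightarrow> openin X V \<Longrightarrow> openin X W \<Longrightarrow> W \<subseteq> V \<Longrightarrow> V \<subseteq> U \<Longrightarrow> f \<in> carrier (sections \<O> U) \<Longrightarrow>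
   restr \<O> V W (restr \<O> U V f) = restr \<O> U W f"
  using sheaf_O unfolding sheaf_on_def presheaf_on_def by blast

lemma restr_add:
  "openin X U \<Longrightarrow> openin X V \<Longrightarrow> V \<subseteq> U \<Longrightarrow> f \<in> carrier (sections \<O> U) \<Longrightarrow> g \<in> carrier (sections \<O> U) \<Longrightarrow>
   restr \<O> U V (f \<oplus>\<^bsub>sections \<O> U\<^esub> g) = restr \<O> U V f \<oplus>\<^bsub>sections \<O> V\<^esub> restr \<O> U V g"
  using ring_hom_add[OF restr_hom] by blast

lemma restr_mult:
  "openin X U \<Longrightarrow> openin X V \<Longrightarrow> V \<subseteq> U \<Longrightarrow> f \<in> carrier (sections \<O> U) \<Longrightarrow> g \<in> carrier (sections \<O> U) \<Longrightarrow>
   restr \<O> U V (f \<otimes>\<^bsub>sections \<O> U\<^esub> g) = restr \<O> U V f \<otimes>\<^bsub>sections \<O> V\<^esub> restr \<O> U V g"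
  using ring_hom_mult[OF restr_hom] by blast

lemma restr_one:
  "openin X U \<Longrightarrow> openin X V \<Longrightarrow> V \<subseteq> U \<Longrightarrow> restr \<O> U V \<one>\<^bsub>sections \<O> U\<^esub> = \<one>\<^bsub>sections \<O> V\<^esub>"
  using ring_hom_one[OF restr_hom] by blast

lemma restr_zero:
  "openin X U \<Longrightarrow> openin X V \<Longrightarrow> V \<subseteq> U \<Longrightarrow> restr \<O> U V \<zero>\<^bsub>sections \<O> U\<^esub> = \<zero>\<^bsub>sections \<O> V\<^esub>"
  using ring_hom_zero[OF restr_hom] cring_O cring.axioms(1) by blast

lemma smult_O_closed:
  "openin X U \<Longrightarrow> f \<in> carrier (sections \<O> U) \<Longrightarrow> c \<odot>\<^bsub>sections \<O> U\<^esub> f \<in> carrier (sections \<O> U)"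
  using module.smult_closed[OF algebra.module[OF algebra_O]] by (simp add: complex_field_def)

lemma one_O_closed: "openin X U \<Longrightarrow> \<one>\<^bsub>sections \<O> U\<^esub> \<in> carrier (sections \<O> U)"
  by (rule ring.ring_simprules(6)[OF cring.axioms(1)[OF cring_O]])

lemma zero_O_closed: "openin X U \<Longrightarrow> \<zero>\<^bsub>sections \<O> U\<^esub> \<in> carrier (sections \<O> U)"
  by (rule ring.ring_simprules(2)[OF cring.axioms(1)[OF cring_O]])

lemma add_O_closed: "openin X U \<Longrightarrow> f \<in> carrier (sections \<O> U) \<Longrightarrow> g \<in> carrier (sections \<O> U) \<Longrightarrow>
   f \<oplus>\<^bsub>sections \<O> U\<^esub> g \<in> carrier (sections \<O> U)"
  by (rule ring.ring_simprules(1)[OF cring.axioms(1)[OF cring_O]])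

lemma mult_O_closed: "openin X U \<Longrightarrow> f \<in> carrier (sections \<O> U) \<Longrightarrow> g \<in> carrier (sections \<O> U) \<Longrightarrow>
   f \<otimes>\<^bsub>sections \<O> U\<^esub> g \<in> carrier (sections \<O> U)"
  by (rule ring.ring_simprules(5)[OF cring.axioms(1)[OF cring_O]])

section \<open>Germs and the operations of the stalk\<close>

text \<open>Transitivity of equality of germs: the neighbourhoods on which two pairs of
  representatives agree are intersected. The reverse inclusion is the same statement with the roles
  exchanged.\<close>

lemma germ_subset:
  assumes U: "openin X U" "s \<in> carrier (sections \<O> U)" and V: "openin X V" "t \<in> carrier (sections \<O> V)"
    and W: "openin X W" "a \<in> W" "W \<subseteq> U \<inter> V" "restr \<O> U W s = restr \<O> V W t"
  shows "germ X \<O> a U s \<subseteq> germ X \<O> a V t"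
proof -
  have "(Z, r) \<in> germ X \<O> a V t" if "(Z, r) \<in> germ X \<O> a U s" for Z r
  proof -
    from that obtain W' where Z: "openin X Z" "a \<in> Z" "r \<in> carrier (sections \<O> Z)"
      "openin X W'" "a \<in> W'" "W' \<subseteq> U \<inter> Z" "restr \<O> U W' s = restr \<O> Z W' r"
      by (auto simp: germ_def)
    let ?W = "W \<inter> W'"
    have o: "openin X ?W" using W Z by blast
    have "restr \<O> V ?W t = restr \<O> W ?W (restr \<O> V W t)" using W V o by (subst restr_restr) auto
    also have "\<dots> = restr \<O> U ?W s" unfolding W(4)[symmetric] using W U o by (subst restr_restr) auto
    also have "\<dots> = restr \<O> W' ?W (restr \<O> U W' s)" using Z U o by (subst restr_restr) auto
    also have "\<dots> = restr \<O> Z ?W r" unfolding Z(7) using Z o by (subst restr_restr) auto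
    finally show ?thesis using Z W o by (auto simp: germ_def intro!: exI[of _ ?W])
  qed
  then show ?thesis by auto
qed

lemma germ_cong:
  assumes "openin X U" "s \<in> carrier (sections \<O> U)" "openin X V" "t \<in> carrier (sections \<O> V)"
    and "openin X W" "a \<in> W" "W \<subseteq> U \<inter> V" "restr \<O> U W s = restr \<O> V W t"
  shows "germ X \<O> a U s = germ X \<O> a V t"
  using germ_subset[OF assms] germ_subset[OF assms(3,4,1,2,5,6) _ assms(8)[symmetric]] assms(7) by blast

lemma germ_memD:
  assumes "(V, t) \<in> germ X \<O> a U s"
  shows "openin X V" "a \<in> V" "t \<in> carrier (sections \<O> V)"
  using assms by (auto simp: germ_def)

lemma germ_mem_self:
  assumes "openin X U" "a \<in> U" "s \<in> carrier (sections \<O> U)"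
  shows "(U, s) \<in> germ X \<O> a U s"
  using assms by (auto simp: germ_def)

lemma germ_restr:
  assumes "openin X U" "s \<in> carrier (sections \<O> U)" "openin X V" "a \<in> V" "V \<subseteq> U"
  shows "germ X \<O> a V (restr \<O> U V s) = germ X \<O> a U s"
  by (rule germ_cong[where W = V]) (use assms in \<open>auto simp: restr_self\<close>)

text \<open>The operations of \<open>stalk\<close> are unions over all representatives. All members
  of such a union are equal, so it collapses to the member for the given pair. \<open>F\<close>
  stands for addition or multiplication, the two instances used.\<close>

lemma germ_operation:
  assumes closed: "\<And>W x y. openin X W \<Longrightarrow> x \<in> carrier (sections \<O> W) \<Longrightarrow> y \<in> carrier (sections \<O> W) \<Longrightarrow>
      F W x y \<in> carrier (sections \<O> W)"
    and compat: "\<And>V W x y. openin X V \<Longrightarrow> openin X W \<Longrightarrow> W \<subseteq> V \<Longrightarrow> x \<in> carrier (sections \<O> V) \<Longrightarrow>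
      y \<in> carrier (sections \<O> V) \<Longrightarrow> restr \<O> V W (F V x y) = F W (restr \<O> V W x) (restr \<O> V W y)"
    and U: "openin X U" "a \<in> U" "s \<in> carrier (sections \<O> U)"
    and V: "openin X V" "a \<in> V" "t \<in> carrier (sections \<O> V)"
  shows "(\<Union>(U, s)\<in>germ X \<O> a U s. \<Union>(V, t)\<in>germ X \<O> a V t.
           germ X \<O> a (U \<inter> V) (F (U \<inter> V) (restr \<O> U (U \<inter> V) s) (restr \<O> V (U \<inter> V) t))) =
         germ X \<O> a (U \<inter> V) (F (U \<inter> V) (restr \<O> U (U \<inter> V) s) (restr \<O> V (U \<inter> V) t))"
proof -
  have eq: "germ X \<O> a (U' \<inter> V') (F (U' \<inter> V') (restr \<O> U' (U' \<inter> V') s') (restr \<O> V' (U' \<inter> V') t')) =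
      germ X \<O> a (U \<inter> V) (F (U \<inter> V) (restr \<O> U (U \<inter> V) s) (restr \<O> V (U \<inter> V) t))"
    if m: "(U', s') \<in> germ X \<O> a U s" "(V', t') \<in> germ X \<O> a V t" for U' s' V' t'
  proof -
    note U' = germ_memD[OF m(1)] and V' = germ_memD[OF m(2)]
    obtain W1 where W1: "openin X W1" "a \<in> W1" "W1 \<subseteq> U \<inter> U'" "restr \<O> U W1 s = restr \<O> U' W1 s'"
      using m(1) by (auto simp: germ_def)
    obtain W2 where W2: "openin X W2" "a \<in> W2" "W2 \<subseteq> V \<inter> V'" "restr \<O> V W2 t = restr \<O> V' W2 t'"
      using m(2) by (auto simp: germ_def)
    let ?W = "W1 \<inter> W2"
    have o: "openin X ?W" "openin X (U' \<inter> V')" "openin X (U \<inter> V)" using W1 W2 U U' V V' by blast+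
    have s: "restr \<O> U ?W s = restr \<O> U' ?W s'"
    proof -
      have "restr \<O> U ?W s = restr \<O> W1 ?W (restr \<O> U W1 s)" using W1 U o by (subst restr_restr) auto
      also have "\<dots> = restr \<O> U' ?W s'" unfolding W1(4) using W1 U' o by (subst restr_restr) auto
      finally show ?thesis .
    qed
    have t: "restr \<O> V ?W t = restr \<O> V' ?W t'"
    proof -
      have "restr \<O> V ?W t = restr \<O> W2 ?W (restr \<O> V W2 t)" using W2 V o by (subst restr_restr) auto
      also have "\<dots> = restr \<O> V' ?W t'" unfolding W2(4) using W2 V' o by (subst restr_restr) auto
      finally show ?thesis .
    qed
    show ?thesis
    proof (rule germ_cong[where W = ?W])
      have sub: "?W \<subseteq> U \<inter> V" "?W \<subseteq> U' \<inter> V'" using W1 W2 by auto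
      show "restr \<O> (U' \<inter> V') ?W (F (U' \<inter> V') (restr \<O> U' (U' \<inter> V') s') (restr \<O> V' (U' \<inter> V') t')) =
        restr \<O> (U \<inter> V) ?W (F (U \<inter> V) (restr \<O> U (U \<inter> V) s) (restr \<O> V (U \<inter> V) t))"
        using U V U' V' o sub s t by (simp add: compat restr_restr)
    qed (use U V U' V' o W1 W2 in \<open>auto intro!: closed\<close>)
  qed
  show ?thesis
  proof (rule equalityI)
    show "(\<Union>(U, s)\<in>germ X \<O> a U s. \<Union>(V, t)\<in>germ X \<O> a V t.
           germ X \<O> a (U \<inter> V) (F (U \<inter> V) (restr \<O> U (U \<inter> V) s) (restr \<O> V (U \<inter> V) t))) \<subseteq>
         germ X \<O> a (U \<inter> V) (F (U \<inter> V) (restr \<O> U (U \<inter> V) s) (restr \<O> V (U \<inter> V) t))"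
      using eq by (intro UN_least) (auto split: prod.splits)
    show "germ X \<O> a (U \<inter> V) (F (U \<inter> V) (restr \<O> U (U \<inter> V) s) (restr \<O> V (U \<inter> V) t)) \<subseteq>
      (\<Union>(U, s)\<in>germ X \<O> a U s. \<Union>(V, t)\<in>germ X \<O> a V t.
           germ X \<O> a (U \<inter> V) (F (U \<inter> V) (restr \<O> U (U \<inter> V) s) (restr \<O> V (U \<inter> V) t)))"
      using germ_mem_self[OF U] germ_mem_self[OF V] by (intro subsetI UN_I[of "(U, s)"] UN_I[of "(V, t)"]) auto
  qed
qed

lemma stalk_add:
  assumes "openin X U" "a \<in> U" "s \<in> carrier (sections \<O> U)" "openin X V" "a \<in> V" "t \<in> carrier (sections \<O> V)"
  shows "germ X \<O> a U s \<oplus>\<^bsub>stalk X \<O> a\<^esub> germ X \<O> a V t =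
    germ X \<O> a (U \<inter> V) (restr \<O> U (U \<inter> V) s \<oplus>\<^bsub>sections \<O> (U \<inter> V)\<^esub> restr \<O> V (U \<inter> V) t)"
  using germ_operation[where F = "\<lambda>W. add (sections \<O> W)", OF add_O_closed restr_add assms] by (simp add: stalk_def)

lemma stalk_mult:
  assumes "openin X U" "a \<in> U" "s \<in> carrier (sections \<O> U)" "openin X V" "a \<in> V" "t \<in> carrier (sections \<O> V)"
  shows "germ X \<O> a U s \<otimes>\<^bsub>stalk X \<O> a\<^esub> germ X \<O> a V t =
    germ X \<O> a (U \<inter> V) (restr \<O> U (U \<inter> V) s \<otimes>\<^bsub>sections \<O> (U \<inter> V)\<^esub> restr \<O> V (U \<inter> V) t)"
  using germ_operation[where F = "\<lambda>W. mult (sections \<O> W)", OF mult_O_closed restr_mult assms] by (simp add: stalk_def)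

lemma local_ring_stalk: "a \<in> topspace X \<Longrightarrow> local_ring (stalk X \<O> a)"
  using formal_manifold by (simp add: formal_manifold_def locally_ringed_space_def)

end

lemma cring_complex_field: "cring complex_field"
proof -
  have "\<exists>y. x + y = 0" for x :: complex by (rule exI[of _ "-x"]) simp
  then show ?thesis
    by (intro cringI abelian_groupI comm_monoidI) (auto simp: complex_field_def algebra_simps)
qed

context formal_mfd begin

text \<open>Any locally defined evaluation is the residue, because its kernel is a maximal ideal of the stalk.\<close>

lemma eval_at_eq:
  fixes val :: "'m set \<Rightarrow> 'o \<Rightarrow> complex"
  assumes U0: "openin X U0" "a \<in> U0"
    and val_restr: "\<And>V W f. openin X V \<Longrightarrow> openin X W \<Longrightarrow> a \<in> W \<Longrightarrow> W \<subseteq> V \<Longrightarrow> V \<subseteq> U0 \<Longrightarrow>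
       f \<in> carrier (sections \<O> V) \<Longrightarrow> val W (restr \<O> V W f) = val V f"
    and val_add: "\<And>V f g. openin X V \<Longrightarrow> a \<in> V \<Longrightarrow> V \<subseteq> U0 \<Longrightarrow> f \<in> carrier (sections \<O> V) \<Longrightarrow>
       g \<in> carrier (sections \<O> V) \<Longrightarrow> val V (f \<oplus>\<^bsub>sections \<O> V\<^esub> g) = val V f + val V g"
    and val_mult: "\<And>V f g. openin X V \<Longrightarrow> a \<in> V \<Longrightarrow> V \<subseteq> U0 \<Longrightarrow> f \<in> carrier (sections \<O> V) \<Longrightarrow>
       g \<in> carrier (sections \<O> V) \<Longrightarrow> val V (f \<otimes>\<^bsub>sections \<O> V\<^esub> g) = val V f * val V g"
    and val_one: "\<And>V. openin X V \<Longrightarrow> a \<in> V \<Longrightarrow> V \<subseteq> U0 \<Longrightarrow> val V \<one>\<^bsub>sections \<O> V\<^esub> = 1"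
    and val_smult: "\<And>V f c. openin X V \<Longrightarrow> a \<in> V \<Longrightarrow> V \<subseteq> U0 \<Longrightarrow> f \<in> carrier (sections \<O> V) \<Longrightarrow>
       val V (c \<odot>\<^bsub>sections \<O> V\<^esub> f) = c * val V f"
    and V: "openin X V" "a \<in> V" "f \<in> carrier (sections \<O> V)"
  shows "eval_at X \<O> V f a = val (V \<inter> U0) (restr \<O> V (V \<inter> U0) f)"
proof -
  let ?R = "stalk X \<O> a"
  have a: "a \<in> topspace X" using U0 openin_subset by blast
  define ev where "ev g = (THE c. \<forall>(V, t)\<in>g. V \<subseteq> U0 \<longrightarrow> val V t = c)" for g
  define lv where "lv U s = val (U \<inter> U0) (restr \<O> U (U \<inter> U0) s)" for U s
  have ev: "ev (germ X \<O> a U s) = lv U s" if U: "openin X U" "a \<in> U" "s \<in> carrier (sections \<O> U)" for U s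
  proof -
    have mem: "(U \<inter> U0, restr \<O> U (U \<inter> U0) s) \<in> germ X \<O> a U s"
      using U U0 germ_mem_self[of "U \<inter> U0" a "restr \<O> U (U \<inter> U0) s"] germ_restr[of U s "U \<inter> U0" a] by auto
    have "val V t = lv U s" if t: "(V, t) \<in> germ X \<O> a U s" "V \<subseteq> U0" for V t
    proof -
      note V = germ_memD[OF t(1)]
      obtain W where W: "openin X W" "a \<in> W" "W \<subseteq> U \<inter> V" "restr \<O> U W s = restr \<O> V W t"
        using t by (auto simp: germ_def)
      have o: "openin X (U \<inter> U0)" "W \<subseteq> U \<inter> U0" using U U0 W t by auto
      have "val V t = val W (restr \<O> V W t)" using val_restr[of V W t] V W t by auto
      also have "\<dots> = val W (restr \<O> (U \<inter> U0) W (restr \<O> U (U \<inter> U0) s))"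
        using W(4) restr_restr[OF U(1) o(1) W(1) o(2) _ U(3)] by simp
      also have "\<dots> = lv U s" unfolding lv_def using o W U by (intro val_restr) auto
      finally show ?thesis .
    qed
    then show ?thesis unfolding ev_def using mem by (intro the_equality) auto
  qed
  have lv_restr: "lv W (restr \<O> U W s) = lv U s"
    if "openin X U" "a \<in> W" "s \<in> carrier (sections \<O> U)" "openin X W" "W \<subseteq> U" for U W s
    using ev[of W "restr \<O> U W s"] ev[of U s] germ_restr[of U s W a] that by auto
  have lv_add: "lv U (s \<oplus>\<^bsub>sections \<O> U\<^esub> t) = lv U s + lv U t"
    if "openin X U" "a \<in> U" "s \<in> carrier (sections \<O> U)" "t \<in> carrier (sections \<O> U)" for U s t
    using that U0 unfolding lv_def by (simp add: restr_add val_add openin_Int)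
  have lv_mult: "lv U (s \<otimes>\<^bsub>sections \<O> U\<^esub> t) = lv U s * lv U t"
    if "openin X U" "a \<in> U" "s \<in> carrier (sections \<O> U)" "t \<in> carrier (sections \<O> U)" for U s t
    using that U0 unfolding lv_def by (simp add: restr_mult val_mult openin_Int)
  have lv_one: "lv U \<one>\<^bsub>sections \<O> U\<^esub> = 1" if "openin X U" "a \<in> U" for U
    using that U0 unfolding lv_def by (simp add: restr_one val_one openin_Int)
  have lv_smult: "lv U (c \<odot>\<^bsub>sections \<O> U\<^esub> s) = c * lv U s"
    if "openin X U" "a \<in> U" "s \<in> carrier (sections \<O> U)" for U s c
    using that U0 unfolding lv_def by (simp add: restr_smult val_smult openin_Int)
  have R: "cring ?R" and uniq: "\<exists>!I. maximalideal I ?R"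
    using local_ring_stalk[OF a] by (auto simp: local_ring_def)
  interpret R: cring ?R by fact
  have carr: "\<exists>U s. g = germ X \<O> a U s \<and> openin X U \<and> a \<in> U \<and> s \<in> carrier (sections \<O> U)" if "g \<in> carrier ?R" for g
    using that by (auto simp: stalk_def)
  have carrI: "germ X \<O> a U s \<in> carrier ?R" if "openin X U" "a \<in> U" "s \<in> carrier (sections \<O> U)" for U s
    using that by (auto simp: stalk_def)
  have top: "openin X (topspace X)" by simp
  have one: "\<one>\<^bsub>?R\<^esub> = germ X \<O> a (topspace X) \<one>\<^bsub>sections \<O> (topspace X)\<^esub>"
    by (simp add: stalk_def)
  have ev_mult: "ev (g \<otimes>\<^bsub>?R\<^esub> h) = ev g * ev h" if gh: "g \<in> carrier ?R" "h \<in> carrier ?R" for g h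
  proof -
    obtain U s V t where 1: "g = germ X \<O> a U s" "openin X U" "a \<in> U" "s \<in> carrier (sections \<O> U)"
      and 2: "h = germ X \<O> a V t" "openin X V" "a \<in> V" "t \<in> carrier (sections \<O> V)"
      using carr[OF gh(1)] carr[OF gh(2)] by blast
    then show ?thesis
      by (simp add: stalk_mult ev openin_Int mult_O_closed lv_mult lv_restr)
  qed
  have ev_add: "ev (g \<oplus>\<^bsub>?R\<^esub> h) = ev g + ev h" if gh: "g \<in> carrier ?R" "h \<in> carrier ?R" for g h
  proof -
    obtain U s V t where 1: "g = germ X \<O> a U s" "openin X U" "a \<in> U" "s \<in> carrier (sections \<O> U)"
      and 2: "h = germ X \<O> a V t" "openin X V" "a \<in> V" "t \<in> carrier (sections \<O> V)"
      using carr[OF gh(1)] carr[OF gh(2)] by blast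
    then show ?thesis
      by (simp add: stalk_add ev openin_Int add_O_closed lv_add lv_restr)
  qed
  have ev_one: "ev \<one>\<^bsub>?R\<^esub> = 1"
    unfolding one using a by (simp add: ev one_O_closed lv_one)
  have hom: "ring_hom_ring ?R complex_field ev"
    by (rule ring_hom_ringI[OF R.ring_axioms cring.axioms(1)[OF cring_complex_field]])
      (auto simp: complex_field_def ev_mult ev_add ev_one)
  define K where "K = {g \<in> carrier ?R. ev g = 0}"
  have K_ideal: "ideal K ?R"
    using ring_hom_ring.kernel_is_ideal[OF hom] unfolding a_kernel_def' K_def by (simp add: complex_field_def)
  have "maximalideal K ?R"
  proof (rule maximalidealI[OF K_ideal])
    have "\<one>\<^bsub>?R\<^esub> \<notin> K" using ev_one by (simp add: K_def)
    then show "carrier ?R \<noteq> K" by auto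
  next
    fix J assume J: "ideal J ?R" "K \<subseteq> J" "J \<subseteq> carrier ?R"
    show "J = K \<or> J = carrier ?R"
    proof (cases "J = K")
      case False
      then obtain g where g: "g \<in> J" "g \<in> carrier ?R" "ev g \<noteq> 0" using J by (auto simp: K_def)
      \<comment> \<open>The germ of the scalar 1 / \<open>ev g\<close>. Then 1 - h g lies in the
        kernel \<open>K\<close>, so an ideal that contains \<open>K\<close> and \<open>g\<close>
        contains 1.\<close>
      obtain h where h: "h = germ X \<O> a (topspace X) (inverse (ev g) \<odot>\<^bsub>sections \<O> (topspace X)\<^esub> \<one>\<^bsub>sections \<O> (topspace X)\<^esub>)"
        by blast
      have hc: "h \<in> carrier ?R" unfolding h using a by (intro carrI) (auto intro: smult_O_closed one_O_closed)
      have hev: "ev h = inverse (ev g)"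
        unfolding h using a by (subst ev) (auto simp: lv_smult lv_one one_O_closed intro: smult_O_closed)
      let ?k = "\<one>\<^bsub>?R\<^esub> \<ominus>\<^bsub>?R\<^esub> (h \<otimes>\<^bsub>?R\<^esub> g)"
      have hg: "h \<otimes>\<^bsub>?R\<^esub> g \<in> J" using ideal.I_l_closed[OF J(1) g(1) hc] .
      have kc: "?k \<in> carrier ?R" using hc g by auto
      have sum: "?k \<oplus>\<^bsub>?R\<^esub> (h \<otimes>\<^bsub>?R\<^esub> g) = \<one>\<^bsub>?R\<^esub>"
        using hc g by (simp add: R.minus_eq R.a_assoc R.l_neg)
      have "ev ?k + ev h * ev g = 1"
        using sum ev_add[OF kc, of "h \<otimes>\<^bsub>?R\<^esub> g"] ev_mult[OF hc g(2)] ev_one hc g by auto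
      then have "?k \<in> K" using hev g kc by (simp add: K_def)
      then have "?k \<in> J" using J by blast
      then have "\<one>\<^bsub>?R\<^esub> \<in> J"
        using additive_subgroup.a_closed[OF ideal.axioms(1)[OF J(1)] _ hg] sum by metis
      then show ?thesis using ideal.one_imp_carrier[OF J(1)] by blast
    qed auto
  qed
  then have K: "(THE I. maximalideal I ?R) = K" using uniq by (intro the1_equality)
  \<comment> \<open>Subtracting a constant moves \<open>f\<close> into \<open>K\<close> for exactly
    one value of that constant, so the description in \<open>eval_at\<close> selects the local
    value.\<close>
  have "germ X \<O> a V (f \<ominus>\<^bsub>sections \<O> V\<^esub> (c \<odot>\<^bsub>sections \<O> V\<^esub> \<one>\<^bsub>sections \<O> V\<^esub>)) \<in> K \<longleftrightarrow> lv V f = c" for c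
  proof -
    interpret V: cring "sections \<O> V" using cring_O V by blast
    let ?c = "c \<odot>\<^bsub>sections \<O> V\<^esub> \<one>\<^bsub>sections \<O> V\<^esub>"
    let ?d = "f \<ominus>\<^bsub>sections \<O> V\<^esub> ?c"
    have cc: "?c \<in> carrier (sections \<O> V)" using V by (intro smult_O_closed) auto
    have dc: "?d \<in> carrier (sections \<O> V)" using V cc by auto
    have "?d \<oplus>\<^bsub>sections \<O> V\<^esub> ?c = f" using V cc by (simp add: V.minus_eq V.a_assoc V.l_neg)
    then have "lv V f = lv V ?d + lv V ?c" using lv_add[OF V(1,2) dc cc] by simp
    also have "lv V ?c = c" using V by (simp add: lv_smult lv_one)
    finally show ?thesis using V dc by (auto simp: K_def carrI ev)
  qed
  then show ?thesis
    unfolding eval_at_def K lv_def[symmetric] by simp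
qed

end

section \<open>The local model\<close>

lemma formal_functions_simps:
  "f \<in> carrier (formal_functions n k V) \<longleftrightarrow>
    (\<forall>\<alpha>\<in>multi_indices k. smooth_on_Rn n V (f \<alpha>)) \<and> (\<forall>\<alpha> x. \<alpha> \<notin> multi_indices k \<or> x \<notin> V \<longrightarrow> f \<alpha> x = 0)"
  "f \<oplus>\<^bsub>formal_functions n k V\<^esub> g = (\<lambda>\<alpha> x. f \<alpha> x + g \<alpha> x)"
  "f \<otimes>\<^bsub>formal_functions n k V\<^esub> g = (\<lambda>\<gamma> x. \<Sum>(\<alpha>, \<beta>) | (\<lambda>i. \<alpha> i + \<beta> i) = \<gamma>. f \<alpha> x * g \<beta> x)"
  "\<one>\<^bsub>formal_functions n k V\<^esub> = (\<lambda>\<alpha> x. if \<alpha> = (\<lambda>i. 0) \<and> x \<in> V then 1 else 0)"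
  "\<zero>\<^bsub>formal_functions n k V\<^esub> = (\<lambda>\<alpha> x. 0)"
  "c \<odot>\<^bsub>formal_functions n k V\<^esub> f = (\<lambda>\<alpha> x. c * f \<alpha> x)"
  by (simp_all add: formal_functions_def)

lemma formal_functions_add_closed:
  "f \<in> carrier (formal_functions n k V) \<Longrightarrow> g \<in> carrier (formal_functions n k V) \<Longrightarrow>
   f \<oplus>\<^bsub>formal_functions n k V\<^esub> g \<in> carrier (formal_functions n k V)"
  by (auto simp: formal_functions_simps intro: smooth_on_Rn_add)

lemma formal_functions_smult_closed:
  "f \<in> carrier (formal_functions n k V) \<Longrightarrow> c \<odot>\<^bsub>formal_functions n k V\<^esub> f \<in> carrier (formal_functions n k V)"
  by (auto simp: formal_functions_simps intro: smooth_on_Rn_mult smooth_on_Rn_const)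

text \<open>A sum of two exponents leaves \<open>multi_indices k\<close> only if one of them does,
  so the vanishing coefficients of the factors force those of the product.\<close>

lemma formal_functions_mult_closed:
  assumes f: "f \<in> carrier (formal_functions n k V)" and g: "g \<in> carrier (formal_functions n k V)"
  shows "f \<otimes>\<^bsub>formal_functions n k V\<^esub> g \<in> carrier (formal_functions n k V)"
proof -
  have sm: "smooth_on_Rn n V (h \<alpha>)" if "h \<in> carrier (formal_functions n k V)" for h \<alpha>
  proof (cases "\<alpha> \<in> multi_indices k")
    case False
    then have "h \<alpha> = (\<lambda>_. 0)" using that by (auto simp: formal_functions_simps)
    then show ?thesis by (simp add: smooth_on_Rn_const)
  qed (use that in \<open>simp add: formal_functions_simps\<close>)
  have "smooth_on_Rn n V (\<lambda>x. \<Sum>(\<alpha>, \<beta>) | (\<lambda>i. \<alpha> i + \<beta> i) = \<gamma>. f \<alpha> x * g \<beta> x)" for \<gamma>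
  proof -
    \<comment> \<open>For an exponent with infinitely many nonzero entries the index set is
      infinite; the sum is then 0 by convention, a case that \<open>smooth_on_Rn_sum\<close>
      covers.\<close>
    have "smooth_on_Rn n V (\<lambda>x. \<Sum>p | (\<lambda>i. fst p i + snd p i) = \<gamma>. f (fst p) x * g (snd p) x)"
      by (intro smooth_on_Rn_sum smooth_on_Rn_mult sm[OF f] sm[OF g])
    then show ?thesis by (simp add: case_prod_unfold)
  qed
  moreover have "(\<Sum>(\<alpha>, \<beta>) | (\<lambda>i. \<alpha> i + \<beta> i) = \<gamma>. f \<alpha> x * g \<beta> x) = 0"
    if "\<gamma> \<notin> multi_indices k \<or> x \<notin> V" for \<gamma> x
  proof (intro sum.neutral ballI)
    fix p assume p: "p \<in> {(\<alpha>, \<beta>). (\<lambda>i. \<alpha> i + \<beta> i) = \<gamma>}"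
    then have "x \<notin> V \<or> fst p \<notin> multi_indices k \<or> snd p \<notin> multi_indices k"
      using that by (auto simp: multi_indices_def)
    then show "(case p of (\<alpha>, \<beta>) \<Rightarrow> f \<alpha> x * g \<beta> x) = 0"
      using f g by (auto simp: formal_functions_simps case_prod_unfold)
  qed
  ultimately show ?thesis by (simp add: formal_functions_simps)
qed

text \<open>The exponent 0 has only the decomposition 0 + 0. Hence taking the constant term is
  multiplicative, which makes it a candidate for the residue.\<close>

lemma formal_functions_mult_at_0:
  "(f \<otimes>\<^bsub>formal_functions n k V\<^esub> g) (\<lambda>i. 0) x = f (\<lambda>i. 0) x * g (\<lambda>i. 0) x"
proof -
  have "{(\<alpha>, \<beta>). (\<lambda>i. \<alpha> i + \<beta> i) = (\<lambda>i. 0 :: nat)} = {(\<lambda>i::nat. 0, \<lambda>i. 0)}"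
    by (auto simp: fun_eq_iff)
  then show ?thesis by (simp add: formal_functions_simps)
qed

definition formal_const :: "(nat \<Rightarrow> real) set \<Rightarrow> ((nat \<Rightarrow> real) \<Rightarrow> complex) \<Rightarrow> (nat \<Rightarrow> nat) \<Rightarrow> (nat \<Rightarrow> real) \<Rightarrow> complex" where
  "formal_const V h = (\<lambda>\<alpha> x. if \<alpha> = (\<lambda>i. 0) \<and> x \<in> V then h x else 0)"

lemma formal_const_closed:
  assumes "openin (Rn n) V" "smooth_on_Rn n V h"
  shows "formal_const V h \<in> carrier (formal_functions n k V)"
proof -
  have "smooth_on_Rn n V (\<lambda>x. if \<alpha> = (\<lambda>i. 0) \<and> x \<in> V then h x else 0)" for \<alpha> :: "nat \<Rightarrow> nat"
  proof (cases "\<alpha> = (\<lambda>i. 0)")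
    case True
    then show ?thesis by (intro smooth_on_Rn_cong[OF assms]) auto
  qed (simp add: smooth_on_Rn_const)
  moreover have "(\<lambda>i. 0) \<in> multi_indices k" by (simp add: multi_indices_def)
  ultimately show ?thesis by (auto simp: formal_functions_simps formal_const_def)
qed

lemma restr_formal_Rn_closed:
  assumes "openin (Rn n) W" "W \<subseteq> V" "f \<in> carrier (formal_functions n k V)"
  shows "restr (formal_Rn n k) V W f \<in> carrier (formal_functions n k W)"
proof -
  have "smooth_on_Rn n W (\<lambda>x. if x \<in> W then f \<alpha> x else 0)" if "\<alpha> \<in> multi_indices k" for \<alpha>
  proof -
    have "smooth_on_Rn n V (f \<alpha>)" using assms(3) that by (simp add: formal_functions_simps)
    from smooth_on_Rn_cong[OF assms(1) smooth_on_Rn_subset[OF this assms(2)]] show ?thesis by simp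
  qed
  moreover have "\<alpha> \<notin> multi_indices k \<Longrightarrow> f \<alpha> x = 0" for \<alpha> x
    using assms(3) by (simp add: formal_functions_simps)
  ultimately show ?thesis by (simp add: formal_Rn_def formal_functions_simps)
qed

context formal_mfd begin

text \<open>The isomorphisms come indexed by the open sets of Euclidean space. As \<phi> is
  injective, an open \<open>V\<close> inside \<open>U\<close> is the preimage of its image, so they
  can be indexed by \<open>V\<close> instead.\<close>

lemma local_iso:
  assumes "p \<in> topspace X"
  obtains U n k \<phi> \<Theta> where "openin X U" "p \<in> U" "homeomorphic_map (subtopology X U) (Rn n) \<phi>"
    "\<And>V. openin X V \<Longrightarrow> V \<subseteq> U \<Longrightarrow> \<Theta> V \<in> ring_iso (formal_functions n k (\<phi> ` V)) (sections \<O> V)"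
    "\<And>V c f. openin X V \<Longrightarrow> V \<subseteq> U \<Longrightarrow> f \<in> carrier (formal_functions n k (\<phi> ` V)) \<Longrightarrow>
        \<Theta> V (c \<odot>\<^bsub>formal_functions n k (\<phi> ` V)\<^esub> f) = c \<odot>\<^bsub>sections \<O> V\<^esub> \<Theta> V f"
    "\<And>V W f. openin X V \<Longrightarrow> openin X W \<Longrightarrow> V \<subseteq> U \<Longrightarrow> W \<subseteq> V \<Longrightarrow> f \<in> carrier (formal_functions n k (\<phi> ` V)) \<Longrightarrow>
        \<Theta> W (restr (formal_Rn n k) (\<phi> ` V) (\<phi> ` W) f) = restr \<O> V W (\<Theta> V f)"
    "\<And>V. openin X V \<Longrightarrow> V \<subseteq> U \<Longrightarrow> openin (Rn n) (\<phi> ` V)"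
proof -
  obtain U n k where U: "openin X U" "p \<in> U"
      "isomorphic_ringed_spaces (subtopology X U) \<O> (Rn n) (formal_Rn n k)"
    using formal_manifold assms unfolding formal_manifold_def by meson
  from U(3)[unfolded isomorphic_ringed_spaces_def] obtain \<phi> \<theta> where \<phi>: "homeomorphic_map (subtopology X U) (Rn n) \<phi>"
    and \<theta>1: "\<forall>V. openin (Rn n) V \<longrightarrow>
           \<theta> V \<in> ring_iso (sections (formal_Rn n k) V) (sections \<O> {a \<in> topspace (subtopology X U). \<phi> a \<in> V}) \<and>
           (\<forall>c. \<forall>f\<in>carrier (sections (formal_Rn n k) V).
              \<theta> V (c \<odot>\<^bsub>sections (formal_Rn n k) V\<^esub> f) = c \<odot>\<^bsub>sections \<O> {a \<in> topspace (subtopology X U). \<phi> a \<in> V}\<^esub> \<theta> V f)"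
    and \<theta>2: "\<forall>V W. openin (Rn n) V \<and> openin (Rn n) W \<and> W \<subseteq> V \<longrightarrow>
           (\<forall>f\<in>carrier (sections (formal_Rn n k) V).
              \<theta> W (restr (formal_Rn n k) V W f) =
              restr \<O> {a \<in> topspace (subtopology X U). \<phi> a \<in> V} {a \<in> topspace (subtopology X U). \<phi> a \<in> W} (\<theta> V f))"
    by (elim exE conjE) (rule that; assumption)
  have top: "topspace (subtopology X U) = U" using U openin_subset by auto
  have inj: "inj_on \<phi> U" using \<phi> top by (metis homeomorphic_imp_injective_map)
  have pre: "{a \<in> topspace (subtopology X U). \<phi> a \<in> \<phi> ` V} = V" if "V \<subseteq> U" for V
    using inj that unfolding top by (auto dest: inj_onD)
  have opn: "openin (Rn n) (\<phi> ` V)" if "openin X V" "V \<subseteq> U" for V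
    using homeomorphic_map_openness[OF \<phi>, of V] that U top openin_subset[OF that(1)] by (simp add: openin_open_subtopology)
  have sec: "sections (formal_Rn n k) = formal_functions n k" by (simp add: formal_Rn_def)
  show thesis
  proof (rule that[of U n \<phi> "\<lambda>V. \<theta> (\<phi> ` V)" k])
    show "\<theta> (\<phi> ` V) \<in> ring_iso (formal_functions n k (\<phi> ` V)) (sections \<O> V)" if "openin X V" "V \<subseteq> U" for V
      using \<theta>1[rule_format, OF opn[OF that]] unfolding sec pre[OF that(2)] by simp
    show "\<theta> (\<phi> ` V) (c \<odot>\<^bsub>formal_functions n k (\<phi> ` V)\<^esub> f) = c \<odot>\<^bsub>sections \<O> V\<^esub> \<theta> (\<phi> ` V) f"
      if "openin X V" "V \<subseteq> U" "f \<in> carrier (formal_functions n k (\<phi> ` V))" for V c f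
      using \<theta>1[rule_format, OF opn[OF that(1,2)]] that unfolding sec pre[OF that(2)] by simp
    show "\<theta> (\<phi> ` W) (restr (formal_Rn n k) (\<phi> ` V) (\<phi> ` W) f) = restr \<O> V W (\<theta> (\<phi> ` V) f)"
      if "openin X V" "openin X W" "V \<subseteq> U" "W \<subseteq> V" "f \<in> carrier (formal_functions n k (\<phi> ` V))" for V W f
    proof -
      have W: "W \<subseteq> U" using that by simp
      show ?thesis
        using \<theta>2[rule_format, OF conjI[OF opn[OF that(1,3)] conjI[OF opn[OF that(2) W] image_mono[OF that(4)]]]] that(5)
        unfolding sec pre[OF that(3)] pre[OF W] by blast
    qed
  qed (use U \<phi> opn in auto)
qed

text \<open>\<open>E V h\<close> is the section given by the power series with constant term \<open>h\<close> and no other terms.\<close>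

lemma local_model:
  assumes p: "p \<in> topspace X"
  obtains U n \<phi> E where "openin X U" "p \<in> U" "homeomorphic_map (subtopology X U) (Rn n) \<phi>"
    "\<And>V. openin X V \<Longrightarrow> V \<subseteq> U \<Longrightarrow> openin (Rn n) (\<phi> ` V)"
    "\<And>V f. openin X V \<Longrightarrow> V \<subseteq> U \<Longrightarrow> f \<in> carrier (sections \<O> V) \<Longrightarrow>
       \<exists>h. smooth_on_Rn n (\<phi> ` V) h \<and> (\<forall>b\<in>V. eval_at X \<O> V f b = h (\<phi> b))"
    "\<And>V h. openin X V \<Longrightarrow> V \<subseteq> U \<Longrightarrow> smooth_on_Rn n (\<phi> ` V) h \<Longrightarrow> E V h \<in> carrier (sections \<O> V)"
    "\<And>V h b. openin X V \<Longrightarrow> V \<subseteq> U \<Longrightarrow> smooth_on_Rn n (\<phi> ` V) h \<Longrightarrow> b \<in> V \<Longrightarrow> eval_at X \<O> V (E V h) b = h (\<phi> b)"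
    "\<And>V W h. openin X V \<Longrightarrow> openin X W \<Longrightarrow> V \<subseteq> U \<Longrightarrow> W \<subseteq> V \<Longrightarrow> smooth_on_Rn n (\<phi> ` V) h \<Longrightarrow>
       restr \<O> V W (E V h) = E W h"
    "\<And>V h. openin X V \<Longrightarrow> V \<subseteq> U \<Longrightarrow> (\<And>x. x \<in> \<phi> ` V \<Longrightarrow> h x = 0) \<Longrightarrow> E V h = \<zero>\<^bsub>sections \<O> V\<^esub>"
    "\<And>V h. openin X V \<Longrightarrow> V \<subseteq> U \<Longrightarrow> (\<And>x. x \<in> \<phi> ` V \<Longrightarrow> h x = 1) \<Longrightarrow> E V h = \<one>\<^bsub>sections \<O> V\<^esub>"
    "\<And>V W f. openin X V \<Longrightarrow> openin X W \<Longrightarrow> W \<subseteq> V \<Longrightarrow> p \<in> W \<Longrightarrow> f \<in> carrier (sections \<O> V) \<Longrightarrow>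
       eval_at X \<O> W (restr \<O> V W f) p = eval_at X \<O> V f p"
    "\<And>V f g. openin X V \<Longrightarrow> p \<in> V \<Longrightarrow> f \<in> carrier (sections \<O> V) \<Longrightarrow> g \<in> carrier (sections \<O> V) \<Longrightarrow>
       eval_at X \<O> V (f \<oplus>\<^bsub>sections \<O> V\<^esub> g) p = eval_at X \<O> V f p + eval_at X \<O> V g p"
    "\<And>V f c. openin X V \<Longrightarrow> p \<in> V \<Longrightarrow> f \<in> carrier (sections \<O> V) \<Longrightarrow>
       eval_at X \<O> V (c \<odot>\<^bsub>sections \<O> V\<^esub> f) p = c * eval_at X \<O> V f p"
    "\<And>V. openin X V \<Longrightarrow> p \<in> V \<Longrightarrow> eval_at X \<O> V \<one>\<^bsub>sections \<O> V\<^esub> p = 1"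
proof -
  obtain U n k \<phi> \<Theta> where U: "openin X U" "p \<in> U" and \<phi>: "homeomorphic_map (subtopology X U) (Rn n) \<phi>"
    and iso: "\<And>V. openin X V \<Longrightarrow> V \<subseteq> U \<Longrightarrow> \<Theta> V \<in> ring_iso (formal_functions n k (\<phi> ` V)) (sections \<O> V)"
    and sm: "\<And>V c f. openin X V \<Longrightarrow> V \<subseteq> U \<Longrightarrow> f \<in> carrier (formal_functions n k (\<phi> ` V)) \<Longrightarrow>
        \<Theta> V (c \<odot>\<^bsub>formal_functions n k (\<phi> ` V)\<^esub> f) = c \<odot>\<^bsub>sections \<O> V\<^esub> \<Theta> V f"
    and res: "\<And>V W f. openin X V \<Longrightarrow> openin X W \<Longrightarrow> V \<subseteq> U \<Longrightarrow> W \<subseteq> V \<Longrightarrow> f \<in> carrier (formal_functions n k (\<phi> ` V)) \<Longrightarrow>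
        \<Theta> W (restr (formal_Rn n k) (\<phi> ` V) (\<phi> ` W) f) = restr \<O> V W (\<Theta> V f)"
    and opn: "\<And>V. openin X V \<Longrightarrow> V \<subseteq> U \<Longrightarrow> openin (Rn n) (\<phi> ` V)"
    by (rule local_iso[OF p]) (rule that; assumption)
  \<comment> \<open>The constant term of the power series that corresponds to \<open>f\<close>,
    evaluated at the image of \<open>b\<close>.\<close>
  define val where "val b V f = inv_into (carrier (formal_functions n k (\<phi> ` V))) (\<Theta> V) f (\<lambda>i. 0) (\<phi> b)" for b V f
  have inj: "inj_on (\<Theta> V) (carrier (formal_functions n k (\<phi> ` V)))"
    and surj: "\<Theta> V ` carrier (formal_functions n k (\<phi> ` V)) = carrier (sections \<O> V)"
    and hom: "\<Theta> V \<in> ring_hom (formal_functions n k (\<phi> ` V)) (sections \<O> V)"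
    if "openin X V" "V \<subseteq> U" for V
    using iso[OF that] by (auto simp: ring_iso_def bij_betw_def)
  have val: "val b V (\<Theta> V g) = g (\<lambda>i. 0) (\<phi> b)"
    if "openin X V" "V \<subseteq> U" "g \<in> carrier (formal_functions n k (\<phi> ` V))" for b V g
    unfolding val_def using inv_into_f_f[OF inj[OF that(1,2)] that(3)] by simp
  have rep: "\<exists>g\<in>carrier (formal_functions n k (\<phi> ` V)). f = \<Theta> V g"
    if "openin X V" "V \<subseteq> U" "f \<in> carrier (sections \<O> V)" for V f
    using surj[OF that(1,2)] that(3) by blast
  have val_restr: "val b W (restr \<O> V W f) = val b V f"
    if o: "openin X V" "openin X W" "b \<in> W" "W \<subseteq> V" "V \<subseteq> U" and f: "f \<in> carrier (sections \<O> V)" for b V W f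
  proof -
    obtain g where g: "g \<in> carrier (formal_functions n k (\<phi> ` V))" "f = \<Theta> V g" using rep o f by blast
    have W: "W \<subseteq> U" using o by simp
    have "restr (formal_Rn n k) (\<phi> ` V) (\<phi> ` W) g \<in> carrier (formal_functions n k (\<phi> ` W))"
      using restr_formal_Rn_closed[OF opn[OF o(2) W] image_mono[OF o(4)] g(1)] .
    from val[OF o(2) W this] res[OF o(1,2,5,4) g(1)] val[OF o(1,5) g(1)] g(2) o(3)
    show ?thesis by (simp add: formal_Rn_def)
  qed
  have val_add: "val b V (f \<oplus>\<^bsub>sections \<O> V\<^esub> g) = val b V f + val b V g"
    if o: "openin X V" "b \<in> V" "V \<subseteq> U" and f: "f \<in> carrier (sections \<O> V)" "g \<in> carrier (sections \<O> V)" for b V f g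
  proof -
    obtain f' g' where g: "f' \<in> carrier (formal_functions n k (\<phi> ` V))" "f = \<Theta> V f'"
      "g' \<in> carrier (formal_functions n k (\<phi> ` V))" "g = \<Theta> V g'" using rep[OF o(1,3)] f by blast
    have "f \<oplus>\<^bsub>sections \<O> V\<^esub> g = \<Theta> V (f' \<oplus>\<^bsub>formal_functions n k (\<phi> ` V)\<^esub> g')"
      using ring_hom_add[OF hom[OF o(1,3)]] g by simp
    then show ?thesis
      using val[OF o(1,3) formal_functions_add_closed[OF g(1,3)]] val[OF o(1,3) g(1)] val[OF o(1,3) g(3)] g
      by (simp add: formal_functions_simps)
  qed
  have val_mult: "val b V (f \<otimes>\<^bsub>sections \<O> V\<^esub> g) = val b V f * val b V g"
    if o: "openin X V" "b \<in> V" "V \<subseteq> U" and f: "f \<in> carrier (sections \<O> V)" "g \<in> carrier (sections \<O> V)" for b V f g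
  proof -
    obtain f' g' where g: "f' \<in> carrier (formal_functions n k (\<phi> ` V))" "f = \<Theta> V f'"
      "g' \<in> carrier (formal_functions n k (\<phi> ` V))" "g = \<Theta> V g'" using rep[OF o(1,3)] f by blast
    have "f \<otimes>\<^bsub>sections \<O> V\<^esub> g = \<Theta> V (f' \<otimes>\<^bsub>formal_functions n k (\<phi> ` V)\<^esub> g')"
      using ring_hom_mult[OF hom[OF o(1,3)]] g by simp
    then show ?thesis
      using val[OF o(1,3) formal_functions_mult_closed[OF g(1,3)]] val[OF o(1,3) g(1)] val[OF o(1,3) g(3)] g
      by (simp add: formal_functions_mult_at_0)
  qed
  have val_smult: "val b V (c \<odot>\<^bsub>sections \<O> V\<^esub> f) = c * val b V f"
    if o: "openin X V" "b \<in> V" "V \<subseteq> U" and f: "f \<in> carrier (sections \<O> V)" for b V f c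
  proof -
    obtain f' where g: "f' \<in> carrier (formal_functions n k (\<phi> ` V))" "f = \<Theta> V f'"
      using rep[OF o(1,3)] f by blast
    then show ?thesis
      using val[OF o(1,3) formal_functions_smult_closed[OF g(1), of c]] val[OF o(1,3) g(1)] sm[OF o(1,3) g(1), of c]
      by (simp add: formal_functions_simps)
  qed
  define E where "E V h = \<Theta> V (formal_const (\<phi> ` V) h)" for V h
  have one: "formal_const (\<phi> ` V) (\<lambda>_. 1) = \<one>\<^bsub>formal_functions n k (\<phi> ` V)\<^esub>" for V
    by (simp add: formal_const_def formal_functions_simps)
  have zero: "formal_const (\<phi> ` V) (\<lambda>_. 0) = \<zero>\<^bsub>formal_functions n k (\<phi> ` V)\<^esub>" for V
    by (simp add: formal_const_def formal_functions_simps)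
  have E_closed: "E V h \<in> carrier (sections \<O> V)" if "openin X V" "V \<subseteq> U" "smooth_on_Rn n (\<phi> ` V) h" for V h
    unfolding E_def using ring_hom_closed[OF hom[OF that(1,2)]] formal_const_closed[OF opn[OF that(1,2)] that(3)] .
  have E_cong: "E V h = E V h'" if "\<And>x. x \<in> \<phi> ` V \<Longrightarrow> h x = h' x" for V h h'
  proof -
    have "formal_const (\<phi> ` V) h = formal_const (\<phi> ` V) h'"
      unfolding formal_const_def using that by (intro ext) auto
    then show ?thesis unfolding E_def by simp
  qed
  have val_E: "val b V (E V h) = h (\<phi> b)" if "openin X V" "V \<subseteq> U" "smooth_on_Rn n (\<phi> ` V) h" "b \<in> V" for b V h
    unfolding E_def using val[OF that(1,2) formal_const_closed[OF opn[OF that(1,2)] that(3)]] that(4)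
    by (simp add: formal_const_def)
  have E_one: "E V (\<lambda>_. 1) = \<one>\<^bsub>sections \<O> V\<^esub>" if "openin X V" "V \<subseteq> U" for V
    unfolding E_def one using ring_hom_one[OF hom[OF that]] .
  \<comment> \<open>\<open>ring_hom\<close> says nothing about zero, so the image of the zero series
    is found by cancelling in z + z = z within the ring of sections.\<close>
  have E_zero: "E V (\<lambda>_. 0) = \<zero>\<^bsub>sections \<O> V\<^esub>" if o: "openin X V" "V \<subseteq> U" for V
  proof -
    let ?z = "\<zero>\<^bsub>formal_functions n k (\<phi> ` V)\<^esub>"
    interpret cring "sections \<O> V" using cring_O o by blast
    have z: "?z \<in> carrier (formal_functions n k (\<phi> ` V))"
      by (simp add: formal_functions_simps smooth_on_Rn_const)
    have "?z \<oplus>\<^bsub>formal_functions n k (\<phi> ` V)\<^esub> ?z = ?z" by (simp add: formal_functions_simps)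
    then have "\<Theta> V ?z = \<Theta> V ?z \<oplus>\<^bsub>sections \<O> V\<^esub> \<Theta> V ?z"
      using ring_hom_add[OF hom[OF o] z z] by simp
    moreover have "\<Theta> V ?z \<in> carrier (sections \<O> V)" using ring_hom_closed[OF hom[OF o] z] .
    ultimately show ?thesis unfolding E_def zero
      by (metis add.r_cancel_one)
  qed
  have val_one: "val b V \<one>\<^bsub>sections \<O> V\<^esub> = 1" if "openin X V" "b \<in> V" "V \<subseteq> U" for b V
    using val_E[OF that(1,3) smooth_on_Rn_const that(2), of 1] E_one[OF that(1,3)] by simp
  have ev: "eval_at X \<O> V f b = val b (V \<inter> U) (restr \<O> V (V \<inter> U) f)"
    if "openin X V" "b \<in> V" "b \<in> U" "f \<in> carrier (sections \<O> V)" for b V f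
    by (rule eval_at_eq[OF U(1) that(3) val_restr val_add val_mult val_one val_smult that(1,2,4)])
  have ev_sub: "eval_at X \<O> V f b = val b V f"
    if "openin X V" "b \<in> V" "V \<subseteq> U" "f \<in> carrier (sections \<O> V)" for b V f
    using ev[of V b f] that by (auto simp: inf.absorb1 restr_self)
  show thesis
  proof (rule that[of U n \<phi> E])
    show "\<exists>h. smooth_on_Rn n (\<phi> ` V) h \<and> (\<forall>b\<in>V. eval_at X \<O> V f b = h (\<phi> b))"
      if o: "openin X V" "V \<subseteq> U" "f \<in> carrier (sections \<O> V)" for V f
    proof -
      obtain g where g: "g \<in> carrier (formal_functions n k (\<phi> ` V))" "f = \<Theta> V g"
        using rep o by blast
      then have "smooth_on_Rn n (\<phi> ` V) (g (\<lambda>i. 0))" by (simp add: formal_functions_simps multi_indices_def)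
      then show ?thesis using ev_sub[OF o(1) _ o(2,3)] val[OF o(1,2) g(1)] g(2) by auto
    qed
    show "eval_at X \<O> V (E V h) b = h (\<phi> b)"
      if o: "openin X V" "V \<subseteq> U" "smooth_on_Rn n (\<phi> ` V) h" "b \<in> V" for V h b
      using ev_sub[OF o(1,4,2) E_closed[OF o(1,2,3)]] val_E[OF o] by simp
    show "restr \<O> V W (E V h) = E W h"
      if o: "openin X V" "openin X W" "V \<subseteq> U" "W \<subseteq> V" "smooth_on_Rn n (\<phi> ` V) h" for V W h
    proof -
      have "restr (formal_Rn n k) (\<phi> ` V) (\<phi> ` W) (formal_const (\<phi> ` V) h) = formal_const (\<phi> ` W) h"
        using o(4) by (intro ext) (auto simp: formal_Rn_def formal_const_def)
      then show ?thesis unfolding E_def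
        using res[OF o(1-4) formal_const_closed[OF opn[OF o(1,3)] o(5)]] by simp
    qed
    show "E V h = \<zero>\<^bsub>sections \<O> V\<^esub>" if "openin X V" "V \<subseteq> U" "\<And>x. x \<in> \<phi> ` V \<Longrightarrow> h x = 0" for V h
      using E_cong[of V h "\<lambda>_. 0"] E_zero that by simp
    show "E V h = \<one>\<^bsub>sections \<O> V\<^esub>" if "openin X V" "V \<subseteq> U" "\<And>x. x \<in> \<phi> ` V \<Longrightarrow> h x = 1" for V h
      using E_cong[of V h "\<lambda>_. 1"] E_one that by simp
    show "eval_at X \<O> W (restr \<O> V W f) p = eval_at X \<O> V f p"
      if o: "openin X V" "openin X W" "W \<subseteq> V" "p \<in> W" "f \<in> carrier (sections \<O> V)" for V W f
    proof -
      \<comment> \<open>\<open>V\<close> and \<open>W\<close> may reach beyond \<open>U\<close>.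
        Both values are therefore computed after restriction to \<open>U\<close>, which contains
        \<open>p\<close>.\<close>
      have "eval_at X \<O> W (restr \<O> V W f) p = val p (W \<inter> U) (restr \<O> W (W \<inter> U) (restr \<O> V W f))"
        using o U by (intro ev) auto
      also have "restr \<O> W (W \<inter> U) (restr \<O> V W f) = restr \<O> (V \<inter> U) (W \<inter> U) (restr \<O> V (V \<inter> U) f)"
        using o U by (simp add: restr_restr openin_Int le_infI1)
      also have "val p (W \<inter> U) \<dots> = val p (V \<inter> U) (restr \<O> V (V \<inter> U) f)"
        using o U by (intro val_restr) (auto simp: openin_Int)
      also have "\<dots> = eval_at X \<O> V f p" using o U by (intro ev[symmetric]) auto
      finally show ?thesis .
    qed
    show "eval_at X \<O> V (f \<oplus>\<^bsub>sections \<O> V\<^esub> g) p = eval_at X \<O> V f p + eval_at X \<O> V g p"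
      if o: "openin X V" "p \<in> V" "f \<in> carrier (sections \<O> V)" "g \<in> carrier (sections \<O> V)" for V f g
      using o U by (simp add: ev add_O_closed restr_add val_add openin_Int)
    show "eval_at X \<O> V (c \<odot>\<^bsub>sections \<O> V\<^esub> f) p = c * eval_at X \<O> V f p"
      if o: "openin X V" "p \<in> V" "f \<in> carrier (sections \<O> V)" for V f c
      using o U by (simp add: ev smult_O_closed restr_smult val_smult openin_Int)
    show "eval_at X \<O> V \<one>\<^bsub>sections \<O> V\<^esub> p = 1" if o: "openin X V" "p \<in> V" for V
      using o U by (simp add: ev one_O_closed restr_one val_one openin_Int)
  qed (use U \<phi> opn E_closed in auto)
qed

text \<open>The rules for residues at \<open>p\<close> mention none of the data of the local model
  around \<open>p\<close>; this lemma and the next three extract them from it.\<close>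

lemma eval_at_restr:
  assumes "openin X V" "openin X W" "W \<subseteq> V" "p \<in> W" "f \<in> carrier (sections \<O> V)"
  shows "eval_at X \<O> W (restr \<O> V W f) p = eval_at X \<O> V f p"
proof -
  have "p \<in> topspace X" using assms openin_subset by blast
  then show ?thesis
  proof (rule local_model, goal_cases)
    case (1 U n \<phi> E)
    show ?case by (rule 1(11)[OF assms])
  qed
qed

lemma eval_at_add:
  assumes "openin X V" "p \<in> V" "f \<in> carrier (sections \<O> V)" "g \<in> carrier (sections \<O> V)"
  shows "eval_at X \<O> V (f \<oplus>\<^bsub>sections \<O> V\<^esub> g) p = eval_at X \<O> V f p + eval_at X \<O> V g p"
proof -
  have "p \<in> topspace X" using assms openin_subset by blast
  then show ?thesis
  proof (rule local_model, goal_cases)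
    case (1 U n \<phi> E)
    show ?case by (rule 1(12)[OF assms])
  qed
qed

lemma eval_at_smult:
  assumes "openin X V" "p \<in> V" "f \<in> carrier (sections \<O> V)"
  shows "eval_at X \<O> V (c \<odot>\<^bsub>sections \<O> V\<^esub> f) p = c * eval_at X \<O> V f p"
proof -
  have "p \<in> topspace X" using assms openin_subset by blast
  then show ?thesis
  proof (rule local_model, goal_cases)
    case (1 U n \<phi> E)
    show ?case by (rule 1(13)[OF assms])
  qed
qed

lemma eval_at_one:
  assumes "openin X V" "p \<in> V"
  shows "eval_at X \<O> V \<one>\<^bsub>sections \<O> V\<^esub> p = 1"
proof -
  have "p \<in> topspace X" using assms openin_subset by blast
  then show ?thesis
  proof (rule local_model, goal_cases)
    case (1 U n \<phi> E)
    show ?case by (rule 1(14)[OF assms])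
  qed
qed

lemma eval_at_zero:
  assumes "openin X V" "p \<in> V"
  shows "eval_at X \<O> V \<zero>\<^bsub>sections \<O> V\<^esub> p = 0"
proof -
  interpret cring "sections \<O> V" using cring_O assms by blast
  show ?thesis using eval_at_add[OF assms, of "\<zero>\<^bsub>sections \<O> V\<^esub>" "\<zero>\<^bsub>sections \<O> V\<^esub>"] by simp
qed

end

section \<open>The smooth functions on the reduction\<close>

lemma sheaf_glue_two:
  assumes S: "sheaf_on X S" and o: "openin X A" "openin X B"
    and s: "s \<in> carrier (sections S A)" and t: "t \<in> carrier (sections S B)"
    and eq: "restr S A (A \<inter> B) s = restr S B (A \<inter> B) t"
  shows "\<exists>r\<in>carrier (sections S (A \<union> B)). restr S (A \<union> B) A r = s \<and> restr S (A \<union> B) B r = t"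
proof -
  have id: "restr S U U u = u" if "openin X U" "u \<in> carrier (sections S U)" for U u
    using S that unfolding sheaf_on_def presheaf_on_def by blast
  define \<U> where "\<U> = {A, B}"
  \<comment> \<open>If A = B the cover has only one member. The overlap condition then forces s = t,
    so this choice is consistent.\<close>
  define f where "f V = (if V = A then s else t)" for V
  have fB: "f B = t"
    using eq id[OF o(1) s] id[OF o(2) t] unfolding f_def by auto
  have fA: "f A = s" by (simp add: f_def)
  have 1: "\<forall>V\<in>\<U>. openin X V \<and> f V \<in> carrier (sections S V)"
    using o s t fA fB by (auto simp: \<U>_def)
  have 2: "\<forall>V\<in>\<U>. \<forall>W\<in>\<U>. restr S V (V \<inter> W) (f V) = restr S W (V \<inter> W) (f W)"
    using eq fA fB by (auto simp: \<U>_def Int_commute)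
  have "\<exists>!r. r \<in> carrier (sections S (\<Union>\<U>)) \<and> (\<forall>V\<in>\<U>. restr S (\<Union>\<U>) V r = f V)"
    using S 1 2 unfolding sheaf_on_def by blast
  then show ?thesis using fA fB by (auto simp: \<U>_def)
qed

context formal_mfd begin

lemma reduced_sections_local:
  assumes "\<And>a. a \<notin> U \<Longrightarrow> g a = 0"
    and "\<And>a. a \<in> U \<Longrightarrow> \<exists>V h. openin X V \<and> a \<in> V \<and> V \<subseteq> U \<and> h \<in> reduced_sections X \<O> V \<and> (\<forall>b\<in>V. g b = h b)"
  shows "g \<in> reduced_sections X \<O> U"
proof -
  have "\<exists>V f. openin X V \<and> a \<in> V \<and> V \<subseteq> U \<and> f \<in> carrier (sections \<O> V) \<and> (\<forall>b\<in>V. g b = eval_at X \<O> V f b)"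
    if a: "a \<in> U" for a
  proof -
    obtain V h where V: "openin X V" "a \<in> V" "V \<subseteq> U" "h \<in> reduced_sections X \<O> V" "\<forall>b\<in>V. g b = h b"
      using assms(2)[OF a] by blast
    then obtain W f where "openin X W" "a \<in> W" "W \<subseteq> V" "f \<in> carrier (sections \<O> W)" "\<forall>b\<in>W. h b = eval_at X \<O> W f b"
      unfolding reduced_sections_def by blast
    with V show ?thesis by (intro exI[of _ W] exI[of _ f]) auto
  qed
  then show ?thesis using assms(1) by (simp add: reduced_sections_def)
qed

lemma reduced_sections_outside: "g \<in> reduced_sections X \<O> U \<Longrightarrow> a \<notin> U \<Longrightarrow> g a = 0"
  by (simp add: reduced_sections_def)

lemma reduced_sections_eval:
  assumes "openin X U" "f \<in> carrier (sections \<O> U)"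
  shows "(\<lambda>a. if a \<in> U then eval_at X \<O> U f a else 0) \<in> reduced_sections X \<O> U"
  using assms unfolding reduced_sections_def by auto

lemma reduced_sections_restrict:
  assumes "g \<in> reduced_sections X \<O> U" "openin X V" "V \<subseteq> U"
  shows "(\<lambda>a. if a \<in> V then g a else 0) \<in> reduced_sections X \<O> V"
proof -
  have "\<exists>W f. openin X W \<and> a \<in> W \<and> W \<subseteq> V \<and> f \<in> carrier (sections \<O> W) \<and>
      (\<forall>b\<in>W. (if b \<in> V then g b else 0) = eval_at X \<O> W f b)" if a: "a \<in> V" for a
  proof -
    obtain W f where W: "openin X W" "a \<in> W" "W \<subseteq> U" "f \<in> carrier (sections \<O> W)" "\<forall>b\<in>W. g b = eval_at X \<O> W f b"
      using assms a unfolding reduced_sections_def by blast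
    have o: "openin X (W \<inter> V)" using W assms by blast
    show ?thesis
      using W o a eval_at_restr[OF W(1) o _ _ W(4)]
      by (intro exI[of _ "W \<inter> V"] exI[of _ "restr \<O> W (W \<inter> V) f"]) auto
  qed
  then show ?thesis by (simp add: reduced_sections_def)
qed

lemma chartD:
  assumes "c \<in> charts X \<O>"
  shows "openin X (chart_dom c)" "openin (Rn (chart_dim c)) (chart_map c ` chart_dom c)"
    "homeomorphic_map (subtopology X (chart_dom c))
       (subtopology (Rn (chart_dim c)) (chart_map c ` chart_dom c)) (chart_map c)"
    "inj_on (chart_map c) (chart_dom c)"
    "\<And>V. openin X V \<Longrightarrow> V \<subseteq> chart_dom c \<Longrightarrow> openin (Rn (chart_dim c)) (chart_map c ` V)"
    "\<And>V g. openin X V \<Longrightarrow> V \<subseteq> chart_dom c \<Longrightarrow> (\<And>a. a \<notin> V \<Longrightarrow> g a = 0) \<Longrightarrow>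
       g \<in> reduced_sections X \<O> V \<longleftrightarrow> smooth_on_Rn (chart_dim c) (chart_map c ` V) (g \<circ> chart_inv c)"
proof -
  show 1: "openin X (chart_dom c)" "openin (Rn (chart_dim c)) (chart_map c ` chart_dom c)"
    and h: "homeomorphic_map (subtopology X (chart_dom c))
       (subtopology (Rn (chart_dim c)) (chart_map c ` chart_dom c)) (chart_map c)"
    and "\<And>V g. openin X V \<Longrightarrow> V \<subseteq> chart_dom c \<Longrightarrow> (\<And>a. a \<notin> V \<Longrightarrow> g a = 0) \<Longrightarrow>
       g \<in> reduced_sections X \<O> V \<longleftrightarrow> smooth_on_Rn (chart_dim c) (chart_map c ` V) (g \<circ> chart_inv c)"
    using assms unfolding charts_def by blast+
  have top: "topspace (subtopology X (chart_dom c)) = chart_dom c" using openin_subset[OF 1(1)] by auto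
  show "inj_on (chart_map c) (chart_dom c)" using homeomorphic_imp_injective_map[OF h] top by simp
  show "openin (Rn (chart_dim c)) (chart_map c ` V)" if "openin X V" "V \<subseteq> chart_dom c" for V
  proof -
    have "openin (subtopology (Rn (chart_dim c)) (chart_map c ` chart_dom c)) (chart_map c ` V)"
      using homeomorphic_map_openness[OF h, of V] that 1 top openin_subset[OF that(1)] by (simp add: openin_open_subtopology)
    from openin_trans_full[OF this 1(2)] show ?thesis .
  qed
qed

lemma chart_inv_map: "c \<in> charts X \<O> \<Longrightarrow> a \<in> chart_dom c \<Longrightarrow> chart_inv c (chart_map c a) = a"
  using inv_into_f_f[OF chartD(4)] .

text \<open>The coordinate map of the local model is a chart: residues of sections are smooth
  constant terms, and conversely every smooth function is lifted to \<O> by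
  \<open>E\<close>.\<close>

lemma ex_chart:
  assumes "p \<in> topspace X"
  shows "\<exists>c\<in>charts X \<O>. p \<in> chart_dom c"
  using assms
proof (rule local_model, goal_cases)
  case (1 U n \<phi> E)
  note U = 1(1) and p = 1(2) and \<phi> = 1(3) and opn = 1(4) and toh = 1(5) and E = 1(6) and evE = 1(7)
  have top: "topspace (subtopology X U) = U" using openin_subset[OF U] by auto
  have inj: "inj_on \<phi> U" using homeomorphic_imp_injective_map[OF \<phi>] top by simp
  have surj: "\<phi> ` U = topspace (Rn n)" using homeomorphic_imp_surjective_map[OF \<phi>] top by simp
  \<comment> \<open>The restriction makes the map extensional on \<open>U\<close>, as
    \<open>charts\<close> demands; it keeps charts with different junk values apart from the
    set.\<close>
  define c where "c = \<lparr> chart_dim = n, chart_dom = U, chart_map = restrict \<phi> U \<rparr>"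
  have c: "chart_dim c = n" "chart_dom c = U" "chart_map c = restrict \<phi> U" by (simp_all add: c_def)
  have im: "chart_map c ` V = \<phi> ` V" if "V \<subseteq> U" for V using that by (auto simp: c)
  have inv: "chart_inv c (\<phi> b) = b" if "b \<in> U" for b
  proof -
    have "inj_on (restrict \<phi> U) U" using inj by (simp add: inj_on_def)
    from inv_into_f_f[OF this that] that show ?thesis by (simp add: c)
  qed
  have iff: "g \<in> reduced_sections X \<O> V \<longleftrightarrow> smooth_on_Rn n (\<phi> ` V) (g \<circ> chart_inv c)"
    if V: "openin X V" "V \<subseteq> U" "\<And>a. a \<notin> V \<Longrightarrow> g a = 0" for V g
  proof
    assume g: "g \<in> reduced_sections X \<O> V"
    show "smooth_on_Rn n (\<phi> ` V) (g \<circ> chart_inv c)"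
    proof (rule smooth_on_Rn_local[OF opn[OF V(1,2)]])
      fix x assume "x \<in> \<phi> ` V"
      then obtain a where a: "a \<in> V" "x = \<phi> a" by blast
      then obtain W f where W: "openin X W" "a \<in> W" "W \<subseteq> V" "f \<in> carrier (sections \<O> W)"
        "\<forall>b\<in>W. g b = eval_at X \<O> W f b"
        using g unfolding reduced_sections_def by blast
      have WU: "W \<subseteq> U" using W V by blast
      obtain h where h: "smooth_on_Rn n (\<phi> ` W) h" "\<forall>b\<in>W. eval_at X \<O> W f b = h (\<phi> b)"
        using toh[OF W(1) WU W(4)] by blast
      have "smooth_on_Rn n (\<phi> ` W) (g \<circ> chart_inv c)"
      proof (rule smooth_on_Rn_cong[OF opn[OF W(1) WU] h(1)])
        fix y assume "y \<in> \<phi> ` W"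
        then obtain b where b: "b \<in> W" "y = \<phi> b" by blast
        then have "chart_inv c y = b" using inv WU by blast
        then show "h y = (g \<circ> chart_inv c) y" using h(2) W(5) b by simp
      qed
      then show "\<exists>W. openin (Rn n) W \<and> x \<in> W \<and> W \<subseteq> \<phi> ` V \<and> smooth_on_Rn n W (g \<circ> chart_inv c)"
        using opn[OF W(1) WU] W a by (intro exI[of _ "\<phi> ` W"]) auto
    qed
  next
    assume h: "smooth_on_Rn n (\<phi> ` V) (g \<circ> chart_inv c)"
    have "g b = eval_at X \<O> V (E V (g \<circ> chart_inv c)) b" if "b \<in> V" for b
    proof -
      have "b \<in> U" using that V by blast
      then show ?thesis using evE[OF V(1,2) h that] inv by simp
    qed
    then show "g \<in> reduced_sections X \<O> V"
      using E[OF V(1,2) h] V unfolding reduced_sections_def by blast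
  qed
  have "c \<in> charts X \<O>"
    unfolding charts_def
  proof (intro CollectI conjI allI impI)
    show "openin X (chart_dom c)" using U by (simp add: c)
    show "openin (Rn (chart_dim c)) (chart_map c ` chart_dom c)"
    proof -
      have "chart_map c ` chart_dom c = topspace (Rn n)" using im[of U] surj c(2) by simp
      then show ?thesis by (simp only: c(1) openin_topspace)
    qed
    show "chart_map c \<in> extensional (chart_dom c)" by (simp add: c)
    show "homeomorphic_map (subtopology X (chart_dom c))
           (subtopology (Rn (chart_dim c)) (chart_map c ` chart_dom c)) (chart_map c)"
    proof -
      have "homeomorphic_map (subtopology X U) (Rn n) (restrict \<phi> U)"
        by (rule homeomorphic_map_eq[OF \<phi>]) (simp add: top)
      moreover have "subtopology (Rn n) (chart_map c ` chart_dom c) = Rn n"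
      proof -
        have "chart_map c ` chart_dom c = topspace (Rn n)" using im[of U] surj c(2) by simp
        then show ?thesis by (simp only: subtopology_topspace)
      qed
      ultimately show ?thesis by (simp add: c)
    qed
    fix V and g :: "'m \<Rightarrow> complex" assume "openin X V \<and> V \<subseteq> chart_dom c \<and> (\<forall>a. a \<notin> V \<longrightarrow> g a = 0)"
    then have V: "openin X V" "V \<subseteq> U" "\<And>a. a \<notin> V \<Longrightarrow> g a = 0" by (auto simp: c)
    show "g \<in> reduced_sections X \<O> V \<longleftrightarrow> smooth_on_Rn (chart_dim c) (chart_map c ` V) (g \<circ> chart_inv c)"
      using iff[OF V] im[OF V(2)] by (simp add: c(1))
  qed
  moreover have "p \<in> chart_dom c" using p by (simp add: c)
  ultimately show ?case by blast
qed

text \<open>Pointwise operations are checked in charts, where they act on smooth functions.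
  \<open>Q\<close> carries a side condition such as a nonvanishing denominator, and F 0 0 = 0
  preserves the extension by zero.\<close>

lemma reduced_sections_binop:
  assumes U: "openin X U" and F0: "F 0 0 = 0"
    and smooth: "\<And>n V f g. smooth_on_Rn n V f \<Longrightarrow> smooth_on_Rn n V g \<Longrightarrow> (\<And>x. x \<in> V \<Longrightarrow> Q (f x) (g x)) \<Longrightarrow>
      smooth_on_Rn n V (\<lambda>x. F (f x) (g x))"
    and g: "g1 \<in> reduced_sections X \<O> U" "g2 \<in> reduced_sections X \<O> U" and Q: "\<And>a. a \<in> U \<Longrightarrow> Q (g1 a) (g2 a)"
  shows "(\<lambda>a. F (g1 a) (g2 a)) \<in> reduced_sections X \<O> U"
proof (rule reduced_sections_local)
  fix a assume a: "a \<in> U"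
  then obtain c where c: "c \<in> charts X \<O>" "a \<in> chart_dom c" using ex_chart openin_subset[OF U] by blast
  note cD = chartD[OF c(1)]
  define V where "V = U \<inter> chart_dom c"
  have V: "openin X V" "V \<subseteq> chart_dom c" "V \<subseteq> U" using U cD(1) by (auto simp: V_def)
  define r where "r g b = (if b \<in> V then g b else (0::complex))" for g b
  have rr: "r g \<in> reduced_sections X \<O> V" if "g \<in> reduced_sections X \<O> U" for g
    using reduced_sections_restrict[OF that V(1,3)] by (simp add: r_def[abs_def])
  have rs: "smooth_on_Rn (chart_dim c) (chart_map c ` V) (r g \<circ> chart_inv c)" if "g \<in> reduced_sections X \<O> U" for g
    using cD(6)[OF V(1,2), of "r g"] rr[OF that] by (simp add: r_def)
  let ?h = "\<lambda>b. F (r g1 b) (r g2 b)"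
  have inv: "chart_inv c (chart_map c b) = b" if "b \<in> V" for b using chart_inv_map[OF c(1)] V that by blast
  have "smooth_on_Rn (chart_dim c) (chart_map c ` V) (\<lambda>x. F ((r g1 \<circ> chart_inv c) x) ((r g2 \<circ> chart_inv c) x))"
  proof (rule smooth[OF rs[OF g(1)] rs[OF g(2)]])
    fix x assume "x \<in> chart_map c ` V"
    then show "Q ((r g1 \<circ> chart_inv c) x) ((r g2 \<circ> chart_inv c) x)"
      using inv Q V by (auto simp: r_def)
  qed
  then have "smooth_on_Rn (chart_dim c) (chart_map c ` V) (?h \<circ> chart_inv c)" by (simp add: o_def)
  then have "?h \<in> reduced_sections X \<O> V"
    using cD(6)[OF V(1,2), of ?h] F0 by (simp add: r_def)
  then show "\<exists>V h. openin X V \<and> a \<in> V \<and> V \<subseteq> U \<and> h \<in> reduced_sections X \<O> V \<and> (\<forall>b\<in>V. F (g1 b) (g2 b) = h b)"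
    using V a c by (intro exI[of _ V] exI[of _ ?h]) (auto simp: V_def r_def)
qed (use F0 reduced_sections_outside[OF g(1)] reduced_sections_outside[OF g(2)] in simp)

lemma reduced_sections_add:
  assumes "openin X U" "g \<in> reduced_sections X \<O> U" "h \<in> reduced_sections X \<O> U"
  shows "(\<lambda>a. g a + h a) \<in> reduced_sections X \<O> U"
  by (rule reduced_sections_binop[where Q = "\<lambda>_ _. True", OF assms(1) _ _ assms(2,3)]) (auto intro: smooth_on_Rn_add)

lemma reduced_sections_mult:
  assumes "openin X U" "g \<in> reduced_sections X \<O> U" "h \<in> reduced_sections X \<O> U"
  shows "(\<lambda>a. g a * h a) \<in> reduced_sections X \<O> U"
  by (rule reduced_sections_binop[where Q = "\<lambda>_ _. True", OF assms(1) _ _ assms(2,3)]) (auto intro: smooth_on_Rn_mult)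

lemma reduced_sections_scale:
  assumes "openin X U" "g \<in> reduced_sections X \<O> U"
  shows "(\<lambda>a. c * g a) \<in> reduced_sections X \<O> U"
  by (rule reduced_sections_binop[where Q = "\<lambda>_ _. True" and F = "\<lambda>x y. c * x", OF assms(1) _ _ assms(2,2)])
    (auto intro: smooth_on_Rn_mult smooth_on_Rn_const)

text \<open>Off \<open>U\<close> both functions are 0, and 0 / 0 = 0 keeps the quotient extended by
  zero.\<close>

lemma reduced_sections_divide:
  assumes "openin X U" "g \<in> reduced_sections X \<O> U" "h \<in> reduced_sections X \<O> U" "\<And>a. a \<in> U \<Longrightarrow> h a \<noteq> 0"
  shows "(\<lambda>a. g a / h a) \<in> reduced_sections X \<O> U"
  by (rule reduced_sections_binop[where Q = "\<lambda>_ y. y \<noteq> 0", OF assms(1) _ _ assms(2,3)])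
    (use assms(4) in \<open>auto simp: divide_inverse intro!: smooth_on_Rn_mult smooth_on_Rn_inverse\<close>)

lemma reduced_sections_zero: "openin X U \<Longrightarrow> (\<lambda>_. 0) \<in> reduced_sections X \<O> U"
  using reduced_sections_eval[OF _ zero_O_closed, of U] eval_at_zero[of U] by (simp add: if_distrib cong: if_cong)

lemma reduced_sections_sum:
  assumes "openin X U" "\<And>i. i \<in> I \<Longrightarrow> g i \<in> reduced_sections X \<O> U"
  shows "(\<lambda>a. \<Sum>i\<in>I. g i a) \<in> reduced_sections X \<O> U"
  using assms(2)
  by (induction I rule: infinite_finite_induct)
    (auto intro: reduced_sections_add[OF assms(1)] simp: reduced_sections_zero[OF assms(1)])

section \<open>Bumps on the formal manifold\<close>

lemma Hausdorff: "Hausdorff_space X"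
  using formal_manifold by (simp add: formal_manifold_def)

text \<open>The Euclidean bump, read as a power series without higher terms, is a section over
  \<open>U\<close> that is zero on \<open>U\<close> minus \<open>L\<close>; it glues with the zero
  section on the complement of \<open>L\<close>. Thus it is 1 on \<open>N\<close> and 0 off
  \<open>L\<close> as a section of \<O>, so multiplication by it is the identity or zero on every
  module.\<close>

lemma bump_section:
  assumes W: "openin X W" and p: "p \<in> W"
  obtains s N L where "s \<in> carrier (sections \<O> (topspace X))" "openin X N" "p \<in> N" "N \<subseteq> L"
    "compactin X L" "L \<subseteq> W" "restr \<O> (topspace X) N s = \<one>\<^bsub>sections \<O> N\<^esub>"
    "restr \<O> (topspace X) (topspace X - L) s = \<zero>\<^bsub>sections \<O> (topspace X - L)\<^esub>"
    "\<And>b. b \<in> topspace X \<Longrightarrow> \<exists>t\<in>{0..1}. eval_at X \<O> (topspace X) s b = complex_of_real t"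
proof -
  have "p \<in> topspace X" using assms openin_subset by blast
  then have "\<exists>s N L. s \<in> carrier (sections \<O> (topspace X)) \<and> openin X N \<and> p \<in> N \<and> N \<subseteq> L \<and>
    compactin X L \<and> L \<subseteq> W \<and> restr \<O> (topspace X) N s = \<one>\<^bsub>sections \<O> N\<^esub> \<and>
    restr \<O> (topspace X) (topspace X - L) s = \<zero>\<^bsub>sections \<O> (topspace X - L)\<^esub> \<and>
    (\<forall>b\<in>topspace X. \<exists>t\<in>{0..1}. eval_at X \<O> (topspace X) s b = complex_of_real t)"
  proof (rule local_model, goal_cases)
    case (1 U n \<phi> E)
    note U = 1(1) and pU = 1(2) and \<phi> = 1(3) and opn = 1(4) and E = 1(6) and evE = 1(7) and resE = 1(8)
      and E0 = 1(9) and E1 = 1(10)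
    have top: "topspace (subtopology X U) = U" using openin_subset[OF U] by auto
    have surj: "\<phi> ` U = topspace (Rn n)" using homeomorphic_imp_surjective_map[OF \<phi>] top by simp
    have inj: "inj_on \<phi> U" using homeomorphic_imp_injective_map[OF \<phi>] top by simp
    obtain \<psi> where "homeomorphic_maps (subtopology X U) (Rn n) \<phi> \<psi>"
      using \<phi> homeomorphic_map_maps by blast
    then have \<psi>: "continuous_map (Rn n) (subtopology X U) \<psi>" "\<And>x. x \<in> topspace (Rn n) \<Longrightarrow> \<phi> (\<psi> x) = x"
      "\<And>x. x \<in> U \<Longrightarrow> \<psi> (\<phi> x) = x"
      using top by (auto simp: homeomorphic_maps_def)
    have \<phi>c: "continuous_map (subtopology X U) (Rn n) \<phi>" using \<phi> homeomorphic_imp_continuous_map by blast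
    have UW: "openin X (U \<inter> W)" using U W by blast
    obtain b N0 L0 where b: "smooth_on_Rn n (topspace (Rn n)) b" and N0: "openin (Rn n) N0" "\<phi> p \<in> N0" "N0 \<subseteq> L0"
      and L0: "compactin (Rn n) L0" "L0 \<subseteq> \<phi> ` (U \<inter> W)" and b1: "\<And>x. x \<in> N0 \<Longrightarrow> b x = 1"
      and b0: "\<And>x. x \<in> topspace (Rn n) - L0 \<Longrightarrow> b x = 0" and b01: "\<And>x. \<exists>t\<in>{0..1}. b x = complex_of_real t"
      by (rule bump_on_Rn[OF opn[OF UW Int_lower1], of "\<phi> p"]) (use p pU in auto)
    have L0t: "L0 \<subseteq> topspace (Rn n)" using L0 compactin_subset_topspace by blast
    define N where "N = {x \<in> U. \<phi> x \<in> N0}"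
    define L where "L = {x \<in> U. \<phi> x \<in> L0}"
    have No: "openin X N"
    proof -
      have "openin (subtopology X U) {x \<in> topspace (subtopology X U). \<phi> x \<in> N0}"
        using openin_continuous_map_preimage[OF \<phi>c N0(1)] .
      from openin_trans_full[OF this U] show ?thesis unfolding N_def top .
    qed
    have "L = \<psi> ` L0"
    proof
      show "L \<subseteq> \<psi> ` L0" using \<psi>(3) by (force simp: L_def)
      show "\<psi> ` L0 \<subseteq> L"
        using \<psi>(1,2) L0t top unfolding L_def continuous_map_def by (auto simp: Pi_iff)
    qed
    then have Lc: "compactin (subtopology X U) L" using image_compactin[OF L0(1) \<psi>(1)] by simp
    then have Lc': "compactin X L" by (simp add: compactin_subtopology)
    have LW: "L \<subseteq> W"
      using L0(2) inj unfolding L_def by (auto dest!: subsetD inj_onD)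
    \<comment> \<open>Compact sets are closed in a Hausdorff space. Hence \<open>U\<close> and the
      complement of \<open>L\<close> form an open cover, over which the section is glued.\<close>
    have Lo: "openin X (topspace X - L)"
      using compactin_imp_closedin[OF Hausdorff Lc'] by blast
    have LU: "L \<subseteq> U" by (auto simp: L_def)
    have sm: "smooth_on_Rn n (\<phi> ` V) b" if "V \<subseteq> U" for V
      using image_mono[OF that, of \<phi>] unfolding surj by (rule smooth_on_Rn_subset[OF b])
    have un: "U \<union> (topspace X - L) = topspace X" using LU openin_subset[OF U] by blast
    have sU: "E U b \<in> carrier (sections \<O> U)" using E[OF U subset_refl sm] by blast
    have oi: "openin X (U \<inter> (topspace X - L))" using U Lo by blast
    have "restr \<O> U (U \<inter> (topspace X - L)) (E U b) = E (U \<inter> (topspace X - L)) b"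
      using resE[OF U oi subset_refl Int_lower1 sm] by blast
    also have "\<dots> = \<zero>\<^bsub>sections \<O> (U \<inter> (topspace X - L))\<^esub>"
    proof (rule E0[OF oi Int_lower1])
      fix x assume "x \<in> \<phi> ` (U \<inter> (topspace X - L))"
      then have "x \<in> topspace (Rn n) - L0" using surj by (auto simp: L_def)
      then show "b x = 0" by (rule b0)
    qed
    also have "\<dots> = restr \<O> (topspace X - L) (U \<inter> (topspace X - L)) \<zero>\<^bsub>sections \<O> (topspace X - L)\<^esub>"
      using restr_zero[OF Lo oi Int_lower2] by simp
    finally obtain s where s: "s \<in> carrier (sections \<O> (topspace X))" "restr \<O> (topspace X) U s = E U b"
      "restr \<O> (topspace X) (topspace X - L) s = \<zero>\<^bsub>sections \<O> (topspace X - L)\<^esub>"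
      using sheaf_glue_two[OF sheaf_O U Lo sU zero_O_closed[OF Lo]] unfolding un by blast
    have T: "openin X (topspace X)" by simp
    have NU: "N \<subseteq> U" by (auto simp: N_def)
    have "restr \<O> (topspace X) N s = restr \<O> U N (restr \<O> (topspace X) U s)"
      using restr_restr[OF T U No NU openin_subset[OF U] s(1)] by simp
    also have "\<dots> = E N b" unfolding s(2) using resE[OF U No subset_refl NU sm] by blast
    also have "\<dots> = \<one>\<^bsub>sections \<O> N\<^esub>" by (rule E1[OF No NU]) (auto simp: N_def b1)
    finally have "restr \<O> (topspace X) N s = \<one>\<^bsub>sections \<O> N\<^esub>" .
    moreover have "\<exists>t\<in>{0..1}. eval_at X \<O> (topspace X) s x = complex_of_real t" if x: "x \<in> topspace X" for x
    proof (cases "x \<in> U")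
      case True
      have "eval_at X \<O> (topspace X) s x = b (\<phi> x)"
        using eval_at_restr[OF T U openin_subset[OF U] True s(1)] evE[OF U subset_refl sm[OF subset_refl] True] s(2)
        by simp
      then show ?thesis using b01 by simp
    next
      case False
      then have xL: "x \<in> topspace X - L" using x LU by blast
      have "eval_at X \<O> (topspace X) s x = 0"
        using eval_at_restr[OF T Lo _ xL s(1)] eval_at_zero[OF Lo xL] s(3) by simp
      then show ?thesis by (intro bexI[of _ 0]) auto
    qed
    moreover have "p \<in> N" "N \<subseteq> L" using pU N0 by (auto simp: N_def L_def)
    ultimately show ?case using s No Lc' LW by blast
  qed
  then show thesis using that by blast
qed

lemma bump_function:
  assumes W: "openin X W" and p: "p \<in> W"
  obtains g N L where "g \<in> reduced_sections X \<O> (topspace X)" "openin X N" "p \<in> N" "N \<subseteq> L"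
    "compactin X L" "L \<subseteq> W" "\<And>b. b \<in> N \<Longrightarrow> g b = 1" "\<And>b. b \<notin> L \<Longrightarrow> g b = 0"
    "\<And>b. \<exists>t\<in>{0..1}. g b = complex_of_real t"
proof -
  obtain s N L where s: "s \<in> carrier (sections \<O> (topspace X))" and N: "openin X N" "p \<in> N" "N \<subseteq> L"
    and L: "compactin X L" "L \<subseteq> W" and s1: "restr \<O> (topspace X) N s = \<one>\<^bsub>sections \<O> N\<^esub>"
    and s0: "restr \<O> (topspace X) (topspace X - L) s = \<zero>\<^bsub>sections \<O> (topspace X - L)\<^esub>"
    and s01: "\<And>b. b \<in> topspace X \<Longrightarrow> \<exists>t\<in>{0..1}. eval_at X \<O> (topspace X) s b = complex_of_real t"
    by (rule bump_section[OF assms]) (rule that; assumption)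
  let ?g = "\<lambda>a. if a \<in> topspace X then eval_at X \<O> (topspace X) s a else 0"
  have T: "openin X (topspace X)" by simp
  have Lo: "openin X (topspace X - L)" using compactin_imp_closedin[OF Hausdorff L(1)] by blast
  have Nt: "N \<subseteq> topspace X" using N openin_subset by blast
  show thesis
  proof (rule that[of ?g N L])
    show "?g \<in> reduced_sections X \<O> (topspace X)" by (rule reduced_sections_eval[OF T s])
    show "?g b = 1" if "b \<in> N" for b
      using eval_at_restr[OF T N(1) Nt that s] eval_at_one[OF N(1) that] s1 Nt that by auto
    show "?g b = 0" if "b \<notin> L" for b
    proof (cases "b \<in> topspace X")
      case True
      then have b: "b \<in> topspace X - L" using that by blast
      show ?thesis using eval_at_restr[OF T Lo _ b s] eval_at_zero[OF Lo b] s0 by simp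
    qed simp
    show "\<exists>t\<in>{0..1}. ?g b = complex_of_real t" for b
      using s01[of b] by (cases "b \<in> topspace X") (auto intro!: bexI[of _ 0])
  qed (use N L in auto)
qed

end

section \<open>Partitions of unity on the reduction\<close>

lemma compactin_finite_subcover:
  assumes K: "compactin X K" and N: "\<And>p. p \<in> K \<Longrightarrow> openin X (N p) \<and> p \<in> N p"
  obtains F where "finite F" "F \<subseteq> K" "K \<subseteq> (\<Union>p\<in>F. N p)"
proof -
  have cover: "(\<forall>U\<in>N ` K. openin X U) \<and> K \<subseteq> \<Union>(N ` K)" using N by auto
  from K[unfolded compactin_def, THEN conjunct2, THEN spec, THEN mp, OF cover]
  obtain \<F> where \<F>: "finite \<F>" "\<F> \<subseteq> N ` K" "K \<subseteq> \<Union>\<F>" by blast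
  from finite_subset_image[OF \<F>(1,2)] obtain F where "finite F" "F \<subseteq> K" "\<F> = N ` F" by blast
  with \<F> show thesis by (intro that[of F]) auto
qed

lemma paracompact_refinement:
  assumes "paracompact_space X" "\<Union>\<U> = topspace X" "\<And>U. U \<in> \<U> \<Longrightarrow> openin X U"
  obtains \<V> where "\<forall>V\<in>\<V>. openin X V" "\<Union>\<V> = topspace X" "\<forall>V\<in>\<V>. \<exists>U\<in>\<U>. V \<subseteq> U" "locally_finite_in X \<V>"
proof -
  have cover: "(\<forall>U\<in>\<U>. openin X U) \<and> \<Union>\<U> = topspace X" using assms by blast
  from assms(1)[unfolded paracompact_space_def, THEN spec, THEN mp, OF cover] that show thesis by blast
qed

text \<open>
  A second refinement shrinks the locally finite cover \<open>\<W>\<close> to compact sets: \<open>K W\<close> is the closure of the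
  union of those of its members that were assigned to \<open>W\<close>.
\<close>

lemma Hausdorff_compact_shrinking:
  assumes X: "Hausdorff_space X" "paracompact_space X"
    and \<W>: "locally_finite_in X \<W>" "\<And>W. W \<in> \<W> \<Longrightarrow> \<exists>L. compactin X L \<and> W \<subseteq> L"
    and nbhd: "\<And>p. p \<in> topspace X \<Longrightarrow> \<exists>W\<in>\<W>. \<exists>N L. openin X N \<and> p \<in> N \<and> N \<subseteq> L \<and> compactin X L \<and> L \<subseteq> W"
  obtains K where "\<And>W. W \<in> \<W> \<Longrightarrow> compactin X (K W) \<and> K W \<subseteq> W" "topspace X = (\<Union>W\<in>\<W>. K W)"
proof -
  let ?cl = "Abstract_Topology.closure_of X"
  \<comment> \<open>Small sets with a compact set between them and a member of \<W>. A set of a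
    refinement then has its closure inside that member, as compact sets are closed.\<close>
  define \<U> where "\<U> = {N. openin X N \<and> (\<exists>W\<in>\<W>. \<exists>L. N \<subseteq> L \<and> compactin X L \<and> L \<subseteq> W)}"
  have "\<Union>\<U> = topspace X"
  proof
    show "\<Union>\<U> \<subseteq> topspace X" unfolding \<U>_def by (auto dest!: openin_subset)
    show "topspace X \<subseteq> \<Union>\<U>"
    proof
      fix p assume "p \<in> topspace X"
      from nbhd[OF this] obtain W N L where "W \<in> \<W>" "openin X N" "p \<in> N" "N \<subseteq> L" "compactin X L" "L \<subseteq> W"
        by (elim bexE exE conjE) (rule that; assumption)
      then show "p \<in> \<Union>\<U>" unfolding \<U>_def by (intro UnionI[of N]) auto
    qed
  qed
  moreover have "openin X U" if "U \<in> \<U>" for U using that by (simp add: \<U>_def)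
  ultimately obtain \<V> where \<V>: "\<forall>V\<in>\<V>. openin X V" "\<Union>\<V> = topspace X" "\<forall>V\<in>\<V>. \<exists>U\<in>\<U>. V \<subseteq> U" "locally_finite_in X \<V>"
    by (rule paracompact_refinement[OF X(2)])
  have "\<exists>W. W \<in> \<W> \<and> ?cl V \<subseteq> W" if V: "V \<in> \<V>" for V
  proof -
    obtain U where "U \<in> \<U>" "V \<subseteq> U" using \<V>(3) V by blast
    then obtain W L where L: "W \<in> \<W>" "V \<subseteq> L" "compactin X L" "L \<subseteq> W" unfolding \<U>_def by blast
    have "?cl V \<subseteq> L" using closure_of_minimal[OF L(2)] compactin_imp_closedin[OF X(1) L(3)] by blast
    with L show ?thesis by blast
  qed
  then obtain w where w: "\<And>V. V \<in> \<V> \<Longrightarrow> w V \<in> \<W> \<and> ?cl V \<subseteq> w V" by metis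
  define K where "K W = ?cl (\<Union>{V \<in> \<V>. w V = W})" for W
  \<comment> \<open>For a locally finite family, closure commutes with union. So \<open>K W\<close>
    is closed and still contained in \<open>W\<close>.\<close>
  have K: "K W = (\<Union>V\<in>{V \<in> \<V>. w V = W}. ?cl V)" for W
    unfolding K_def by (rule closure_of_locally_finite_Union[OF locally_finite_in_subset[OF \<V>(4)]]) auto
  show thesis
  proof (rule that[of K])
    fix W assume W: "W \<in> \<W>"
    then obtain L where L: "compactin X L" "W \<subseteq> L" using \<W>(2) by blast
    have sub: "K W \<subseteq> W" unfolding K using w by blast
    moreover have "closedin X (K W)" unfolding K_def by simp
    ultimately show "compactin X (K W) \<and> K W \<subseteq> W" using closed_compactin[OF L(1), of "K W"] L(2) by blast
  next
    show "topspace X = (\<Union>W\<in>\<W>. K W)"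
    proof
      show "topspace X \<subseteq> (\<Union>W\<in>\<W>. K W)"
      proof
        fix x assume "x \<in> topspace X"
        then obtain V where V: "V \<in> \<V>" "x \<in> V" using \<V>(2) by blast
        have "V \<subseteq> ?cl V" by (rule closure_of_subset) (use \<V> V openin_subset in blast)
        then show "x \<in> (\<Union>W\<in>\<W>. K W)" using V w unfolding K by blast
      qed
      show "(\<Union>W\<in>\<W>. K W) \<subseteq> topspace X" unfolding K_def by (intro UN_least closure_of_subset_topspace)
    qed
  qed
qed

context formal_mfd begin

lemma paracompact: "paracompact_space X"
  using formal_manifold by (simp add: formal_manifold_def)

text \<open>The neighbourhood \<open>N\<close> of a bump sits in a chart domain and in a compact
  set. A locally finite refinement by such sets inherits both properties, which makes the compact
  shrinking applicable.\<close>

lemma chart_cover: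
  obtains \<W> c where "\<And>W. W \<in> \<W> \<Longrightarrow> openin X W" "\<Union>\<W> = topspace X" "locally_finite_in X \<W>"
    "\<And>W. W \<in> \<W> \<Longrightarrow> c W \<in> charts X \<O> \<and> W \<subseteq> chart_dom (c W) \<and> (\<exists>L. compactin X L \<and> W \<subseteq> L)"
proof -
  define \<U> where "\<U> = {N. openin X N \<and> (\<exists>c\<in>charts X \<O>. N \<subseteq> chart_dom c \<and> (\<exists>L. compactin X L \<and> N \<subseteq> L))}"
  have "\<Union>\<U> = topspace X"
  proof
    show "\<Union>\<U> \<subseteq> topspace X" unfolding \<U>_def by (auto dest!: openin_subset)
    show "topspace X \<subseteq> \<Union>\<U>"
    proof
      fix p assume "p \<in> topspace X"
      then obtain c where c: "c \<in> charts X \<O>" "p \<in> chart_dom c" using ex_chart by blast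
      obtain g N L where N: "openin X N" "p \<in> N" "N \<subseteq> L" "compactin X L" "L \<subseteq> chart_dom c"
        by (rule bump_function[OF chartD(1)[OF c(1)] c(2)])
      have "N \<in> \<U>" unfolding \<U>_def using N c(1) by blast
      then show "p \<in> \<Union>\<U>" using N(2) by blast
    qed
  qed
  moreover have "openin X U" if "U \<in> \<U>" for U using that by (simp add: \<U>_def)
  ultimately obtain \<W> where \<W>: "\<forall>V\<in>\<W>. openin X V" "\<Union>\<W> = topspace X" "\<forall>V\<in>\<W>. \<exists>U\<in>\<U>. V \<subseteq> U" "locally_finite_in X \<W>"
    by (rule paracompact_refinement[OF paracompact])
  have "\<exists>c. c \<in> charts X \<O> \<and> W \<subseteq> chart_dom c \<and> (\<exists>L. compactin X L \<and> W \<subseteq> L)" if W: "W \<in> \<W>" for W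
  proof -
    obtain U where "U \<in> \<U>" "W \<subseteq> U" using \<W>(3) W by blast
    then show ?thesis unfolding \<U>_def by blast
  qed
  then obtain c where "\<And>W. W \<in> \<W> \<Longrightarrow> c W \<in> charts X \<O> \<and> W \<subseteq> chart_dom (c W) \<and> (\<exists>L. compactin X L \<and> W \<subseteq> L)"
    by metis
  with \<W> show thesis by (intro that[of \<W> c]) auto
qed

text \<open>A sum of finitely many bumps whose neighbourhoods of value 1 cover \<open>K\<close>.
  Real parts are taken because bump values are complex numbers that happen to be real, while
  positivity needs an order.\<close>

lemma positive_function:
  assumes K: "compactin X K" "K \<subseteq> W" and W: "openin X W"
  obtains \<tau> Q where "(\<lambda>b. complex_of_real (\<tau> b)) \<in> reduced_sections X \<O> (topspace X)" "compactin X Q" "Q \<subseteq> W"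
    "\<And>b. b \<notin> Q \<Longrightarrow> \<tau> b = 0" "\<And>b. 0 \<le> \<tau> b" "\<And>b. b \<in> K \<Longrightarrow> 0 < \<tau> b"
proof -
  define P where "P p t N L \<longleftrightarrow> (\<lambda>b. complex_of_real (t b)) \<in> reduced_sections X \<O> (topspace X) \<and> openin X N \<and> p \<in> N \<and>
    compactin X L \<and> L \<subseteq> W \<and> (\<forall>b\<in>N. t b = 1) \<and> (\<forall>b. b \<notin> L \<longrightarrow> t b = 0) \<and> (\<forall>b. 0 \<le> t b)" for p t N L
  have "\<exists>t N L. P p t N L" if p: "p \<in> K" for p
  proof -
    have pW: "p \<in> W" using p K by blast
    obtain g N L where g: "g \<in> reduced_sections X \<O> (topspace X)" "openin X N" "p \<in> N" "N \<subseteq> L"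
      "compactin X L" "L \<subseteq> W" "\<And>b. b \<in> N \<Longrightarrow> g b = 1" "\<And>b. b \<notin> L \<Longrightarrow> g b = 0"
      "\<And>b. \<exists>t\<in>{0..1}. g b = complex_of_real t"
      by (rule bump_function[OF W pW]) (rule that; assumption)
    have Re: "complex_of_real (Re (g b)) = g b \<and> 0 \<le> Re (g b)" for b
    proof -
      obtain t where "t \<in> {0..1}" "g b = complex_of_real t" using g(9) by blast
      then show ?thesis by simp
    qed
    have "(\<lambda>b. complex_of_real (Re (g b))) = g" using Re by auto
    then show ?thesis unfolding P_def using g Re by (intro exI[of _ "\<lambda>b. Re (g b)"] exI[of _ N] exI[of _ L]) auto
  qed
  then obtain t N L where P: "\<And>p. p \<in> K \<Longrightarrow> P p (t p) (N p) (L p)" by metis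
  note t = P[unfolded P_def]
  have "\<And>p. p \<in> K \<Longrightarrow> openin X (N p) \<and> p \<in> N p" using t by blast
  from compactin_finite_subcover[OF K(1) this] obtain F where F: "finite F" "F \<subseteq> K" "K \<subseteq> (\<Union>p\<in>F. N p)" by blast
  show thesis
  proof (rule that[of "\<lambda>b. \<Sum>p\<in>F. t p b" "\<Union>(L ` F)"])
    have "(\<lambda>b. \<Sum>p\<in>F. complex_of_real (t p b)) \<in> reduced_sections X \<O> (topspace X)"
      by (rule reduced_sections_sum) (use t F in auto)
    then show "(\<lambda>b. complex_of_real (\<Sum>p\<in>F. t p b)) \<in> reduced_sections X \<O> (topspace X)" by simp
    show "compactin X (\<Union>(L ` F))" by (rule compactin_Union) (use t F in auto)
    show "\<Union>(L ` F) \<subseteq> W" using t F by blast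
    show "(\<Sum>p\<in>F. t p b) = 0" if b: "b \<notin> \<Union>(L ` F)" for b
      by (rule sum.neutral) (use b t F in blast)
    show "0 \<le> (\<Sum>p\<in>F. t p b)" for b
      by (rule sum_nonneg) (use t F in blast)
    show "0 < (\<Sum>p\<in>F. t p b)" if b: "b \<in> K" for b
    proof -
      obtain p where p: "p \<in> F" "b \<in> N p" using F b by blast
      have "t p b = 1" using p t F by blast
      then show ?thesis using p F t by (intro sum_pos2[of F p]) auto
    qed
  qed
qed

text \<open>Positive functions on a locally finite cover are divided by their sum.
  \<open>partition_of_unity\<close> is indexed by charts instead of members of the cover, so the
  functions are collected according to the chart assigned to each member.\<close>

lemma ex_partition_of_unity: "\<exists>\<rho>. partition_of_unity X \<O> \<rho>"
proof -
  obtain \<W> c where \<W>: "\<And>W. W \<in> \<W> \<Longrightarrow> openin X W" "\<Union>\<W> = topspace X" "locally_finite_in X \<W>"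
    and c: "\<And>W. W \<in> \<W> \<Longrightarrow> c W \<in> charts X \<O> \<and> W \<subseteq> chart_dom (c W) \<and> (\<exists>L. compactin X L \<and> W \<subseteq> L)"
    by (rule chart_cover) (rule that; assumption)
  obtain K where K: "\<And>W. W \<in> \<W> \<Longrightarrow> compactin X (K W) \<and> K W \<subseteq> W" "topspace X = (\<Union>W\<in>\<W>. K W)"
  proof (rule Hausdorff_compact_shrinking[OF Hausdorff paracompact \<W>(3)])
    show "\<exists>L. compactin X L \<and> W \<subseteq> L" if "W \<in> \<W>" for W using c[OF that] by blast
    fix p assume "p \<in> topspace X"
    then obtain W where W: "W \<in> \<W>" "p \<in> W" using \<W>(2) by blast
    obtain g N L where "openin X N" "p \<in> N" "N \<subseteq> L" "compactin X L" "L \<subseteq> W"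
      by (rule bump_function[OF \<W>(1)[OF W(1)] W(2)])
    with W(1) show "\<exists>W\<in>\<W>. \<exists>N L. openin X N \<and> p \<in> N \<and> N \<subseteq> L \<and> compactin X L \<and> L \<subseteq> W" by blast
  qed (rule that; assumption)
  define P where "P W \<tau> Q \<longleftrightarrow> (\<lambda>b. complex_of_real (\<tau> b)) \<in> reduced_sections X \<O> (topspace X) \<and> compactin X Q \<and> Q \<subseteq> W \<and>
    (\<forall>b. b \<notin> Q \<longrightarrow> \<tau> b = 0) \<and> (\<forall>b. 0 \<le> \<tau> b) \<and> (\<forall>b\<in>K W. 0 < \<tau> b)" for W \<tau> Q
  have "\<exists>\<tau> Q. P W \<tau> Q" if W: "W \<in> \<W>" for W
  proof -
    obtain \<tau> Q where "(\<lambda>b. complex_of_real (\<tau> b)) \<in> reduced_sections X \<O> (topspace X)" "compactin X Q" "Q \<subseteq> W"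
      "\<And>b. b \<notin> Q \<Longrightarrow> \<tau> b = 0" "\<And>b. 0 \<le> \<tau> b" "\<And>b. b \<in> K W \<Longrightarrow> 0 < \<tau> b"
      using K(1)[OF W] by (elim conjE) (rule positive_function[OF _ _ \<W>(1)[OF W]], assumption, assumption, rule that; assumption)
    then show ?thesis unfolding P_def by (intro exI[of _ \<tau>] exI[of _ Q]) auto
  qed
  then obtain \<tau> Q where P: "\<And>W. W \<in> \<W> \<Longrightarrow> P W (\<tau> W) (Q W)" by metis
  have \<tau>: "\<And>W. W \<in> \<W> \<Longrightarrow> (\<lambda>b. complex_of_real (\<tau> W b)) \<in> reduced_sections X \<O> (topspace X)"
    and Q: "\<And>W. W \<in> \<W> \<Longrightarrow> compactin X (Q W) \<and> Q W \<subseteq> W"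
    and \<tau>Q: "\<And>W b. W \<in> \<W> \<Longrightarrow> b \<notin> Q W \<Longrightarrow> \<tau> W b = 0"
    and \<tau>0: "\<And>W b. W \<in> \<W> \<Longrightarrow> 0 \<le> \<tau> W b" and \<tau>K: "\<And>W b. W \<in> \<W> \<Longrightarrow> b \<in> K W \<Longrightarrow> 0 < \<tau> W b"
    using P unfolding P_def by blast+
  have fin: "\<exists>V. openin X V \<and> a \<in> V \<and> finite {W \<in> \<W>. \<exists>b\<in>V. \<tau> W b \<noteq> 0}" if a: "a \<in> topspace X" for a
  proof -
    obtain V where V: "openin X V" "a \<in> V" "finite {W \<in> \<W>. W \<inter> V \<noteq> {}}"
      using \<W>(3) a unfolding locally_finite_in_def by blast
    have "{W \<in> \<W>. \<exists>b\<in>V. \<tau> W b \<noteq> 0} \<subseteq> {W \<in> \<W>. W \<inter> V \<noteq> {}}" using \<tau>Q Q by blast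
    then show ?thesis using V finite_subset by blast
  qed
  \<comment> \<open>Keeping only the nonzero terms makes the sum finite at each point; over an
    infinite index set \<open>sum\<close> would return 0.\<close>
  define F where "F \<A> a = {W \<in> \<A>. \<tau> W a \<noteq> 0}" for \<A> a
  define S where "S \<A> a = (\<Sum>W\<in>F \<A> a. \<tau> W a)" for \<A> a
  have finF: "finite (F \<A> a)" if "\<A> \<subseteq> \<W>" for \<A> a
  proof (cases "a \<in> topspace X")
    case True
    then obtain V where V: "a \<in> V" "finite {W \<in> \<W>. \<exists>b\<in>V. \<tau> W b \<noteq> 0}" using fin by blast
    have "F \<A> a \<subseteq> {W \<in> \<W>. \<exists>b\<in>V. \<tau> W b \<noteq> 0}" unfolding F_def using V(1) \<open>\<A> \<subseteq> \<W>\<close> by blast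
    then show ?thesis using V(2) finite_subset by blast
  next
    case False
    have "F \<A> a = {}" unfolding F_def using \<tau>Q Q False \<W>(2) \<open>\<A> \<subseteq> \<W>\<close> by blast
    then show ?thesis by simp
  qed
  have S_red: "(\<lambda>a. complex_of_real (S \<A> a)) \<in> reduced_sections X \<O> (topspace X)" if \<A>: "\<A> \<subseteq> \<W>" for \<A>
  proof (rule reduced_sections_local)
    show "complex_of_real (S \<A> a) = 0" if "a \<notin> topspace X" for a
    proof -
      have "F \<A> a = {}" unfolding F_def using \<tau>Q Q that \<W>(2) \<A> by blast
      then show ?thesis by (simp add: S_def)
    qed
    fix a assume "a \<in> topspace X"
    then obtain V where V: "openin X V" "a \<in> V" "finite {W \<in> \<W>. \<exists>b\<in>V. \<tau> W b \<noteq> 0}" using fin by blast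
    \<comment> \<open>The terms that matter somewhere on \<open>V\<close>. On \<open>V\<close> the
      sum \<open>S\<close> coincides with this fixed finite sum, which is a reduced section.\<close>
    define \<B> where "\<B> = {W \<in> \<A>. \<exists>b\<in>V. \<tau> W b \<noteq> 0}"
    have \<B>: "finite \<B>" "\<B> \<subseteq> \<W>"
      using finite_subset[OF _ V(3), of \<B>] \<A> unfolding \<B>_def by blast+
    have eq: "S \<A> b = (\<Sum>W\<in>\<B>. \<tau> W b)" if b: "b \<in> V" for b
      unfolding S_def by (rule sum.mono_neutral_left[OF \<B>(1)]) (use b in \<open>auto simp: F_def \<B>_def\<close>)
    have "(\<lambda>b. \<Sum>W\<in>\<B>. complex_of_real (\<tau> W b)) \<in> reduced_sections X \<O> (topspace X)"
      by (rule reduced_sections_sum) (use \<tau> \<B> in auto)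
    from reduced_sections_restrict[OF this V(1) openin_subset[OF V(1)]]
    show "\<exists>V h. openin X V \<and> a \<in> V \<and> V \<subseteq> topspace X \<and> h \<in> reduced_sections X \<O> V \<and>
        (\<forall>b\<in>V. complex_of_real (S \<A> b) = h b)"
      using V(1,2) openin_subset[OF V(1)] eq
      by (intro exI[of _ V] exI[of _ "\<lambda>b. if b \<in> V then \<Sum>W\<in>\<B>. complex_of_real (\<tau> W b) else 0"]) auto
  qed
  have S_nonneg: "0 \<le> S \<A> a" if "\<A> \<subseteq> \<W>" for \<A> a
    unfolding S_def F_def using \<tau>0 that by (intro sum_nonneg) auto
  have S_mono: "S \<A> a \<le> S \<W> a" if \<A>: "\<A> \<subseteq> \<W>" for \<A> a
    unfolding S_def
  proof (rule sum_mono2[OF finF[OF subset_refl]])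
    show "F \<A> a \<subseteq> F \<W> a" using \<A> by (auto simp: F_def)
    show "0 \<le> \<tau> b a" if "b \<in> F \<W> a - F \<A> a" for b using that \<tau>0 by (auto simp: F_def)
  qed
  have S_pos: "0 < S \<W> a" if a: "a \<in> topspace X" for a
  proof -
    obtain W where W: "W \<in> \<W>" "a \<in> K W" using a K(2) by blast
    then have "0 < \<tau> W a" using \<tau>K by blast
    then show ?thesis unfolding S_def using W \<tau>0
      by (intro sum_pos2[OF finF[OF subset_refl], of W]) (auto simp: F_def)
  qed
  \<comment> \<open>All members of the cover that were assigned the chart \<open>d\<close>; there
    may be infinitely many.\<close>
  define fib where "fib d = {W \<in> \<W>. c W = d}" for d
  have fib: "fib d \<subseteq> \<W>" for d by (auto simp: fib_def)
  define \<rho> where "\<rho> d a = complex_of_real (S (fib d) a) / complex_of_real (S \<W> a)" for d a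
  have nz: "\<exists>W\<in>fib d. \<tau> W a \<noteq> 0" if "\<rho> d a \<noteq> 0" for d a
  proof (rule ccontr)
    assume "\<not> ?thesis"
    then have "F (fib d) a = {}" by (auto simp: F_def)
    then have "\<rho> d a = 0" by (simp add: \<rho>_def S_def)
    then show False using that by simp
  qed
  have "partition_of_unity X \<O> \<rho>"
    unfolding partition_of_unity_def
  proof (intro conjI ballI)
    fix d assume d: "d \<in> charts X \<O>"
    show "\<rho> d \<in> reduced_sections X \<O> (topspace X)"
      unfolding \<rho>_def[abs_def] using S_pos
      by (intro reduced_sections_divide S_red fib subset_refl) (auto simp: less_imp_neq[symmetric] dest: S_pos)
    show "\<exists>t\<in>{0..1}. \<rho> d a = complex_of_real t" if a: "a \<in> topspace X" for a
    proof
      show "\<rho> d a = complex_of_real (S (fib d) a / S \<W> a)" by (simp add: \<rho>_def)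
      show "S (fib d) a / S \<W> a \<in> {0..1}"
        using S_nonneg[OF fib] S_mono[OF fib, of d a] S_pos[OF a] by (simp add: divide_simps)
    qed
    show "Abstract_Topology.closure_of X {a \<in> topspace X. \<rho> d a \<noteq> 0} \<subseteq> chart_dom d"
    proof -
      \<comment> \<open>The compact sets \<open>Q W\<close> of one fibre form a locally finite
        family, so their union is closed and contains the closure of the set where
        \<open>\<rho> d\<close> is nonzero.\<close>
      have lf: "locally_finite_in X (Q ` fib d)"
        by (rule locally_finite_in_refinement[OF locally_finite_in_subset[OF \<W>(3) fib]]) (use Q fib in blast)
      have "closedin X (\<Union>(Q ` fib d))"
        by (rule closedin_locally_finite_Union[OF _ lf])
          (use Q fib compactin_imp_closedin[OF Hausdorff] in blast)
      moreover have "{a \<in> topspace X. \<rho> d a \<noteq> 0} \<subseteq> \<Union>(Q ` fib d)"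
        using nz \<tau>Q fib by blast
      ultimately have "Abstract_Topology.closure_of X {a \<in> topspace X. \<rho> d a \<noteq> 0} \<subseteq> \<Union>(Q ` fib d)"
        by (simp add: closure_of_minimal)
      also have "\<dots> \<subseteq> chart_dom d" unfolding fib_def using Q c by blast
      finally show ?thesis .
    qed
  next
    fix a assume a: "a \<in> topspace X"
    then obtain V where V: "openin X V" "a \<in> V" "finite {W \<in> \<W>. \<exists>b\<in>V. \<tau> W b \<noteq> 0}" using fin by blast
    have "{d \<in> charts X \<O>. \<exists>b\<in>V. \<rho> d b \<noteq> 0} \<subseteq> c ` {W \<in> \<W>. \<exists>b\<in>V. \<tau> W b \<noteq> 0}"
      using nz unfolding fib_def by blast
    then show "\<exists>W. openin X W \<and> a \<in> W \<and> finite {d \<in> charts X \<O>. \<exists>b\<in>W. \<rho> d b \<noteq> 0}"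
      using V finite_subset[OF _ finite_imageI[OF V(3)]] by blast
  next
    fix a assume a: "a \<in> topspace X"
    have "(\<Sum>d | d \<in> charts X \<O> \<and> \<rho> d a \<noteq> 0. \<rho> d a) = (\<Sum>d\<in>c ` F \<W> a. \<rho> d a)"
    proof (rule sum.mono_neutral_left)
      show "finite (c ` F \<W> a)" using finF by simp
      show "{d \<in> charts X \<O>. \<rho> d a \<noteq> 0} \<subseteq> c ` F \<W> a" using nz by (auto simp: F_def fib_def)
      show "\<forall>d\<in>c ` F \<W> a - {d \<in> charts X \<O>. \<rho> d a \<noteq> 0}. \<rho> d a = 0"
        using c by (auto simp: F_def)
    qed
    also have "\<dots> = complex_of_real ((\<Sum>d\<in>c ` F \<W> a. S (fib d) a) / S \<W> a)"
      by (simp add: \<rho>_def sum_divide_distrib)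
    \<comment> \<open>Each nonzero term of the total sum belongs to exactly one chart; the terms are
      grouped along the fibres of \<open>c\<close>.\<close>
    also have "(\<Sum>d\<in>c ` F \<W> a. S (fib d) a) = S \<W> a"
    proof -
      have "F (fib d) a = {W \<in> F \<W> a. c W = d}" for d by (auto simp: F_def fib_def)
      then show ?thesis unfolding S_def by (simp add: sum.image_gen[OF finF[OF subset_refl], of "\<lambda>W. \<tau> W a" a c])
    qed
    finally show "(\<Sum>d | d \<in> charts X \<O> \<and> \<rho> d a \<noteq> 0. \<rho> d a) = 1" using S_pos[OF a] by simp
  qed
  then show ?thesis by blast
qed

end

section \<open>Integrals of compactly supported densities\<close>

lemma Rats_interval_in_open:
  assumes "open V" "(x::real) \<in> V"
  shows "\<exists>p. p \<in> \<rat> \<times> \<rat> \<and> x \<in> {fst p<..<snd p} \<and> {fst p<..<snd p} \<subseteq> V"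
proof -
  obtain e where e: "0 < e" "ball x e \<subseteq> V" using assms open_contains_ball by blast
  obtain a where a: "a \<in> \<rat>" "x - e < a" "a < x" using Rats_dense_in_real[of "x - e" x] e by auto
  obtain b where b: "b \<in> \<rat>" "x < b" "b < x + e" using Rats_dense_in_real[of x "x + e"] e by auto
  have "{a<..<b} \<subseteq> ball x e" using a b by (auto simp: dist_real_def)
  then show ?thesis using e a b by (intro exI[of _ "(a, b)"]) auto
qed

text \<open>The product sigma-algebra contains boxes, and an open set is the union of the countably
  many boxes with rational endpoints inside it.\<close>

lemma openin_Rn_in_sets:
  assumes U: "openin (Rn n) U"
  shows "U \<in> sets (PiM {..<n} (\<lambda>_. lborel))"
proof -
  define box where "box p = PiE {..<n} (\<lambda>i. {fst (p i)<..<snd (p i) :: real})" for p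
  define B where "B = {p \<in> PiE {..<n} (\<lambda>_. \<rat> \<times> \<rat>). box p \<subseteq> U}"
  have "countable (PiE {..<n} (\<lambda>_. \<rat> \<times> (\<rat> :: real set)))"
    by (intro countable_PiE countable_SIGMA countable_rat) auto
  then have B: "countable B" unfolding B_def by (rule countable_subset[rotated]) auto
  have "U \<subseteq> (\<Union>p\<in>B. box p)"
  proof
    fix x assume x: "x \<in> U"
    from U[unfolded openin_product_topology_alt] x obtain V where
      V: "\<forall>i\<in>{..<n}. openin euclideanreal (V i)" "x \<in> PiE {..<n} V" "PiE {..<n} V \<subseteq> U"
      by blast
    have "\<exists>p. p \<in> \<rat> \<times> \<rat> \<and> x i \<in> {fst p<..<snd p} \<and> {fst p<..<snd p} \<subseteq> V i" if "i < n" for i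
      using Rats_interval_in_open[of "V i" "x i"] V(1) PiE_mem[OF V(2)] that by auto
    then obtain p where p: "\<And>i. i < n \<Longrightarrow> p i \<in> \<rat> \<times> \<rat> \<and> x i \<in> {fst (p i)<..<snd (p i)} \<and> {fst (p i)<..<snd (p i)} \<subseteq> V i"
      by metis
    \<comment> \<open>Restriction to the n coordinates places the chosen endpoints in the countable
      set of extensional rational families.\<close>
    define q where "q = restrict p {..<n}"
    have "box q \<subseteq> PiE {..<n} V" unfolding box_def by (rule PiE_mono) (use p in \<open>simp add: q_def\<close>)
    moreover have "q \<in> PiE {..<n} (\<lambda>_. \<rat> \<times> \<rat>)" unfolding q_def by (rule restrict_PiE_iff[THEN iffD2]) (use p in simp)
    ultimately have "q \<in> B" using V(3) unfolding B_def by simp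
    moreover have "x \<in> box q"
      unfolding box_def
    proof (rule PiE_I)
      show "x i \<in> {fst (q i)<..<snd (q i)}" if "i \<in> {..<n}" for i using p[of i] that by (simp add: q_def)
      show "x i = undefined" if "i \<notin> {..<n}" for i using PiE_arb[OF V(2) that] .
    qed
    ultimately show "x \<in> (\<Union>p\<in>B. box p)" by blast
  qed
  then have "U = (\<Union>p\<in>B. box p)" unfolding B_def by blast
  moreover have "(\<Union>p\<in>B. box p) \<in> sets (PiM {..<n} (\<lambda>_. lborel))"
    by (rule sets.countable_UN'[OF B]) (auto simp: box_def intro!: sets_PiM_I_finite)
  ultimately show ?thesis by simp
qed

lemma space_PiM_lborel: "space (PiM {..<n} (\<lambda>_. lborel)) = topspace (Rn n)"
  by (simp add: space_PiM)

text \<open>A compact set is the complement of an open, hence measurable set. Its coordinate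
  projections are bounded, so it lies in a box of finite volume.\<close>

lemma compactin_Rn_measure:
  assumes K: "compactin (Rn n) K"
  shows "K \<in> sets (PiM {..<n} (\<lambda>_. lborel))" "emeasure (PiM {..<n} (\<lambda>_. lborel)) K < \<infinity>"
proof -
  have Kt: "K \<subseteq> topspace (Rn n)" using K compactin_subset_topspace by blast
  have "Hausdorff_space (Rn n)" by (simp add: Hausdorff_space_product_topology)
  then have "closedin (Rn n) K" using compactin_imp_closedin K by blast
  then have "topspace (Rn n) - K \<in> sets (PiM {..<n} (\<lambda>_. lborel))"
    by (intro openin_Rn_in_sets) blast
  then have "space (PiM {..<n} (\<lambda>_. lborel)) - (topspace (Rn n) - K) \<in> sets (PiM {..<n} (\<lambda>_. lborel))"
    by (rule sets.compl_sets)
  then show "K \<in> sets (PiM {..<n} (\<lambda>_. lborel))"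
    using Kt unfolding space_PiM_lborel by (simp add: double_diff)
  have "\<exists>M. \<forall>x\<in>K. \<bar>x i\<bar> \<le> M" if i: "i < n" for i
  proof -
    have "compactin euclideanreal ((\<lambda>x. x i) ` K)"
      by (rule image_compactin[OF K continuous_map_product_projection]) (simp add: i)
    then have "bounded ((\<lambda>x. x i) ` K)" by (simp add: compact_imp_bounded)
    then show ?thesis by (auto simp: bounded_iff)
  qed
  then obtain M where M: "\<And>i x. i < n \<Longrightarrow> x \<in> K \<Longrightarrow> \<bar>x i\<bar> \<le> M i" by metis
  define A where "A i = {- M i..M i}" for i
  interpret product_sigma_finite "\<lambda>_::nat. lborel :: real measure" by standard
  have "K \<subseteq> PiE {..<n} A"
  proof
    fix x assume x: "x \<in> K"
    then have "x \<in> extensional {..<n}" using Kt by (auto simp: PiE_def)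
    then show "x \<in> PiE {..<n} A" using M[OF _ x] by (auto simp: A_def PiE_iff abs_le_iff minus_le_iff)
  qed
  moreover have box: "PiE {..<n} A \<in> sets (PiM {..<n} (\<lambda>_. lborel))"
    by (intro sets_PiM_I_finite) (auto simp: A_def)
  ultimately have "emeasure (PiM {..<n} (\<lambda>_. lborel)) K \<le> emeasure (PiM {..<n} (\<lambda>_. lborel)) (PiE {..<n} A)"
    by (rule emeasure_mono)
  also have "\<dots> = (\<Prod>i<n. emeasure lborel (A i))"
    by (rule emeasure_PiM) (auto simp: A_def)
  also have "\<dots> < \<infinity>"
  proof -
    have "emeasure lborel (A i) = ennreal (measure lborel (A i))" for i
      by (rule emeasure_eq_ennreal_measure) (simp add: A_def emeasure_lborel_Icc_eq)
    then show ?thesis by (simp add: prod_ennreal)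
  qed
  finally show "emeasure (PiM {..<n} (\<lambda>_. lborel)) K < \<infinity>" .
qed

text \<open>The function is bounded on a compact set of finite measure and zero elsewhere. For
  measurability, where continuity is known on \<open>V\<close> only, a preimage is split into its
  part in \<open>V\<close> and, if it contains the zero set, the complement of
  \<open>V\<close>.\<close>

lemma integrable_continuous_compact_support:
  fixes f :: "(nat \<Rightarrow> real) \<Rightarrow> complex"
  assumes V: "openin (Rn n) V" and K: "compactin (Rn n) K" "K \<subseteq> V"
    and cont: "continuous_map (subtopology (Rn n) V) euclidean f" and 0: "\<And>x. x \<notin> K \<Longrightarrow> f x = 0"
  shows "integrable (PiM {..<n} (\<lambda>_. lborel)) f"
proof -
  let ?M = "PiM {..<n} (\<lambda>_. lborel :: real measure)"
  have Vt: "topspace (subtopology (Rn n) V) = V" using openin_subset[OF V] by auto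
  have "f \<in> borel_measurable ?M"
  proof (rule borel_measurableI)
    fix S :: "complex set" assume "open S"
    then have "openin (subtopology (Rn n) V) {x \<in> V. f x \<in> S}"
      using openin_continuous_map_preimage[OF cont, of S] unfolding Vt by simp
    then have 1: "{x \<in> V. f x \<in> S} \<in> sets ?M" using openin_trans_full[OF _ V] openin_Rn_in_sets by blast
    have 2: "space ?M - V \<in> sets ?M" using openin_Rn_in_sets[OF V] by blast
    have "f -` S \<inter> space ?M = {x \<in> V. f x \<in> S} \<union> (if 0 \<in> S then space ?M - V else {})"
      using 0 K(2) openin_subset[OF V] unfolding space_PiM_lborel by (auto split: if_splits) (metis subsetD)+
    then show "f -` S \<inter> space ?M \<in> sets ?M" using 1 2 by auto
  qed
  moreover have "\<exists>B. \<forall>x\<in>K. norm (f x) \<le> B"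
  proof -
    have "compactin (subtopology (Rn n) V) K" using K by (simp add: compactin_subtopology)
    from image_compactin[OF this cont] have "bounded (f ` K)" by (simp add: compact_imp_bounded)
    then show ?thesis by (auto simp: bounded_iff)
  qed
  then obtain B where "\<And>x. x \<in> K \<Longrightarrow> norm (f x) \<le> B" by blast
  ultimately show ?thesis
    using compactin_Rn_measure[OF K(1)] 0
    by (intro integrableI_bounded_set[of K ?M f B]) auto
qed

context formal_mfd begin

lemma integrable_chart:
  assumes c: "c \<in> charts X \<O>" and V: "openin X V" "V \<subseteq> chart_dom c" and g: "g \<in> reduced_sections X \<O> V"
    and K: "compactin X K" "K \<subseteq> V" "\<And>a. a \<notin> K \<Longrightarrow> g a = 0"
  shows "integrable (PiM {..<chart_dim c} (\<lambda>_. lborel))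
    (\<lambda>x. if x \<in> chart_map c ` chart_dom c then g (chart_inv c x) else 0)"
proof (rule integrable_continuous_compact_support)
  note cD = chartD[OF c]
  have top: "topspace (subtopology X (chart_dom c)) = chart_dom c" using openin_subset[OF cD(1)] by auto
  show V': "openin (Rn (chart_dim c)) (chart_map c ` V)" using cD(5)[OF V] .
  have Kc: "compactin (subtopology X (chart_dom c)) K" using K V by (auto simp: compactin_subtopology)
  have "compactin (subtopology (Rn (chart_dim c)) (chart_map c ` chart_dom c)) (chart_map c ` K)"
    by (rule image_compactin[OF Kc homeomorphic_imp_continuous_map[OF cD(3)]])
  then show "compactin (Rn (chart_dim c)) (chart_map c ` K)" by (simp add: compactin_subtopology)
  show "chart_map c ` K \<subseteq> chart_map c ` V" using K by blast
  have "smooth_on_Rn (chart_dim c) (chart_map c ` V) (g \<circ> chart_inv c)"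
    using cD(6)[OF V] g reduced_sections_outside[OF g] by blast
  then have "continuous_map (subtopology (Rn (chart_dim c)) (chart_map c ` V)) euclidean (g \<circ> chart_inv c)"
    by (rule smooth_on_Rn_continuous)
  then show "continuous_map (subtopology (Rn (chart_dim c)) (chart_map c ` V)) euclidean
      (\<lambda>x. if x \<in> chart_map c ` chart_dom c then g (chart_inv c x) else 0)"
    by (rule continuous_map_eq) (use V in auto)
  show "(if x \<in> chart_map c ` chart_dom c then g (chart_inv c x) else 0) = 0" if "x \<notin> chart_map c ` K" for x
  proof (cases "x \<in> chart_map c ` chart_dom c")
    case True
    then obtain a where a: "a \<in> chart_dom c" "x = chart_map c a" by blast
    then have "a \<notin> K" using that by blast
    then show ?thesis using K(3) chart_inv_map[OF c a(1)] a(2) by simp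
  qed simp
qed

section \<open>Linearity of the integral\<close>

text \<open>The same \<open>SOME\<close> term as in \<open>density_integral\<close>, so that every
  integral unfolds to this one partition of unity.\<close>

definition pou :: "'m chart \<Rightarrow> 'm \<Rightarrow> complex" where
  "pou = (SOME \<rho>. partition_of_unity X \<O> \<rho>)"

lemma pou: "partition_of_unity X \<O> pou"
  unfolding pou_def using someI_ex[OF ex_partition_of_unity] .

definition compact_density :: "'m set \<Rightarrow> 'm set \<Rightarrow> ('m chart \<Rightarrow> 'm \<Rightarrow> complex) \<Rightarrow> bool" where
  "compact_density U K \<mu> \<longleftrightarrow> \<mu> \<in> densities_on X \<O> U \<and> compactin X K \<and> K \<subseteq> U \<and> (\<forall>c a. \<mu> c a \<noteq> 0 \<longrightarrow> a \<in> K)"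

lemma finite_pou_compact:
  assumes "compactin X K"
  shows "finite {c \<in> charts X \<O>. \<exists>a\<in>K. pou c a \<noteq> 0}"
proof -
  define Q where "Q W \<longleftrightarrow> finite {c \<in> charts X \<O>. \<exists>b\<in>W. pou c b \<noteq> 0}" for W
  have "\<exists>W. openin X W \<and> a \<in> W \<and> Q W" if "a \<in> K" for a
    using pou compactin_subset_topspace[OF assms] that unfolding partition_of_unity_def Q_def by blast
  then obtain W where W: "\<And>a. a \<in> K \<Longrightarrow> openin X (W a) \<and> a \<in> W a \<and> Q (W a)"
    by metis
  have "openin X (W a) \<and> a \<in> W a" if "a \<in> K" for a using W[OF that] by blast
  from compactin_finite_subcover[OF assms this] obtain F where F: "finite F" "F \<subseteq> K" "K \<subseteq> (\<Union>p\<in>F. W p)" by blast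
  have "finite (\<Union>p\<in>F. {c \<in> charts X \<O>. \<exists>b\<in>W p. pou c b \<noteq> 0})" using F W unfolding Q_def by blast
  then show ?thesis by (rule finite_subset[rotated]) (use F in blast)
qed

text \<open>The defining sum ranges over charts selected by the density itself. Here it is replaced
  by a finite set of charts that depends on \<open>K\<close> only, so that integrals of different
  densities supported in \<open>K\<close> can be compared term by term.\<close>

lemma density_integral_eq:
  assumes K: "compactin X K" "\<And>c a. \<mu> c a \<noteq> 0 \<Longrightarrow> a \<in> K"
  shows "density_integral X \<O> \<mu> =
    (\<Sum>c | c \<in> charts X \<O> \<and> (\<exists>a\<in>K. pou c a \<noteq> 0). chart_integral c (\<lambda>a. pou c a * \<mu> c a))"
proof -
  have "density_integral X \<O> \<mu> =
    (\<Sum>c | c \<in> charts X \<O> \<and> (\<exists>a. pou c a * \<mu> c a \<noteq> 0). chart_integral c (\<lambda>a. pou c a * \<mu> c a))"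
    by (simp add: density_integral_def pou_def Let_def)
  also have "\<dots> = (\<Sum>c | c \<in> charts X \<O> \<and> (\<exists>a\<in>K. pou c a \<noteq> 0). chart_integral c (\<lambda>a. pou c a * \<mu> c a))"
  proof (rule sum.mono_neutral_left[OF finite_pou_compact[OF K(1)]])
    show "{c. c \<in> charts X \<O> \<and> (\<exists>a. pou c a * \<mu> c a \<noteq> 0)} \<subseteq> {c \<in> charts X \<O>. \<exists>a\<in>K. pou c a \<noteq> 0}"
      using K(2) by fastforce
    show "\<forall>c\<in>{c \<in> charts X \<O>. \<exists>a\<in>K. pou c a \<noteq> 0} - {c. c \<in> charts X \<O> \<and> (\<exists>a. pou c a * \<mu> c a \<noteq> 0)}.
       chart_integral c (\<lambda>a. pou c a * \<mu> c a) = 0"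
    proof
      fix c assume "c \<in> {c \<in> charts X \<O>. \<exists>a\<in>K. pou c a \<noteq> 0} - {c. c \<in> charts X \<O> \<and> (\<exists>a. pou c a * \<mu> c a \<noteq> 0)}"
      then have "(\<lambda>a. pou c a * \<mu> c a) = (\<lambda>a. 0)" by fastforce
      then show "chart_integral c (\<lambda>a. pou c a * \<mu> c a) = 0" by (simp add: chart_integral_def)
    qed
  qed
  finally show ?thesis .
qed

text \<open>The product vanishes off the intersection of \<open>K\<close> with the closure of the
  set where \<open>pou c\<close> is nonzero. That intersection is compact and lies in both
  \<open>U\<close> and the chart domain, although neither factor need have compact support
  there.\<close>

lemma integrable_compact_density:
  assumes U: "openin X U" and \<mu>: "compact_density U K \<mu>" and c: "c \<in> charts X \<O>"
  shows "integrable (PiM {..<chart_dim c} (\<lambda>_. lborel))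
    (\<lambda>x. if x \<in> chart_map c ` chart_dom c then pou c (chart_inv c x) * \<mu> c (chart_inv c x) else 0)"
proof -
  define V where "V = U \<inter> chart_dom c"
  have V: "openin X V" "V \<subseteq> chart_dom c" using U chartD(1)[OF c] by (auto simp: V_def)
  let ?C = "Abstract_Topology.closure_of X {a \<in> topspace X. pou c a \<noteq> 0}"
  have p: "pou c \<in> reduced_sections X \<O> (topspace X)" "?C \<subseteq> chart_dom c"
    using pou c unfolding partition_of_unity_def by auto
  have m: "\<mu> c \<in> reduced_sections X \<O> V" "\<And>a. a \<notin> V \<Longrightarrow> \<mu> c a = 0"
    using \<mu> c unfolding compact_density_def densities_on_def V_def by auto
  have "(\<lambda>a. (if a \<in> V then pou c a else 0) * \<mu> c a) \<in> reduced_sections X \<O> V"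
    by (rule reduced_sections_mult[OF V(1) reduced_sections_restrict[OF p(1) V(1) openin_subset[OF V(1)]] m(1)])
  moreover have "(\<lambda>a. (if a \<in> V then pou c a else 0) * \<mu> c a) = (\<lambda>a. pou c a * \<mu> c a)" using m(2) by auto
  ultimately have g: "(\<lambda>a. pou c a * \<mu> c a) \<in> reduced_sections X \<O> V" by simp
  have K: "compactin X K" "K \<subseteq> U" "\<And>a. \<mu> c a \<noteq> 0 \<Longrightarrow> a \<in> K" using \<mu> by (auto simp: compact_density_def)
  have "closedin X ?C" by simp
  then have "compactin X (?C \<inter> K)" using K(1) by (rule closed_Int_compactin)
  moreover have "?C \<inter> K \<subseteq> V" using p(2) K(2) by (auto simp: V_def)
  moreover have "pou c a * \<mu> c a = 0" if "a \<notin> ?C \<inter> K" for a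
  proof (rule ccontr)
    assume "pou c a * \<mu> c a \<noteq> 0"
    then have *: "pou c a \<noteq> 0" "a \<in> K" using K(3) by auto
    then have "a \<in> topspace X" using compactin_subset_topspace[OF K(1)] by blast
    then have "a \<in> ?C" using closure_of_subset[of "{a \<in> topspace X. pou c a \<noteq> 0}" X] * by blast
    then show False using that * by blast
  qed
  ultimately show ?thesis by (rule integrable_chart[OF c V g])
qed

text \<open>The union of \<open>K\<close> and \<open>L\<close> serves for all three densities, which
  reduces the claim to additivity in each chart; integrability is what makes the latter
  valid.\<close>

lemma density_integral_add:
  assumes U: "openin X U" and \<mu>: "compact_density U K \<mu>" and \<nu>: "compact_density U L \<nu>"
  shows "density_integral X \<O> (\<lambda>c a. \<mu> c a + \<nu> c a) = density_integral X \<O> \<mu> + density_integral X \<O> \<nu>"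
proof -
  let ?K = "K \<union> L"
  have K: "compactin X ?K" using \<mu> \<nu> by (auto simp: compact_density_def intro: compactin_Un)
  have a: "\<mu> c a \<noteq> 0 \<Longrightarrow> a \<in> ?K" "\<nu> c a \<noteq> 0 \<Longrightarrow> a \<in> ?K" for c a
    using \<mu> \<nu> by (auto simp: compact_density_def)
  have a3: "a \<in> ?K" if "\<mu> c a + \<nu> c a \<noteq> 0" for c a
    using a[of c a] that by (cases "\<mu> c a = 0") auto
  have "chart_integral c (\<lambda>a. pou c a * (\<mu> c a + \<nu> c a)) =
    chart_integral c (\<lambda>a. pou c a * \<mu> c a) + chart_integral c (\<lambda>a. pou c a * \<nu> c a)" if c: "c \<in> charts X \<O>" for c
    unfolding chart_integral_def
      Bochner_Integration.integral_add[OF integrable_compact_density[OF U \<mu> c] integrable_compact_density[OF U \<nu> c], symmetric]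
    by (rule Bochner_Integration.integral_cong) (auto simp: distrib_left)
  note lin = this
  let ?C = "{c \<in> charts X \<O>. \<exists>a\<in>?K. pou c a \<noteq> 0}"
  have "density_integral X \<O> \<mu> = (\<Sum>c\<in>?C. chart_integral c (\<lambda>a. pou c a * \<mu> c a))"
    by (rule density_integral_eq[OF K]) (rule a(1))
  moreover have "density_integral X \<O> \<nu> = (\<Sum>c\<in>?C. chart_integral c (\<lambda>a. pou c a * \<nu> c a))"
    by (rule density_integral_eq[OF K]) (rule a(2))
  moreover have "density_integral X \<O> (\<lambda>c a. \<mu> c a + \<nu> c a) =
      (\<Sum>c\<in>?C. chart_integral c (\<lambda>a. pou c a * (\<mu> c a + \<nu> c a)))"
    by (rule density_integral_eq[OF K]) (rule a3)
  ultimately show ?thesis using lin by (simp add: sum.distrib)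
qed

lemma density_integral_scale:
  assumes U: "openin X U" and \<mu>: "compact_density U K \<mu>"
  shows "density_integral X \<O> (\<lambda>c a. z * \<mu> c a) = z * density_integral X \<O> \<mu>"
proof -
  have K: "compactin X K" "\<And>c a. \<mu> c a \<noteq> 0 \<Longrightarrow> a \<in> K" "\<And>c a. z * \<mu> c a \<noteq> 0 \<Longrightarrow> a \<in> K"
    using \<mu> by (auto simp: compact_density_def)
  have "chart_integral c (\<lambda>a. pou c a * (z * \<mu> c a)) = z * chart_integral c (\<lambda>a. pou c a * \<mu> c a)" for c
    unfolding chart_integral_def integral_mult_right_zero[symmetric]
    by (rule Bochner_Integration.integral_cong) auto
  note lin = this
  let ?C = "{c \<in> charts X \<O>. \<exists>a\<in>K. pou c a \<noteq> 0}"
  have "density_integral X \<O> \<mu> = (\<Sum>c\<in>?C. chart_integral c (\<lambda>a. pou c a * \<mu> c a))"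
    by (rule density_integral_eq[OF K(1)]) (rule K(2))
  moreover have "density_integral X \<O> (\<lambda>c a. z * \<mu> c a) =
      (\<Sum>c\<in>?C. chart_integral c (\<lambda>a. pou c a * (z * \<mu> c a)))"
    by (rule density_integral_eq[OF K(1)]) (rule K(3))
  ultimately show ?thesis using lin by (simp add: sum_distrib_left)
qed

lemma density_integral_zero: "density_integral X \<O> (\<lambda>c a. 0) = 0"
  by (simp add: density_integral_def Let_def)


section \<open>Commutators of density-valued operators\<close>

lemma densities_onD:
  assumes "\<mu> \<in> densities_on X \<O> U"
  shows "c \<notin> charts X \<O> \<or> a \<notin> U \<inter> chart_dom c \<Longrightarrow> \<mu> c a = 0" "a \<notin> U \<Longrightarrow> \<mu> c a = 0"
    "c \<in> charts X \<O> \<Longrightarrow> \<mu> c \<in> reduced_sections X \<O> (U \<inter> chart_dom c)"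
    "c \<in> charts X \<O> \<Longrightarrow> d \<in> charts X \<O> \<Longrightarrow> a \<in> U \<inter> chart_dom c \<inter> chart_dom d \<Longrightarrow>
       \<mu> c a = complex_of_real \<bar>jacobian c d a\<bar> * \<mu> d a"
  using assms unfolding densities_on_def by blast+

lemma densities_on_zero: "openin X U \<Longrightarrow> (\<lambda>c a. 0) \<in> densities_on X \<O> U"
  unfolding densities_on_def using reduced_sections_zero chartD(1) by (auto simp: openin_Int)

lemma densities_on_add:
  assumes U: "openin X U" and m: "\<mu> \<in> densities_on X \<O> U" "\<nu> \<in> densities_on X \<O> U"
  shows "(\<lambda>c a. \<mu> c a + \<nu> c a) \<in> densities_on X \<O> U"
  unfolding densities_on_def
proof (intro CollectI conjI ballI allI impI)
  show "\<mu> c a + \<nu> c a = 0" if "c \<notin> charts X \<O> \<or> a \<notin> U \<inter> chart_dom c" for c a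
    using densities_onD(1)[OF m(1) that] densities_onD(1)[OF m(2) that] by simp
  show "(\<lambda>a. \<mu> c a + \<nu> c a) \<in> reduced_sections X \<O> (U \<inter> chart_dom c)" if "c \<in> charts X \<O>" for c
    by (rule reduced_sections_add[OF openin_Int[OF U chartD(1)[OF that]] densities_onD(3)[OF m(1) that] densities_onD(3)[OF m(2) that]])
  show "\<mu> c a + \<nu> c a = complex_of_real \<bar>jacobian c d a\<bar> * (\<mu> d a + \<nu> d a)"
    if "c \<in> charts X \<O>" "d \<in> charts X \<O>" "a \<in> U \<inter> chart_dom c \<inter> chart_dom d" for c d a
    unfolding densities_onD(4)[OF m(1) that] densities_onD(4)[OF m(2) that] by (simp add: distrib_left)
qed

lemma densities_on_fun_mult:
  assumes U: "openin X U" and m: "\<mu> \<in> densities_on X \<O> U" and g: "g \<in> reduced_sections X \<O> U"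
  shows "(\<lambda>c a. g a * \<mu> c a) \<in> densities_on X \<O> U"
  unfolding densities_on_def
proof (intro CollectI conjI ballI allI impI)
  show "g a * \<mu> c a = 0" if "c \<notin> charts X \<O> \<or> a \<notin> U \<inter> chart_dom c" for c a
    using densities_onD(1)[OF m that] by simp
  show "(\<lambda>a. g a * \<mu> c a) \<in> reduced_sections X \<O> (U \<inter> chart_dom c)" if c: "c \<in> charts X \<O>" for c
  proof -
    have o: "openin X (U \<inter> chart_dom c)" using U chartD(1)[OF c] by blast
    from reduced_sections_mult[OF o reduced_sections_restrict[OF g o Int_lower1] densities_onD(3)[OF m c]]
    have "(\<lambda>a. (if a \<in> U \<inter> chart_dom c then g a else 0) * \<mu> c a) \<in> reduced_sections X \<O> (U \<inter> chart_dom c)" .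
    moreover have "(\<lambda>a. (if a \<in> U \<inter> chart_dom c then g a else 0) * \<mu> c a) = (\<lambda>a. g a * \<mu> c a)"
      using densities_onD(1)[OF m] by (intro ext) auto
    ultimately show ?thesis by simp
  qed
  show "g a * \<mu> c a = complex_of_real \<bar>jacobian c d a\<bar> * (g a * \<mu> d a)"
    if "c \<in> charts X \<O>" "d \<in> charts X \<O>" "a \<in> U \<inter> chart_dom c \<inter> chart_dom d" for c d a
    unfolding densities_onD(4)[OF m that] by simp
qed

text \<open>The constant has to be presented as a reduced section over \<open>U\<close>. It is
  obtained as z times the residue of the unit, extended by zero.\<close>

lemma densities_on_scale:
  assumes U: "openin X U" and m: "\<mu> \<in> densities_on X \<O> U"
  shows "(\<lambda>c a. z * \<mu> c a) \<in> densities_on X \<O> U"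
proof -
  have "(\<lambda>a. z * (if a \<in> U then eval_at X \<O> U \<one>\<^bsub>sections \<O> U\<^esub> a else 0)) \<in> reduced_sections X \<O> U"
    by (rule reduced_sections_scale[OF U reduced_sections_eval[OF U one_O_closed[OF U]]])
  from densities_on_fun_mult[OF U m this]
  have "(\<lambda>c a. z * (if a \<in> U then eval_at X \<O> U \<one>\<^bsub>sections \<O> U\<^esub> a else 0) * \<mu> c a) \<in> densities_on X \<O> U" .
  moreover have "(\<lambda>c a. z * (if a \<in> U then eval_at X \<O> U \<one>\<^bsub>sections \<O> U\<^esub> a else 0) * \<mu> c a) = (\<lambda>c a. z * \<mu> c a)"
    using densities_onD(2)[OF m] eval_at_one[OF U] by (intro ext) simp
  ultimately show ?thesis by simp
qed

text \<open>The set U is covered by \<open>V\<close> and the complement of the closed set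
  \<open>K\<close>. The density is given on the first and zero on the second, and the defining
  conditions are local.\<close>

lemma densities_on_extend:
  assumes m: "\<mu> \<in> densities_on X \<O> V" and V: "openin X V" "V \<subseteq> U" and U: "openin X U"
    and K: "closedin X K" "U \<inter> K \<subseteq> V" "\<And>c a. \<mu> c a \<noteq> 0 \<Longrightarrow> a \<in> K"
  shows "\<mu> \<in> densities_on X \<O> U"
  unfolding densities_on_def
proof (intro CollectI conjI ballI allI impI)
  show "\<mu> c a = 0" if "c \<notin> charts X \<O> \<or> a \<notin> U \<inter> chart_dom c" for c a
    using densities_onD(1)[OF m, of c a] that V by auto
  show "\<mu> c \<in> reduced_sections X \<O> (U \<inter> chart_dom c)" if c: "c \<in> charts X \<O>" for c
  proof (rule reduced_sections_local)
    show "\<mu> c a = 0" if "a \<notin> U \<inter> chart_dom c" for a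
      using densities_onD(1)[OF m, of c a] that V by auto
    fix a assume a: "a \<in> U \<inter> chart_dom c"
    show "\<exists>W h. openin X W \<and> a \<in> W \<and> W \<subseteq> U \<inter> chart_dom c \<and> h \<in> reduced_sections X \<O> W \<and> (\<forall>b\<in>W. \<mu> c b = h b)"
    proof (cases "a \<in> V")
      case True
      then show ?thesis using a V chartD(1)[OF c] densities_onD(3)[OF m c]
        by (intro exI[of _ "V \<inter> chart_dom c"] exI[of _ "\<mu> c"]) auto
    next
      case False
      have o: "openin X ((U - K) \<inter> chart_dom c)" using K(1) U chartD(1)[OF c] by blast
      then show ?thesis using a False K reduced_sections_zero[OF o]
        by (intro exI[of _ "(U - K) \<inter> chart_dom c"] exI[of _ "\<lambda>_. 0"]) auto
    qed
  qed
  show "\<mu> c a = complex_of_real \<bar>jacobian c d a\<bar> * \<mu> d a"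
    if "c \<in> charts X \<O>" "d \<in> charts X \<O>" "a \<in> U \<inter> chart_dom c \<inter> chart_dom d" for c d a
  proof (cases "a \<in> V")
    case True
    then show ?thesis using densities_onD(4)[OF m that(1,2), of a] that by auto
  next
    case False
    then show ?thesis using densities_onD(2)[OF m False] by simp
  qed
qed

lemma densities_simps:
  "carrier (sections (densities X \<O>) U) = densities_on X \<O> U"
  "\<zero>\<^bsub>sections (densities X \<O>) U\<^esub> = (\<lambda>c a. 0)"
  "\<mu> \<oplus>\<^bsub>sections (densities X \<O>) U\<^esub> \<nu> = (\<lambda>c a. \<mu> c a + \<nu> c a)"
  "f \<odot>\<^bsub>sections (densities X \<O>) U\<^esub> \<mu> = (\<lambda>c a. if a \<in> U then eval_at X \<O> U f a * \<mu> c a else 0)"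
  "restr (densities X \<O>) U V \<mu> = (\<lambda>c a. if a \<in> V then \<mu> c a else 0)"
  by (simp_all add: densities_def)

lemma densities_smult_closed:
  assumes U: "openin X U" and m: "\<mu> \<in> densities_on X \<O> U" and f: "f \<in> carrier (sections \<O> U)"
  shows "(\<lambda>c a. if a \<in> U then eval_at X \<O> U f a * \<mu> c a else 0) \<in> densities_on X \<O> U"
proof -
  have "(\<lambda>c a. (if a \<in> U then eval_at X \<O> U f a else 0) * \<mu> c a) \<in> densities_on X \<O> U"
    by (rule densities_on_fun_mult[OF U m reduced_sections_eval[OF U f]])
  then show ?thesis by (simp add: if_distrib[of "\<lambda>x. x * _"] cong: if_cong)
qed

text \<open>Subtraction in a record is defined through an abstract additive inverse. Only once the
  densities are known to form an abelian group is it the pointwise difference; commutators are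
  expressed by it.\<close>

lemma densities_minus:
  assumes U: "openin X U" and m: "\<mu> \<in> densities_on X \<O> U" "\<nu> \<in> densities_on X \<O> U"
  shows "\<mu> \<ominus>\<^bsub>sections (densities X \<O>) U\<^esub> \<nu> = (\<lambda>c a. \<mu> c a - \<nu> c a)"
proof -
  have neg: "(\<lambda>c a. (-1) * x c a) \<in> densities_on X \<O> U" if "x \<in> densities_on X \<O> U" for x
    by (rule densities_on_scale[OF U that])
  interpret abelian_group "sections (densities X \<O>) U"
  proof (rule abelian_groupI)
    fix x assume x: "x \<in> carrier (sections (densities X \<O>) U)"
    show "\<exists>y\<in>carrier (sections (densities X \<O>) U). y \<oplus>\<^bsub>sections (densities X \<O>) U\<^esub> x = \<zero>\<^bsub>sections (densities X \<O>) U\<^esub>"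
      using neg[of x] x by (intro bexI[of _ "\<lambda>c a. (-1) * x c a"]) (auto simp: densities_simps)
  qed (auto simp: densities_simps densities_on_zero[OF U] ac_simps intro: densities_on_add[OF U])
  have "\<ominus>\<^bsub>sections (densities X \<O>) U\<^esub> \<nu> = (\<lambda>c a. (-1) * \<nu> c a)"
    by (rule minus_equality) (use m neg in \<open>auto simp: densities_simps\<close>)
  then show ?thesis by (simp add: a_minus_def densities_simps)
qed

end

section \<open>Modules and iterated commutators\<close>

locale formal_module = formal_mfd X \<O> for X :: "'m topology" and \<O> :: "('m, complex, 'o) presheaf" +
  fixes \<F> :: "('m, 'o, 'f) presheaf"
  assumes sheaf_of_modules: "sheaf_of_modules X \<O> \<F>"
begin

abbreviation F_carrier :: "'m set \<Rightarrow> 'f set" where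
  "F_carrier U \<equiv> carrier (sections \<F> U)"

lemma sheaf_F: "sheaf_on X \<F>"
  using sheaf_of_modules by (simp add: sheaf_of_modules_def)

lemma module_F: "openin X U \<Longrightarrow> Module.module (sections \<O> U) (sections \<F> U)"
  using sheaf_of_modules by (simp add: sheaf_of_modules_def)

lemma restr_F_closed:
  assumes "openin X U" "openin X V" "V \<subseteq> U" "u \<in> F_carrier U"
  shows "restr \<F> U V u \<in> F_carrier V"
proof -
  have "restr \<F> U V \<in> F_carrier U \<rightarrow> F_carrier V"
    by (rule sheaf_F[unfolded sheaf_on_def presheaf_on_def, THEN conjunct1, THEN conjunct1, rule_format])
      (use assms(1-3) in simp)
  then show ?thesis using assms(4) by (rule funcset_mem)
qed

lemma restr_F_self: "openin X U \<Longrightarrow> u \<in> F_carrier U \<Longrightarrow> restr \<F> U U u = u"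
  using sheaf_F unfolding sheaf_on_def presheaf_on_def by blast

lemma restr_F_restr:
  "openin X U \<Longrightarrow> openin X V \<Longrightarrow> openin X W \<Longrightarrow> W \<subseteq> V \<Longrightarrow> V \<subseteq> U \<Longrightarrow> u \<in> F_carrier U \<Longrightarrow>
   restr \<F> V W (restr \<F> U V u) = restr \<F> U W u"
  using sheaf_F unfolding sheaf_on_def presheaf_on_def by blast

lemma restr_F_add:
  "openin X U \<Longrightarrow> openin X V \<Longrightarrow> V \<subseteq> U \<Longrightarrow> u \<in> F_carrier U \<Longrightarrow> v \<in> F_carrier U \<Longrightarrow>
   restr \<F> U V (u \<oplus>\<^bsub>sections \<F> U\<^esub> v) = restr \<F> U V u \<oplus>\<^bsub>sections \<F> V\<^esub> restr \<F> U V v"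
  using sheaf_of_modules unfolding sheaf_of_modules_def by blast

lemma restr_F_smult:
  "openin X U \<Longrightarrow> openin X V \<Longrightarrow> V \<subseteq> U \<Longrightarrow> f \<in> carrier (sections \<O> U) \<Longrightarrow> u \<in> F_carrier U \<Longrightarrow>
   restr \<F> U V (f \<odot>\<^bsub>sections \<F> U\<^esub> u) = restr \<O> U V f \<odot>\<^bsub>sections \<F> V\<^esub> restr \<F> U V u"
  by (rule sheaf_of_modules[unfolded sheaf_of_modules_def, THEN conjunct2, THEN conjunct2, THEN spec, THEN spec,
        THEN mp, THEN conjunct2, rule_format]) auto

lemma smult_F_closed:
  "openin X U \<Longrightarrow> f \<in> carrier (sections \<O> U) \<Longrightarrow> u \<in> F_carrier U \<Longrightarrow> f \<odot>\<^bsub>sections \<F> U\<^esub> u \<in> F_carrier U"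
  by (rule module.smult_closed[OF module_F])

lemma abelian_group_F: "openin X U \<Longrightarrow> abelian_group (sections \<F> U)"
  by (rule module.axioms(2)[OF module_F])

lemma zero_F_closed: "openin X U \<Longrightarrow> \<zero>\<^bsub>sections \<F> U\<^esub> \<in> F_carrier U"
  by (rule abelian_monoid.zero_closed[OF abelian_group.axioms(1)[OF abelian_group_F]])

lemma smult_F_commute:
  assumes "openin X U" "f \<in> carrier (sections \<O> U)" "g \<in> carrier (sections \<O> U)" "u \<in> F_carrier U"
  shows "f \<odot>\<^bsub>sections \<F> U\<^esub> (g \<odot>\<^bsub>sections \<F> U\<^esub> u) = g \<odot>\<^bsub>sections \<F> U\<^esub> (f \<odot>\<^bsub>sections \<F> U\<^esub> u)"
proof -
  interpret module "sections \<O> U" "sections \<F> U" using module_F assms by blast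
  show ?thesis using assms by (simp flip: smult_assoc1 add: m_comm)
qed

abbreviation comm :: "'m set \<Rightarrow> ('m set \<Rightarrow> 'f \<Rightarrow> 'm chart \<Rightarrow> 'm \<Rightarrow> complex) \<Rightarrow> 'o \<Rightarrow> 'm set \<Rightarrow> 'f \<Rightarrow> 'm chart \<Rightarrow> 'm \<Rightarrow> complex" where
  "comm V \<equiv> commutator \<O> \<F> (densities X \<O>) V"

text \<open>The condition under which a commutator can be computed pointwise. It passes to
  commutators, so it covers iterated ones.\<close>

definition density_valued :: "'m set \<Rightarrow> ('m set \<Rightarrow> 'f \<Rightarrow> 'm chart \<Rightarrow> 'm \<Rightarrow> complex) \<Rightarrow> bool" where
  "density_valued V D \<longleftrightarrow> (\<forall>W u. openin X W \<and> W \<subseteq> V \<and> u \<in> F_carrier W \<longrightarrow> D W u \<in> densities_on X \<O> W)"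

lemma comm_eq:
  assumes V: "openin X V" and D: "density_valued V D" and f: "f \<in> carrier (sections \<O> V)"
    and W: "openin X W" "W \<subseteq> V" "u \<in> F_carrier W"
  shows "comm V D f W u = (\<lambda>c a. D W (restr \<O> V W f \<odot>\<^bsub>sections \<F> W\<^esub> u) c a -
    (if a \<in> W then eval_at X \<O> W (restr \<O> V W f) a * D W u c a else 0))"
    "comm V D f W u \<in> densities_on X \<O> W"
proof -
  have f': "restr \<O> V W f \<in> carrier (sections \<O> W)" using V W f by simp
  have 1: "D W (restr \<O> V W f \<odot>\<^bsub>sections \<F> W\<^esub> u) \<in> densities_on X \<O> W"
    using D W smult_F_closed[OF W(1) f' W(3)] unfolding density_valued_def by blast
  have Du: "D W u \<in> densities_on X \<O> W" using D W unfolding density_valued_def by blast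
  have 2: "(\<lambda>c a. if a \<in> W then eval_at X \<O> W (restr \<O> V W f) a * D W u c a else 0) \<in> densities_on X \<O> W"
    by (rule densities_smult_closed[OF W(1) Du f'])
  show eq: "comm V D f W u = (\<lambda>c a. D W (restr \<O> V W f \<odot>\<^bsub>sections \<F> W\<^esub> u) c a -
    (if a \<in> W then eval_at X \<O> W (restr \<O> V W f) a * D W u c a else 0))"
    unfolding commutator_def densities_simps(4) by (rule densities_minus[OF W(1) 1 2])
  have "(\<lambda>c a. D W (restr \<O> V W f \<odot>\<^bsub>sections \<F> W\<^esub> u) c a +
    (-1) * (if a \<in> W then eval_at X \<O> W (restr \<O> V W f) a * D W u c a else 0)) \<in> densities_on X \<O> W"
    by (rule densities_on_add[OF W(1) 1 densities_on_scale[OF W(1) 2]])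
  then show "comm V D f W u \<in> densities_on X \<O> W" unfolding eq by simp
qed

lemma density_valued_comm:
  assumes "openin X V" "density_valued V D" "f \<in> carrier (sections \<O> V)"
  shows "density_valued V (comm V D f)"
  unfolding density_valued_def[of V "comm V D f"] using comm_eq(2)[OF assms] by blast

text \<open>Relations between three operators, as one of them may be the sum of the others.\<close>

lemma foldl_comm_rel:
  assumes step: "\<And>D E G f. R D E G \<Longrightarrow> f \<in> carrier (sections \<O> V) \<Longrightarrow> R (comm V D f) (comm V E f) (comm V G f)"
    and "R D E G" "set fs \<subseteq> carrier (sections \<O> V)"
  shows "R (foldl (comm V) D fs) (foldl (comm V) E fs) (foldl (comm V) G fs)"
  using assms(2,3) by (induction fs arbitrary: D E G) (auto intro: step)

text \<open>The commutator is additive in its operator. The relation carried through the list also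
  records that all operators have densities as values, as only then is subtraction
  pointwise.\<close>

lemma foldl_comm_add:
  assumes V: "openin X V" and D: "density_valued V D" "density_valued V E" and fs: "set fs \<subseteq> carrier (sections \<O> V)"
    and W: "openin X W" "W \<subseteq> V" "u \<in> F_carrier W"
  shows "foldl (comm V) (\<lambda>V u c a. D V u c a + E V u c a) fs W u =
    (\<lambda>c a. foldl (comm V) D fs W u c a + foldl (comm V) E fs W u c a)"
proof -
  define R where "R D E G \<longleftrightarrow> density_valued V D \<and> density_valued V E \<and> density_valued V G \<and>
    (\<forall>W u. openin X W \<and> W \<subseteq> V \<and> u \<in> F_carrier W \<longrightarrow> G W u = (\<lambda>c a. D W u c a + E W u c a))" for D E G
  have "R (foldl (comm V) D fs) (foldl (comm V) E fs) (foldl (comm V) (\<lambda>V u c a. D V u c a + E V u c a) fs)"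
  proof (rule foldl_comm_rel[OF _ _ fs])
    show "R D E (\<lambda>V u c a. D V u c a + E V u c a)"
      using D unfolding R_def density_valued_def by (auto intro: densities_on_add)
    fix D E G f assume R: "R D E G" and f: "f \<in> carrier (sections \<O> V)"
    show "R (comm V D f) (comm V E f) (comm V G f)"
      unfolding R_def
    proof (intro conjI allI impI)
      fix W u assume "openin X W \<and> W \<subseteq> V \<and> u \<in> F_carrier W"
      then have W: "openin X W" "W \<subseteq> V" "u \<in> F_carrier W" by auto
      have fu: "restr \<O> V W f \<odot>\<^bsub>sections \<F> W\<^esub> u \<in> F_carrier W"
        using smult_F_closed[OF W(1) _ W(3)] V W f by simp
      show "comm V G f W u = (\<lambda>c a. comm V D f W u c a + comm V E f W u c a)"
        using R W fu unfolding R_def by (simp add: comm_eq(1)[OF V _ f W] fun_eq_iff algebra_simps)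
    qed (use R f V density_valued_comm in \<open>auto simp: R_def\<close>)
  qed
  then show ?thesis using W unfolding R_def by blast
qed

text \<open>The two operators are compared on open subsets of \<open>V\<close> only. For z = 1 this
  replaces an operator by one that agrees with it on \<open>V\<close>, and for z = 0 it treats the
  zero operator. The third argument of \<open>R\<close> is a dummy.\<close>

lemma foldl_comm_scale:
  assumes V: "openin X V" and D: "density_valued V D" and fs: "set fs \<subseteq> carrier (sections \<O> V)"
    and E: "\<And>W u. openin X W \<Longrightarrow> W \<subseteq> V \<Longrightarrow> u \<in> F_carrier W \<Longrightarrow> E W u = (\<lambda>c a. z * D W u c a)"
    and W: "openin X W" "W \<subseteq> V" "u \<in> F_carrier W"
  shows "foldl (comm V) E fs W u = (\<lambda>c a. z * foldl (comm V) D fs W u c a)"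
proof -
  define R where "R D E G \<longleftrightarrow> density_valued V D \<and> density_valued V E \<and>
    (\<forall>W u. openin X W \<and> W \<subseteq> V \<and> u \<in> F_carrier W \<longrightarrow> E W u = (\<lambda>c a. z * D W u c a))"
    for D E and G :: "'m set \<Rightarrow> 'f \<Rightarrow> 'm chart \<Rightarrow> 'm \<Rightarrow> complex"
  have "R (foldl (comm V) D fs) (foldl (comm V) E fs) (foldl (comm V) E fs)"
  proof (rule foldl_comm_rel[OF _ _ fs])
    show "R D E E"
      using D E unfolding R_def density_valued_def by (auto intro: densities_on_scale)
    fix D E G f assume R: "R D E G" and f: "f \<in> carrier (sections \<O> V)"
    show "R (comm V D f) (comm V E f) (comm V G f)"
      unfolding R_def
    proof (intro conjI allI impI)
      fix W u assume "openin X W \<and> W \<subseteq> V \<and> u \<in> F_carrier W"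
      then have W: "openin X W" "W \<subseteq> V" "u \<in> F_carrier W" by auto
      have fu: "restr \<O> V W f \<odot>\<^bsub>sections \<F> W\<^esub> u \<in> F_carrier W"
        using smult_F_closed[OF W(1) _ W(3)] V W f by simp
      show "comm V E f W u = (\<lambda>c a. z * comm V D f W u c a)"
        using R W fu unfolding R_def by (simp add: comm_eq(1)[OF V _ f W] fun_eq_iff algebra_simps)
    qed (use R f V density_valued_comm in \<open>auto simp: R_def\<close>)
  qed
  then show ?thesis using W unfolding R_def by blast
qed

lemma foldl_comm_zero:
  assumes V: "openin X V" and fs: "set fs \<subseteq> carrier (sections \<O> V)"
    and E: "\<And>W u. openin X W \<Longrightarrow> W \<subseteq> V \<Longrightarrow> u \<in> F_carrier W \<Longrightarrow> E W u = (\<lambda>c a. 0)"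
    and W: "openin X W" "W \<subseteq> V" "u \<in> F_carrier W"
  shows "foldl (comm V) E fs W u = (\<lambda>c a. 0)"
proof -
  have "density_valued V E" unfolding density_valued_def using E by (auto intro: densities_on_zero)
  from foldl_comm_scale[OF V this fs, of E 0, OF _ W] show ?thesis using E by simp
qed

text \<open>As \<O> is commutative, [D g, f] = [D, f] g. So precomposition with multiplication by
  \<open>g\<close> passes through iterated commutators and does not raise the order.\<close>

lemma foldl_comm_compose:
  assumes V: "openin X V" and D: "density_valued V D" and fs: "set fs \<subseteq> carrier (sections \<O> V)"
    and g: "g \<in> carrier (sections \<O> V)"
    and E: "\<And>W u. openin X W \<Longrightarrow> W \<subseteq> V \<Longrightarrow> u \<in> F_carrier W \<Longrightarrow> E W u = D W (restr \<O> V W g \<odot>\<^bsub>sections \<F> W\<^esub> u)"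
    and W: "openin X W" "W \<subseteq> V" "u \<in> F_carrier W"
  shows "foldl (comm V) E fs W u = foldl (comm V) D fs W (restr \<O> V W g \<odot>\<^bsub>sections \<F> W\<^esub> u)"
proof -
  have mult: "restr \<O> V W h \<odot>\<^bsub>sections \<F> W\<^esub> u \<in> F_carrier W"
    if "openin X W" "W \<subseteq> V" "u \<in> F_carrier W" "h \<in> carrier (sections \<O> V)" for W u h
    using smult_F_closed[OF that(1) _ that(3)] V that by simp
  define R where "R D E G \<longleftrightarrow> density_valued V D \<and> density_valued V E \<and>
    (\<forall>W u. openin X W \<and> W \<subseteq> V \<and> u \<in> F_carrier W \<longrightarrow> E W u = D W (restr \<O> V W g \<odot>\<^bsub>sections \<F> W\<^esub> u))"
    for D E and G :: "'m set \<Rightarrow> 'f \<Rightarrow> 'm chart \<Rightarrow> 'm \<Rightarrow> complex"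
  have "R (foldl (comm V) D fs) (foldl (comm V) E fs) (foldl (comm V) E fs)"
  proof (rule foldl_comm_rel[OF _ _ fs])
    show "R D E E"
      using D E mult[OF _ _ _ g] unfolding R_def density_valued_def by simp
    fix D E G f assume R: "R D E G" and f: "f \<in> carrier (sections \<O> V)"
    show "R (comm V D f) (comm V E f) (comm V G f)"
      unfolding R_def
    proof (intro conjI allI impI)
      fix W u assume "openin X W \<and> W \<subseteq> V \<and> u \<in> F_carrier W"
      then have W: "openin X W" "W \<subseteq> V" "u \<in> F_carrier W" by auto
      have "restr \<O> V W f \<in> carrier (sections \<O> W)" "restr \<O> V W g \<in> carrier (sections \<O> W)"
        using V W f g by auto
      note comm = smult_F_commute[OF W(1) this W(3)]
      show "comm V E f W u = comm V D f W (restr \<O> V W g \<odot>\<^bsub>sections \<F> W\<^esub> u)"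
        using R W mult[OF W f] mult[OF W g] unfolding R_def
        by (simp add: comm_eq(1)[OF V _ f W] comm_eq(1)[OF V _ f W(1,2) mult[OF W g]] comm fun_eq_iff)
    qed (use R f V density_valued_comm in \<open>auto simp: R_def\<close>)
  qed
  then show ?thesis using W unfolding R_def by blast
qed


section \<open>Compactly supported differential operators\<close>

text \<open>\<open>order_at_most\<close> and \<open>sheaf_hom\<close> are phrased with subtopologies
  and with the operations of the density module. \<open>order_on\<close> and \<open>hom_on\<close>
  are their pointwise forms over open sets of \<open>X\<close>, in which scalars act by plain
  multiplication.\<close>

definition order_on :: "'m set \<Rightarrow> nat \<Rightarrow> ('m set \<Rightarrow> 'f \<Rightarrow> 'm chart \<Rightarrow> 'm \<Rightarrow> complex) \<Rightarrow> bool" where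
  "order_on W r D \<longleftrightarrow> (\<forall>V fs V' u. openin X V \<and> V \<subseteq> W \<and> length fs = Suc r \<and> set fs \<subseteq> carrier (sections \<O> V) \<and>
     openin X V' \<and> V' \<subseteq> V \<and> u \<in> F_carrier V' \<longrightarrow> foldl (comm V) D fs V' u = (\<lambda>c a. 0))"

definition hom_on :: "'m set \<Rightarrow> ('m set \<Rightarrow> 'f \<Rightarrow> 'm chart \<Rightarrow> 'm \<Rightarrow> complex) \<Rightarrow> bool" where
  "hom_on U D \<longleftrightarrow> density_valued U D \<and>
     (\<forall>V u v. openin X V \<and> V \<subseteq> U \<and> u \<in> F_carrier V \<and> v \<in> F_carrier V \<longrightarrow>
        D V (u \<oplus>\<^bsub>sections \<F> V\<^esub> v) = (\<lambda>c a. D V u c a + D V v c a)) \<and>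
     (\<forall>V u z. openin X V \<and> V \<subseteq> U \<and> u \<in> F_carrier V \<longrightarrow>
        D V ((z \<odot>\<^bsub>sections \<O> V\<^esub> \<one>\<^bsub>sections \<O> V\<^esub>) \<odot>\<^bsub>sections \<F> V\<^esub> u) = (\<lambda>c a. z * D V u c a)) \<and>
     (\<forall>V W u. openin X V \<and> openin X W \<and> W \<subseteq> V \<and> V \<subseteq> U \<and> u \<in> F_carrier V \<longrightarrow>
        D W (restr \<F> V W u) = (\<lambda>c a. if a \<in> W then D V u c a else 0))"

lemma hom_onI:
  assumes "\<And>V u. openin X V \<Longrightarrow> V \<subseteq> U \<Longrightarrow> u \<in> F_carrier V \<Longrightarrow> D V u \<in> densities_on X \<O> V"
    and "\<And>V u v. openin X V \<Longrightarrow> V \<subseteq> U \<Longrightarrow> u \<in> F_carrier V \<Longrightarrow> v \<in> F_carrier V \<Longrightarrow>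
        D V (u \<oplus>\<^bsub>sections \<F> V\<^esub> v) = (\<lambda>c a. D V u c a + D V v c a)"
    and "\<And>V u z. openin X V \<Longrightarrow> V \<subseteq> U \<Longrightarrow> u \<in> F_carrier V \<Longrightarrow>
        D V ((z \<odot>\<^bsub>sections \<O> V\<^esub> \<one>\<^bsub>sections \<O> V\<^esub>) \<odot>\<^bsub>sections \<F> V\<^esub> u) = (\<lambda>c a. z * D V u c a)"
    and "\<And>V W u. openin X V \<Longrightarrow> openin X W \<Longrightarrow> W \<subseteq> V \<Longrightarrow> V \<subseteq> U \<Longrightarrow> u \<in> F_carrier V \<Longrightarrow>
        D W (restr \<F> V W u) = (\<lambda>c a. if a \<in> W then D V u c a else 0)"
  shows "hom_on U D"
  using assms unfolding hom_on_def density_valued_def by simp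

lemma hom_onD:
  assumes "hom_on U D"
  shows "\<And>V u. openin X V \<Longrightarrow> V \<subseteq> U \<Longrightarrow> u \<in> F_carrier V \<Longrightarrow> D V u \<in> densities_on X \<O> V"
    and "\<And>V u v. openin X V \<Longrightarrow> V \<subseteq> U \<Longrightarrow> u \<in> F_carrier V \<Longrightarrow> v \<in> F_carrier V \<Longrightarrow>
        D V (u \<oplus>\<^bsub>sections \<F> V\<^esub> v) = (\<lambda>c a. D V u c a + D V v c a)"
    and "\<And>V u z. openin X V \<Longrightarrow> V \<subseteq> U \<Longrightarrow> u \<in> F_carrier V \<Longrightarrow>
        D V ((z \<odot>\<^bsub>sections \<O> V\<^esub> \<one>\<^bsub>sections \<O> V\<^esub>) \<odot>\<^bsub>sections \<F> V\<^esub> u) = (\<lambda>c a. z * D V u c a)"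
    and "\<And>V W u. openin X V \<Longrightarrow> openin X W \<Longrightarrow> W \<subseteq> V \<Longrightarrow> V \<subseteq> U \<Longrightarrow> u \<in> F_carrier V \<Longrightarrow>
        D W (restr \<F> V W u) = (\<lambda>c a. if a \<in> W then D V u c a else 0)"
  using assms unfolding hom_on_def density_valued_def by simp_all

lemma density_valued_subset: "density_valued U D \<Longrightarrow> V \<subseteq> U \<Longrightarrow> density_valued V D"
  unfolding density_valued_def by (meson subset_trans)

lemma hom_on_subset: "hom_on U D \<Longrightarrow> V \<subseteq> U \<Longrightarrow> hom_on V D"
  by (rule hom_onI) (simp_all add: hom_onD subset_trans)

lemma hom_on_density_valued: "hom_on U D \<Longrightarrow> V \<subseteq> U \<Longrightarrow> density_valued V D"
  by (rule density_valued_subset) (simp_all add: hom_on_def)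

lemma scalar_smult_density:
  assumes V: "openin X V" and m: "\<mu> \<in> densities_on X \<O> V"
  shows "(z \<odot>\<^bsub>sections \<O> V\<^esub> \<one>\<^bsub>sections \<O> V\<^esub>) \<odot>\<^bsub>sections (densities X \<O>) V\<^esub> \<mu> = (\<lambda>c a. z * \<mu> c a)"
proof -
  have "eval_at X \<O> V (z \<odot>\<^bsub>sections \<O> V\<^esub> \<one>\<^bsub>sections \<O> V\<^esub>) a = z" if "a \<in> V" for a
    using eval_at_smult[OF V that one_O_closed[OF V]] eval_at_one[OF V that] by simp
  then show ?thesis using densities_onD(2)[OF m] by (auto simp: densities_simps fun_eq_iff)
qed

lemma sheaf_hom_iff:
  assumes U: "openin X U"
  shows "sheaf_hom (subtopology X U) \<O> \<F> (densities X \<O>) D \<longleftrightarrow> hom_on U D"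
proof
  assume D: "sheaf_hom (subtopology X U) \<O> \<F> (densities X \<O>) D"
  show "hom_on U D"
  proof (rule hom_onI)
    fix V assume V: "openin X V" "V \<subseteq> U"
    then have oV: "openin (subtopology X U) V" using U by (simp add: openin_open_subtopology)
    note D1 = D[unfolded sheaf_hom_def, THEN conjunct1, THEN spec, THEN mp, OF oV]
    show val: "D V u \<in> densities_on X \<O> V" if "u \<in> F_carrier V" for u
      using D1[THEN conjunct1] that by (auto simp: densities_simps)
    show "D V (u \<oplus>\<^bsub>sections \<F> V\<^esub> v) = (\<lambda>c a. D V u c a + D V v c a)" if "u \<in> F_carrier V" "v \<in> F_carrier V" for u v
      using D1[THEN conjunct2, THEN conjunct1] that by (simp add: densities_simps(3))
    show "D V ((z \<odot>\<^bsub>sections \<O> V\<^esub> \<one>\<^bsub>sections \<O> V\<^esub>) \<odot>\<^bsub>sections \<F> V\<^esub> u) = (\<lambda>c a. z * D V u c a)"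
      if "u \<in> F_carrier V" for u z
      using D1[THEN conjunct2, THEN conjunct2] that scalar_smult_density[OF V(1) val[OF that], of z] by simp
  next
    fix V W u assume V: "openin X V" "openin X W" "W \<subseteq> V" "V \<subseteq> U" and u: "u \<in> F_carrier V"
    then have "openin (subtopology X U) V \<and> openin (subtopology X U) W \<and> W \<subseteq> V" using U by (auto simp: openin_open_subtopology)
    from D[unfolded sheaf_hom_def, THEN conjunct2, THEN spec, THEN spec, THEN mp, OF this] u
    show "D W (restr \<F> V W u) = (\<lambda>c a. if a \<in> W then D V u c a else 0)" by (simp add: densities_simps)
  qed
next
  assume D: "hom_on U D"
  show "sheaf_hom (subtopology X U) \<O> \<F> (densities X \<O>) D"
    unfolding sheaf_hom_def
  proof (intro conjI allI impI ballI)
    fix V assume "openin (subtopology X U) V"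
    then have V: "openin X V" "V \<subseteq> U" using U by (auto simp: openin_open_subtopology)
    show "D V \<in> F_carrier V \<rightarrow> carrier (sections (densities X \<O>) V)"
      using hom_onD(1)[OF D V] by (auto simp: densities_simps)
    show "D V (u \<oplus>\<^bsub>sections \<F> V\<^esub> v) = D V u \<oplus>\<^bsub>sections (densities X \<O>) V\<^esub> D V v"
      if "u \<in> F_carrier V" "v \<in> F_carrier V" for u v
      using hom_onD(2)[OF D V that] by (simp add: densities_simps)
    show "D V ((z \<odot>\<^bsub>sections \<O> V\<^esub> \<one>\<^bsub>sections \<O> V\<^esub>) \<odot>\<^bsub>sections \<F> V\<^esub> u) =
      (z \<odot>\<^bsub>sections \<O> V\<^esub> \<one>\<^bsub>sections \<O> V\<^esub>) \<odot>\<^bsub>sections (densities X \<O>) V\<^esub> D V u" if "u \<in> F_carrier V" for z u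
      using hom_onD(3)[OF D V that] scalar_smult_density[OF V(1) hom_onD(1)[OF D V that]] by simp
  next
    fix V W u assume "openin (subtopology X U) V \<and> openin (subtopology X U) W \<and> W \<subseteq> V" and u: "u \<in> F_carrier V"
    then have V: "openin X V" "openin X W" "W \<subseteq> V" "V \<subseteq> U" using U by (auto simp: openin_open_subtopology)
    show "D W (restr \<F> V W u) = restr (densities X \<O>) V W (D V u)"
      using hom_onD(4)[OF D V u] by (simp add: densities_simps)
  qed
qed

lemma order_at_most_iff:
  assumes W: "openin X W"
  shows "order_at_most (subtopology X W) \<O> \<F> (densities X \<O>) r D \<longleftrightarrow> order_on W r D"
  unfolding order_at_most_def order_on_def zero_on_def densities_simps openin_open_subtopology[OF W]
  by (meson subset_trans)

text \<open>\<open>K\<close> is any compact set that contains the support, so that it need not be adjusted to every operation.\<close>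

definition diff_op :: "'m set \<Rightarrow> 'm set \<Rightarrow> ('m set \<Rightarrow> 'f \<Rightarrow> 'm chart \<Rightarrow> 'm \<Rightarrow> complex) \<Rightarrow> bool" where
  "diff_op U K D \<longleftrightarrow> hom_on U D \<and>
     (\<forall>a\<in>U. \<exists>W r. openin X W \<and> a \<in> W \<and> W \<subseteq> U \<and> order_on W r D) \<and>
     compactin X K \<and> K \<subseteq> U \<and>
     (\<forall>V u c a. openin X V \<and> V \<subseteq> U \<and> u \<in> F_carrier V \<and> D V u c a \<noteq> 0 \<longrightarrow> a \<in> K)"

lemma diff_opD:
  assumes "diff_op U K D"
  shows "hom_on U D" "\<And>a. a \<in> U \<Longrightarrow> \<exists>W r. openin X W \<and> a \<in> W \<and> W \<subseteq> U \<and> order_on W r D"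
    "compactin X K" "K \<subseteq> U"
    "\<And>V u c a. openin X V \<Longrightarrow> V \<subseteq> U \<Longrightarrow> u \<in> F_carrier V \<Longrightarrow> D V u c a \<noteq> 0 \<Longrightarrow> a \<in> K"
  using assms unfolding diff_op_def by blast+

lemma diff_opI:
  assumes "hom_on U D" "\<And>a. a \<in> U \<Longrightarrow> \<exists>W r. openin X W \<and> a \<in> W \<and> W \<subseteq> U \<and> order_on W r D"
    "compactin X K" "K \<subseteq> U"
    "\<And>V u c a. openin X V \<Longrightarrow> V \<subseteq> U \<Longrightarrow> u \<in> F_carrier V \<Longrightarrow> D V u c a \<noteq> 0 \<Longrightarrow> a \<in> K"
  shows "diff_op U K D"
  using assms unfolding diff_op_def by blast

text \<open>The support itself is a possible \<open>K\<close>: near a point outside it the operator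
  is zero, and compatibility with restriction carries this to sections over larger sets. Conversely
  the operator is zero on \<open>U\<close> minus \<open>K\<close>, so the support is a closed subset
  of the compact set \<open>K\<close>.\<close>

lemma Diff_c_iff:
  assumes U: "openin X U"
  shows "D \<in> Diff_c (subtopology X U) \<O> \<F> (densities X \<O>) \<longleftrightarrow> (\<exists>K. diff_op U K D)"
proof -
  have top: "topspace (subtopology X U) = U" using openin_subset[OF U] by auto
  have order: "(\<exists>W r. openin (subtopology X U) W \<and> a \<in> W \<and>
      order_at_most (subtopology (subtopology X U) W) \<O> \<F> (densities X \<O>) r D) \<longleftrightarrow>
    (\<exists>W r. openin X W \<and> a \<in> W \<and> W \<subseteq> U \<and> order_on W r D)" for a
    unfolding openin_open_subtopology[OF U] subtopology_subtopology
    using order_at_most_iff by (metis inf.absorb2)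
  let ?S = "support (subtopology X U) \<F> (densities X \<O>) D"
  have zero: "zero_on (subtopology X U) \<F> (densities X \<O>) W D \<longleftrightarrow>
      (\<forall>V u. openin X V \<and> V \<subseteq> W \<and> u \<in> F_carrier V \<longrightarrow> D V u = (\<lambda>c a. 0))" if "W \<subseteq> U" for W
    unfolding zero_on_def openin_open_subtopology[OF U] densities_simps using that by blast
  have closed: "closedin (subtopology X U) ?S" unfolding support_def by blast
  show ?thesis
  proof
    assume D: "D \<in> Diff_c (subtopology X U) \<O> \<F> (densities X \<O>)"
    note D' = D[unfolded Diff_c_def mem_Collect_eq differential_operator_def sheaf_hom_iff[OF U] top order]
    note hom = D'[THEN conjunct1, THEN conjunct1] and ord = D'[THEN conjunct1, THEN conjunct2, rule_format]
      and comp = D'[THEN conjunct2]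
    have "diff_op U ?S D"
    proof (rule diff_opI[OF hom ord])
      show "compactin X ?S" "?S \<subseteq> U" using comp by (simp_all add: compactin_subtopology)
      fix V u c a assume V: "openin X V" "V \<subseteq> U" "u \<in> F_carrier V" and nz: "D V u c a \<noteq> 0"
      have aV: "a \<in> V" using densities_onD(2)[OF hom_onD(1)[OF hom V]] nz by blast
      show "a \<in> ?S"
      proof (rule ccontr)
        assume "a \<notin> ?S"
        then obtain W where W: "openin (subtopology X U) W" "zero_on (subtopology X U) \<F> (densities X \<O>) W D" "a \<in> W"
          using aV V(2) unfolding support_def top by blast
        have WU: "openin X W" "W \<subseteq> U" using W(1) unfolding openin_open_subtopology[OF U] by auto
        have o: "openin X (V \<inter> W)" using V WU by blast
        have "D (V \<inter> W) (restr \<F> V (V \<inter> W) u) = (\<lambda>c a. 0)"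
          using W(2) o restr_F_closed[OF V(1) o Int_lower1 V(3)] unfolding zero[OF WU(2)] by blast
        then have "(if a \<in> V \<inter> W then D V u c a else 0) = 0"
          using fun_cong[OF fun_cong[OF hom_onD(4)[OF hom V(1) o Int_lower1 V(2,3)], of c], of a] by simp
        then show False using nz aV W(3) by simp
      qed
    qed
    then show "\<exists>K. diff_op U K D" by blast
  next
    assume "\<exists>K. diff_op U K D"
    then obtain K where K: "diff_op U K D" by blast
    note KD = diff_opD[OF K]
    have "?S \<subseteq> K"
    proof
      fix a assume a: "a \<in> ?S"
      show "a \<in> K"
      proof (rule ccontr)
        assume aK: "a \<notin> K"
        have "openin X (U - K)" using U compactin_imp_closedin[OF Hausdorff KD(3)] by blast
        then have o: "openin (subtopology X U) (U - K)" unfolding openin_open_subtopology[OF U] by blast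
        have "D V u = (\<lambda>c a. 0)" if V: "openin X V" "V \<subseteq> U - K" "u \<in> F_carrier V" for V u
        proof (intro ext)
          fix c b
          show "D V u c b = 0"
            using KD(5)[OF V(1) _ V(3), of c b] densities_onD(2)[OF hom_onD(1)[OF KD(1) V(1) _ V(3)], of b c] V(2)
            by blast
        qed
        then have "zero_on (subtopology X U) \<F> (densities X \<O>) (U - K) D"
          using zero[of "U - K"] by blast
        with o a aK show False unfolding support_def top by blast
      qed
    qed
    moreover have "compactin (subtopology X U) K" using KD by (simp add: compactin_subtopology)
    ultimately have "compactin (subtopology X U) ?S" using closed_compactin[OF _ _ closed] by blast
    then show "D \<in> Diff_c (subtopology X U) \<O> \<F> (densities X \<O>)"
      unfolding Diff_c_def differential_operator_def sheaf_hom_iff[OF U] top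
      by (intro CollectI conjI ballI KD(1) order[THEN iffD2] KD(2))
  qed
qed

lemma order_onD:
  "order_on W r D \<Longrightarrow> openin X V \<Longrightarrow> V \<subseteq> W \<Longrightarrow> length fs = Suc r \<Longrightarrow> set fs \<subseteq> carrier (sections \<O> V) \<Longrightarrow>
   openin X V' \<Longrightarrow> V' \<subseteq> V \<Longrightarrow> u \<in> F_carrier V' \<Longrightarrow> foldl (comm V) D fs V' u = (\<lambda>c a. 0)"
  unfolding order_on_def by blast

lemma order_onI:
  "(\<And>V fs V' u. openin X V \<Longrightarrow> V \<subseteq> W \<Longrightarrow> length fs = Suc r \<Longrightarrow> set fs \<subseteq> carrier (sections \<O> V) \<Longrightarrow>
   openin X V' \<Longrightarrow> V' \<subseteq> V \<Longrightarrow> u \<in> F_carrier V' \<Longrightarrow> foldl (comm V) D fs V' u = (\<lambda>c a. 0)) \<Longrightarrow> order_on W r D"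
  unfolding order_on_def by blast

lemma order_on_subset: "order_on W r D \<Longrightarrow> V \<subseteq> W \<Longrightarrow> order_on V r D"
  unfolding order_on_def by (meson subset_trans)

text \<open>The first r + 1 commutators already give the zero operator, and further commutators keep
  it zero.\<close>

lemma order_on_mono:
  assumes D: "order_on W r D" and rs: "r \<le> s"
  shows "order_on W s D"
proof (rule order_onI)
  fix V fs V' u assume V: "openin X V" "V \<subseteq> W" and fs: "length fs = Suc s" "set fs \<subseteq> carrier (sections \<O> V)"
    and V': "openin X V'" "V' \<subseteq> V" "u \<in> F_carrier V'"
  let ?a = "take (Suc r) fs" and ?b = "drop (Suc r) fs"
  have a: "length ?a = Suc r" "set ?a \<subseteq> carrier (sections \<O> V)" "set ?b \<subseteq> carrier (sections \<O> V)"
    using fs rs set_take_subset[of "Suc r" fs] set_drop_subset[of "Suc r" fs] by auto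
  have "foldl (comm V) D fs V' u = foldl (comm V) (foldl (comm V) D ?a) ?b V' u"
    by (simp flip: foldl_append)
  also have "\<dots> = (\<lambda>c a. 0)"
    by (rule foldl_comm_zero[OF V(1) a(3) order_onD[OF D V a(1,2)] V'])
  finally show "foldl (comm V) D fs V' u = (\<lambda>c a. 0)" .
qed

section \<open>Operations on compactly supported operators\<close>

lemma diff_op_compact_density:
  assumes U: "openin X U" and D: "diff_op U K D" and u: "u \<in> F_carrier U"
  shows "compact_density U K (D U u)"
  using diff_opD(3,4)[OF D] diff_opD(5)[OF D U subset_refl u] hom_onD(1)[OF diff_opD(1)[OF D] U subset_refl u]
  unfolding compact_density_def by blast

lemma diff_op_add:
  assumes U: "openin X U" and D: "diff_op U K D" and E: "diff_op U L E"
  shows "diff_op U (K \<union> L) (\<lambda>V u c a. D V u c a + E V u c a)"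
proof (rule diff_opI)
  note hD = hom_onD[OF diff_opD(1)[OF D]] and hE = hom_onD[OF diff_opD(1)[OF E]]
  show "hom_on U (\<lambda>V u c a. D V u c a + E V u c a)"
    by (rule hom_onI) (simp_all add: hD hE densities_on_add algebra_simps fun_eq_iff)
  show "compactin X (K \<union> L)" "K \<union> L \<subseteq> U" using diff_opD(3,4)[OF D] diff_opD(3,4)[OF E] by (auto intro: compactin_Un)
  show "a \<in> K \<union> L" if "openin X V" "V \<subseteq> U" "u \<in> F_carrier V" "D V u c a + E V u c a \<noteq> 0" for V u c a
    using diff_opD(5)[OF D that(1-3), of c a] diff_opD(5)[OF E that(1-3), of c a] that(4)
    by (cases "D V u c a = 0") auto
  fix a assume "a \<in> U"
  then obtain W1 r1 W2 r2 where W: "openin X W1" "a \<in> W1" "W1 \<subseteq> U" "order_on W1 r1 D"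
    "openin X W2" "a \<in> W2" "W2 \<subseteq> U" "order_on W2 r2 E"
    using diff_opD(2)[OF D] diff_opD(2)[OF E] by meson
  \<comment> \<open>The two orders are bounds on different neighbourhoods; on the intersection the
    maximum bounds both.\<close>
  let ?r = "max r1 r2" and ?W = "W1 \<inter> W2"
  have DW: "order_on ?W ?r D" by (rule order_on_mono[OF order_on_subset[OF W(4)]]) auto
  have EW: "order_on ?W ?r E" by (rule order_on_mono[OF order_on_subset[OF W(8)]]) auto
  have "order_on ?W ?r (\<lambda>V u c a. D V u c a + E V u c a)"
  proof (rule order_onI)
    fix V fs V' u assume V: "openin X V" "V \<subseteq> ?W" and fs: "length fs = Suc ?r" "set fs \<subseteq> carrier (sections \<O> V)"
      and V': "openin X V'" "V' \<subseteq> V" "u \<in> F_carrier V'"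
    have VU: "V \<subseteq> U" using V W by blast
    show "foldl (comm V) (\<lambda>V u c a. D V u c a + E V u c a) fs V' u = (\<lambda>c a. 0)"
      using foldl_comm_add[OF V(1) hom_on_density_valued[OF diff_opD(1)[OF D] VU] hom_on_density_valued[OF diff_opD(1)[OF E] VU] fs(2) V']
        order_onD[OF DW V fs V'] order_onD[OF EW V fs V'] by simp
  qed
  then show "\<exists>W r. openin X W \<and> a \<in> W \<and> W \<subseteq> U \<and> order_on W r (\<lambda>V u c a. D V u c a + E V u c a)"
    using W by (intro exI[of _ ?W] exI[of _ ?r]) auto
qed

lemma diff_op_scale:
  assumes U: "openin X U" and D: "diff_op U K D"
  shows "diff_op U K (\<lambda>V u c a. z * D V u c a)"
proof (rule diff_opI)
  note hD = hom_onD[OF diff_opD(1)[OF D]]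
  show "hom_on U (\<lambda>V u c a. z * D V u c a)"
    by (rule hom_onI) (simp_all add: hD densities_on_scale algebra_simps fun_eq_iff)
  show "compactin X K" "K \<subseteq> U" using diff_opD[OF D] by auto
  show "a \<in> K" if "openin X V" "V \<subseteq> U" "u \<in> F_carrier V" "z * D V u c a \<noteq> 0" for V u c a
    using diff_opD(5)[OF D that(1-3), of c a] that(4) by auto
  fix a assume "a \<in> U"
  then obtain W r where W: "openin X W" "a \<in> W" "W \<subseteq> U" "order_on W r D" using diff_opD(2)[OF D] by meson
  have "order_on W r (\<lambda>V u c a. z * D V u c a)"
  proof (rule order_onI)
    fix V fs V' u assume V: "openin X V" "V \<subseteq> W" and fs: "length fs = Suc r" "set fs \<subseteq> carrier (sections \<O> V)"
      and V': "openin X V'" "V' \<subseteq> V" "u \<in> F_carrier V'"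
    have VU: "V \<subseteq> U" using V W by blast
    have "foldl (comm V) (\<lambda>V u c a. z * D V u c a) fs V' u = (\<lambda>c a. z * foldl (comm V) D fs V' u c a)"
      by (rule foldl_comm_scale[OF V(1) hom_on_density_valued[OF diff_opD(1)[OF D] VU] fs(2) _ V']) simp
    then show "foldl (comm V) (\<lambda>V u c a. z * D V u c a) fs V' u = (\<lambda>c a. 0)"
      using order_onD[OF W(4) V fs V'] by simp
  qed
  then show "\<exists>W r. openin X W \<and> a \<in> W \<and> W \<subseteq> U \<and> order_on W r (\<lambda>V u c a. z * D V u c a)"
    using W by blast
qed

lemma diff_op_zero:
  assumes U: "openin X U"
  shows "diff_op U {} (\<lambda>V u c a. 0)"
proof (rule diff_opI)
  show "hom_on U (\<lambda>V u c a. 0)"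
    by (rule hom_onI) (simp_all add: densities_on_zero)
  have "order_on U 0 (\<lambda>V u c a. 0)"
    by (rule order_onI) (rule foldl_comm_zero; simp)
  then show "\<exists>W r. openin X W \<and> a \<in> W \<and> W \<subseteq> U \<and> order_on W r (\<lambda>V u c a. 0)" if "a \<in> U" for a
    using U that by blast
qed auto

lemma diff_op_compose:
  assumes U: "openin X U" and D: "diff_op U K D" and f: "f \<in> carrier (sections \<O> U)"
  shows "diff_op U K (\<lambda>V u. D V (restr \<O> U V f \<odot>\<^bsub>sections \<F> V\<^esub> u))" (is "diff_op U K ?E")
proof (rule diff_opI)
  note hD = hom_onD[OF diff_opD(1)[OF D]]
  have f': "restr \<O> U V f \<in> carrier (sections \<O> V)" if "openin X V" "V \<subseteq> U" for V using that U f by simp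
  have fu: "restr \<O> U V f \<odot>\<^bsub>sections \<F> V\<^esub> u \<in> F_carrier V" if "openin X V" "V \<subseteq> U" "u \<in> F_carrier V" for V u
    by (rule smult_F_closed[OF that(1) f'[OF that(1,2)] that(3)])
  show "hom_on U ?E"
  proof (rule hom_onI)
    fix V u assume V: "openin X V" "V \<subseteq> U" and u: "u \<in> F_carrier V"
    show "?E V u \<in> densities_on X \<O> V" by (rule hD(1)[OF V fu[OF V u]])
    show "?E V (u \<oplus>\<^bsub>sections \<F> V\<^esub> v) = (\<lambda>c a. ?E V u c a + ?E V v c a)" if v: "v \<in> F_carrier V" for v
      unfolding module.smult_r_distr[OF module_F[OF V(1)] f'[OF V] u v] by (rule hD(2)[OF V fu[OF V u] fu[OF V v]])
    show "?E V ((z \<odot>\<^bsub>sections \<O> V\<^esub> \<one>\<^bsub>sections \<O> V\<^esub>) \<odot>\<^bsub>sections \<F> V\<^esub> u) = (\<lambda>c a. z * ?E V u c a)" for z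
      unfolding smult_F_commute[OF V(1) f'[OF V] smult_O_closed[OF V(1) one_O_closed[OF V(1)]] u]
      by (rule hD(3)[OF V fu[OF V u]])
  next
    fix V W u assume V: "openin X V" "openin X W" "W \<subseteq> V" "V \<subseteq> U" and u: "u \<in> F_carrier V"
    have "restr \<F> V W (restr \<O> U V f \<odot>\<^bsub>sections \<F> V\<^esub> u) = restr \<O> U W f \<odot>\<^bsub>sections \<F> W\<^esub> restr \<F> V W u"
      using restr_F_smult[OF V(1-3) f'[OF V(1,4)] u] restr_restr[OF U V(1-4) f] by simp
    then show "?E W (restr \<F> V W u) = (\<lambda>c a. if a \<in> W then ?E V u c a else 0)"
      using hD(4)[OF V fu[OF V(1,4) u]] by simp
  qed
  show "compactin X K" "K \<subseteq> U" using diff_opD[OF D] by auto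
  show "a \<in> K" if "openin X V" "V \<subseteq> U" "u \<in> F_carrier V" "?E V u c a \<noteq> 0" for V u c a
    using diff_opD(5)[OF D that(1,2) fu[OF that(1-3)], of c a] that(4) by auto
  fix a assume "a \<in> U"
  then obtain W r where W: "openin X W" "a \<in> W" "W \<subseteq> U" "order_on W r D" using diff_opD(2)[OF D] by meson
  have "order_on W r ?E"
  proof (rule order_onI)
    fix V fs V' u assume V: "openin X V" "V \<subseteq> W" and fs: "length fs = Suc r" "set fs \<subseteq> carrier (sections \<O> V)"
      and V': "openin X V'" "V' \<subseteq> V" "u \<in> F_carrier V'"
    have VU: "V \<subseteq> U" using V W by blast
    have V'U: "V' \<subseteq> U" using V' VU by blast
    have res: "restr \<O> V Z (restr \<O> U V f) = restr \<O> U Z f" if "openin X Z" "Z \<subseteq> V" for Z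
      by (rule restr_restr[OF U V(1) that VU f])
    have "foldl (comm V) ?E fs V' u = foldl (comm V) D fs V' (restr \<O> V V' (restr \<O> U V f) \<odot>\<^bsub>sections \<F> V'\<^esub> u)"
      by (rule foldl_comm_compose[OF V(1) hom_on_density_valued[OF diff_opD(1)[OF D] VU] fs(2) f'[OF V(1) VU] _ V'])
        (simp add: res)
    also have "\<dots> = (\<lambda>c a. 0)"
      unfolding res[OF V'(1,2)] by (rule order_onD[OF W(4) V fs V'(1,2) fu[OF V'(1) V'U V'(3)]])
    finally show "foldl (comm V) ?E fs V' u = (\<lambda>c a. 0)" .
  qed
  then show "\<exists>W r. openin X W \<and> a \<in> W \<and> W \<subseteq> U \<and> order_on W r ?E" using W by blast
qed

lemma diff_op_support:
  assumes D: "diff_op U K D" and L: "compactin X L" "L \<subseteq> U"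
    and "\<And>V u c a. openin X V \<Longrightarrow> V \<subseteq> U \<Longrightarrow> u \<in> F_carrier V \<Longrightarrow> D V u c a \<noteq> 0 \<Longrightarrow> a \<in> L"
  shows "diff_op U L D"
  by (rule diff_opI[OF diff_opD(1,2)[OF D] L assms(4)])

text \<open>An operator is a family indexed by open sets, so the same \<open>D\<close> represents
  its restriction. Only the neighbourhoods that witness its order have to be shrunk.\<close>

lemma diff_op_restrict:
  assumes D: "diff_op U K D" and V: "openin X V" "V \<subseteq> U" "K \<subseteq> V"
  shows "diff_op V K D"
proof (rule diff_opI)
  show "hom_on V D" by (rule hom_on_subset[OF diff_opD(1)[OF D] V(2)])
  show "a \<in> K" if "openin X W" "W \<subseteq> V" "u \<in> F_carrier W" "D W u c a \<noteq> 0" for W u c a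
    using diff_opD(5)[OF D that(1) _ that(3,4)] that(2) V(2) by blast
  fix a assume a: "a \<in> V"
  then obtain W r where W: "openin X W" "a \<in> W" "W \<subseteq> U" "order_on W r D" using diff_opD(2)[OF D] V by (meson subsetD)
  show "\<exists>W r. openin X W \<and> a \<in> W \<and> W \<subseteq> V \<and> order_on W r D"
    by (intro exI[of _ "W \<inter> V"] exI[of _ r]) (use W V a order_on_subset[OF W(4), of "W \<inter> V"] in auto)
qed (use diff_opD[OF D] V in auto)

text \<open>Restrict to \<open>V\<close>, apply \<open>D\<close>, and extend the resulting density
  by zero, which is possible because its support lies in the closed set \<open>K\<close>. On open
  subsets of \<open>V\<close> this is \<open>D\<close> again; on \<open>U\<close> minus
  \<open>K\<close> it is zero, hence of order 0. These two open sets cover \<open>U\<close>.\<close>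

lemma diff_op_extend:
  assumes V: "openin X V" "V \<subseteq> U" and U: "openin X U" and D: "diff_op V K D"
  shows "diff_op U K (\<lambda>W u. D (W \<inter> V) (restr \<F> W (W \<inter> V) u))" (is "diff_op U K ?E")
proof (rule diff_opI)
  note hD = hom_onD[OF diff_opD(1)[OF D]]
  have r: "restr \<F> W (W \<inter> V) u \<in> F_carrier (W \<inter> V)" "openin X (W \<inter> V)" if "openin X W" "u \<in> F_carrier W" for W u
    using restr_F_closed[OF that(1) _ Int_lower1 that(2), of V] that V by auto
  have supp: "a \<in> K" if "openin X W" "u \<in> F_carrier W" "?E W u c a \<noteq> 0" for W u c a
    using diff_opD(5)[OF D r(2)[OF that(1,2)] Int_lower2 r(1)[OF that(1,2)] that(3)] .
  show K: "compactin X K" "K \<subseteq> U" using diff_opD[OF D] V by auto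
  show "a \<in> K" if "openin X W" "W \<subseteq> U" "u \<in> F_carrier W" "?E W u c a \<noteq> 0" for W u c a
    using supp[OF that(1,3,4)] .
  have Kc: "closedin X K" by (rule compactin_imp_closedin[OF Hausdorff K(1)])
  have dens: "?E W u \<in> densities_on X \<O> (W \<inter> V)" if "openin X W" "u \<in> F_carrier W" for W u
    by (rule hD(1)[OF r(2)[OF that] Int_lower2 r(1)[OF that]])
  show hom: "hom_on U ?E"
  proof (rule hom_onI)
    fix W u assume W: "openin X W" "W \<subseteq> U" and u: "u \<in> F_carrier W"
    note o = r(2)[OF W(1) u] and ru = r(1)[OF W(1) u]
    show "?E W u \<in> densities_on X \<O> W"
      by (rule densities_on_extend[OF dens[OF W(1) u] o Int_lower1 W(1) Kc _ supp[OF W(1) u]])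
        (use diff_opD(4)[OF D] in blast)
    show "?E W (u \<oplus>\<^bsub>sections \<F> W\<^esub> v) = (\<lambda>c a. ?E W u c a + ?E W v c a)" if v: "v \<in> F_carrier W" for v
      unfolding restr_F_add[OF W(1) o Int_lower1 u v] by (rule hD(2)[OF o Int_lower2 ru r(1)[OF W(1) v]])
    show "?E W ((z \<odot>\<^bsub>sections \<O> W\<^esub> \<one>\<^bsub>sections \<O> W\<^esub>) \<odot>\<^bsub>sections \<F> W\<^esub> u) = (\<lambda>c a. z * ?E W u c a)" for z
      unfolding restr_F_smult[OF W(1) o Int_lower1 smult_O_closed[OF W(1) one_O_closed[OF W(1)]] u]
        restr_smult[OF W(1) o Int_lower1 one_O_closed[OF W(1)]] restr_one[OF W(1) o Int_lower1]
      by (rule hD(3)[OF o Int_lower2 ru])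
  next
    fix W Z u assume W: "openin X W" "openin X Z" "Z \<subseteq> W" "W \<subseteq> U" and u: "u \<in> F_carrier W"
    have oZ: "openin X (Z \<inter> V)" using W V by blast
    have sub: "Z \<inter> V \<subseteq> W \<inter> V" using W by blast
    have "restr \<F> Z (Z \<inter> V) (restr \<F> W Z u) = restr \<F> (W \<inter> V) (Z \<inter> V) (restr \<F> W (W \<inter> V) u)"
      using restr_F_restr[OF W(1,2) oZ Int_lower1 W(3) u] restr_F_restr[OF W(1) r(2)[OF W(1) u] oZ sub Int_lower1 u] by simp
    then have "?E Z (restr \<F> W Z u) = (\<lambda>c a. if a \<in> Z \<inter> V then ?E W u c a else 0)"
      using hD(4)[OF r(2)[OF W(1) u] oZ sub Int_lower2 r(1)[OF W(1) u]] by simp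
    moreover have "?E W u c a = 0" if "a \<notin> V" for c a
      using densities_onD(2)[OF dens[OF W(1) u]] that by blast
    ultimately show "?E Z (restr \<F> W Z u) = (\<lambda>c a. if a \<in> Z then ?E W u c a else 0)"
      by (simp add: fun_eq_iff)
  qed
  fix a assume a: "a \<in> U"
  show "\<exists>W r. openin X W \<and> a \<in> W \<and> W \<subseteq> U \<and> order_on W r ?E"
  proof (cases "a \<in> V")
    case True
    then obtain W r where W: "openin X W" "a \<in> W" "W \<subseteq> V" "order_on W r D" using diff_opD(2)[OF D] by meson
    have "order_on W r ?E"
    proof (rule order_onI)
      fix Z fs Z' u assume Z: "openin X Z" "Z \<subseteq> W" and fs: "length fs = Suc r" "set fs \<subseteq> carrier (sections \<O> Z)"
        and Z': "openin X Z'" "Z' \<subseteq> Z" "u \<in> F_carrier Z'"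
      have ZV: "Z \<subseteq> V" using Z W by blast
      have "foldl (comm Z) ?E fs Z' u = (\<lambda>c a. 1 * foldl (comm Z) D fs Z' u c a)"
      proof (rule foldl_comm_scale[OF Z(1) hom_on_density_valued[OF diff_opD(1)[OF D] ZV] fs(2) _ Z'])
        fix Y u assume Y: "openin X Y" "Y \<subseteq> Z" "u \<in> F_carrier Y"
        then have "Y \<inter> V = Y" using ZV by blast
        then show "?E Y u = (\<lambda>c a. 1 * D Y u c a)" using restr_F_self[OF Y(1,3)] by simp
      qed
      then show "foldl (comm Z) ?E fs Z' u = (\<lambda>c a. 0)" using order_onD[OF W(4) Z fs Z'] by simp
    qed
    then show ?thesis using W V by blast
  next
    case False
    have o: "openin X (U - K)" using U Kc by blast
    have "order_on (U - K) 0 ?E"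
    proof (rule order_onI)
      fix Z fs Z' u assume Z: "openin X Z" "Z \<subseteq> U - K" and fs: "length fs = Suc 0" "set fs \<subseteq> carrier (sections \<O> Z)"
        and Z': "openin X Z'" "Z' \<subseteq> Z" "u \<in> F_carrier Z'"
      show "foldl (comm Z) ?E fs Z' u = (\<lambda>c a. 0)"
      proof (rule foldl_comm_zero[OF Z(1) fs(2) _ Z'])
        fix Y u assume Y: "openin X Y" "Y \<subseteq> Z" "u \<in> F_carrier Y"
        show "?E Y u = (\<lambda>c a. 0)"
        proof (intro ext)
          fix c b show "?E Y u c b = 0"
            using supp[OF Y(1,3), of c b] densities_onD(2)[OF dens[OF Y(1,3)], of b c] Y(2) Z(2) by blast
        qed
      qed
    qed
    moreover have "a \<notin> K" using False diff_opD(4)[OF D] by blast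
    ultimately show ?thesis using o a by blast
  qed
qed

end

section \<open>Partitions of unity in the structure sheaf\<close>

context formal_mfd begin

lemma restr_finsum:
  assumes U: "openin X U" and V: "openin X V" "V \<subseteq> U" and f: "\<And>j. j \<in> J \<Longrightarrow> f j \<in> carrier (sections \<O> U)"
    and J: "finite J"
  shows "restr \<O> U V (finsum (sections \<O> U) f J) = finsum (sections \<O> V) (\<lambda>j. restr \<O> U V (f j)) J"
  using J f
proof (induction J)
  case empty
  interpret U: cring "sections \<O> U" using cring_O U by blast
  interpret V: cring "sections \<O> V" using cring_O V by blast
  show ?case using restr_zero[OF U V] by simp
next
  case (insert j J)
  interpret U: cring "sections \<O> U" using cring_O U by blast
  interpret V: cring "sections \<O> V" using cring_O V by blast
  have fj: "f j \<in> carrier (sections \<O> U)" "f \<in> J \<rightarrow> carrier (sections \<O> U)" using insert by auto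
  have rj: "restr \<O> U V (f j) \<in> carrier (sections \<O> V)" "(\<lambda>j. restr \<O> U V (f j)) \<in> J \<rightarrow> carrier (sections \<O> V)"
    using U V insert.prems by auto
  show ?case
    using insert U.finsum_insert[OF insert(1,2) fj(2,1)] V.finsum_insert[OF insert(1,2) rj(2,1)]
      restr_add[OF U V fj(1) U.finsum_closed[OF fj(2)]] by simp
qed

text \<open>This is the form in which a further bump is added to a partition whose index
  \<open>k\<close> has already been used.\<close>

lemma finsum_update:
  assumes U: "openin X U" and J: "finite J" "k \<in> J" and f: "\<And>j. j \<in> J \<Longrightarrow> f j \<in> carrier (sections \<O> U)"
    and x: "x \<in> carrier (sections \<O> U)"
  shows "finsum (sections \<O> U) (f(k := f k \<oplus>\<^bsub>sections \<O> U\<^esub> x)) J = finsum (sections \<O> U) f J \<oplus>\<^bsub>sections \<O> U\<^esub> x"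
proof -
  interpret U: cring "sections \<O> U" using cring_O U by blast
  let ?K = "J - {k}" and ?g = "f(k := f k \<oplus>\<^bsub>sections \<O> U\<^esub> x)"
  have K: "finite ?K" "k \<notin> ?K" "insert k ?K = J" using J by auto
  have c: "f \<in> ?K \<rightarrow> carrier (sections \<O> U)" "f k \<in> carrier (sections \<O> U)" using f J by auto
  have g: "?g \<in> ?K \<rightarrow> carrier (sections \<O> U)" "?g k \<in> carrier (sections \<O> U)" using c x by auto
  have "finsum (sections \<O> U) ?g ?K = finsum (sections \<O> U) f ?K"
    by (rule U.finsum_cong') (use c in auto)
  then have 1: "finsum (sections \<O> U) ?g J = (f k \<oplus>\<^bsub>sections \<O> U\<^esub> x) \<oplus>\<^bsub>sections \<O> U\<^esub> finsum (sections \<O> U) f ?K"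
    using U.finsum_insert[OF K(1,2) g] unfolding K(3) by (simp only: fun_upd_same)
  have 2: "finsum (sections \<O> U) f J = f k \<oplus>\<^bsub>sections \<O> U\<^esub> finsum (sections \<O> U) f ?K"
    using U.finsum_insert[OF K(1,2) c] unfolding K(3) .
  show ?thesis unfolding 1 2 using c(2) x U.finsum_closed[OF c(1)] by (simp add: U.a_ac)
qed

text \<open>
  Bumps \<open>s\<^sub>1, \<dots>, s\<^sub>m\<close> that are \<open>1\<close> on sets covering \<open>K\<close> are turned into a partition of unity by
  \<open>f\<^sub>b = (1 - f\<^sub>1 - \<dots> - f\<^sub>b\<^sub>-\<^sub>1) s\<^sub>b\<close>. Unlike a normalisation, this needs no division in \<open>\<O>\<close>.
\<close>

lemma sections_partition:
  fixes A :: "'i \<Rightarrow> 'm set"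
  assumes K: "compactin X K" "K \<subseteq> (\<Union>i\<in>I. A i)" and A: "\<And>i. i \<in> I \<Longrightarrow> openin X (A i)"
  obtains f L J where "finite J" "J \<subseteq> I" "\<And>j. j \<in> J \<Longrightarrow> f j \<in> carrier (sections \<O> (topspace X))"
    "\<And>j. j \<in> J \<Longrightarrow> compactin X (L j)" "\<And>j. j \<in> J \<Longrightarrow> L j \<subseteq> A j"
    "\<And>j. j \<in> J \<Longrightarrow> restr \<O> (topspace X) (topspace X - L j) (f j) = \<zero>\<^bsub>sections \<O> (topspace X - L j)\<^esub>"
    "\<And>a. a \<in> K \<Longrightarrow> \<exists>N. openin X N \<and> a \<in> N \<and>
       restr \<O> (topspace X) N (finsum (sections \<O> (topspace X)) f J) = \<one>\<^bsub>sections \<O> N\<^esub>"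
proof -
  let ?T = "topspace X" and ?R = "sections \<O> (topspace X)"
  have T: "openin X ?T" by simp
  interpret R: cring ?R using cring_O T by blast
  define good where "good f L B \<longleftrightarrow> f \<in> carrier ?R \<and> compactin X L \<and> L \<subseteq> B \<and>
    restr \<O> ?T (?T - L) f = \<zero>\<^bsub>sections \<O> (?T - L)\<^esub>" for f L B
  define P where "P a i s N L \<longleftrightarrow> i \<in> I \<and> good s L (A i) \<and> openin X N \<and> a \<in> N \<and>
    restr \<O> ?T N s = \<one>\<^bsub>sections \<O> N\<^esub>" for a i s N L
  have "\<exists>i s N L. P a i s N L" if a: "a \<in> K" for a
  proof -
    obtain i where i: "i \<in> I" "a \<in> A i" using a K(2) by blast
    obtain s N L where "s \<in> carrier ?R" "openin X N" "a \<in> N" "N \<subseteq> L" "compactin X L" "L \<subseteq> A i"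
      "restr \<O> ?T N s = \<one>\<^bsub>sections \<O> N\<^esub>" "restr \<O> ?T (?T - L) s = \<zero>\<^bsub>sections \<O> (?T - L)\<^esub>"
      by (rule bump_section[OF A[OF i(1)] i(2)])
    then have "P a i s N L" using i(1) unfolding P_def good_def by simp
    then show ?thesis by blast
  qed
  then obtain i s N L where P: "\<And>a. a \<in> K \<Longrightarrow> P a (i a) (s a) (N a) (L a)" by metis
  have "openin X (N a) \<and> a \<in> N a" if "a \<in> K" for a using P[OF that] by (simp add: P_def)
  from compactin_finite_subcover[OF K(1) this]
  obtain F where F: "finite F" "F \<subseteq> K" "K \<subseteq> (\<Union>a\<in>F. N a)" by blast
  let ?J = "i ` F"
  have open_diff: "openin X (?T - M)" if "compactin X M" for M
    using compactin_imp_closedin[OF Hausdorff that] by blast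
  \<comment> \<open>Induction over the points already treated, with the index set fixed from the
    start. Several points may share an index; their bumps then accumulate in one function and their
    compact sets in one union.\<close>
  have "\<exists>f L. (\<forall>j\<in>?J. good (f j) (L j) (A j)) \<and>
    (\<forall>a\<in>G. restr \<O> ?T (N a) (finsum ?R f ?J) = \<one>\<^bsub>sections \<O> (N a)\<^esub>)" if "G \<subseteq> F" for G
    using finite_subset[OF that F(1)] that
  proof (induction G)
    case empty
    have "good \<zero>\<^bsub>?R\<^esub> {} (A j)" for j
      using restr_zero[OF T, of ?T] T by (simp add: good_def)
    then show ?case by (intro exI[of _ "\<lambda>_. \<zero>\<^bsub>?R\<^esub>"] exI[of _ "\<lambda>_. {}"]) simp
  next
    case (insert b G)
    then obtain f M where f: "\<And>j. j \<in> ?J \<Longrightarrow> good (f j) (M j) (A j)"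
      and one: "\<And>a. a \<in> G \<Longrightarrow> restr \<O> ?T (N a) (finsum ?R f ?J) = \<one>\<^bsub>sections \<O> (N a)\<^esub>" by blast
    have b: "b \<in> F" "b \<in> K" using insert.prems F by auto
    have Pb: "good (s b) (L b) (A (i b))" "openin X (N b)" "restr \<O> ?T (N b) (s b) = \<one>\<^bsub>sections \<O> (N b)\<^esub>"
      using P[OF b(2)] by (auto simp: P_def)
    have fc: "f j \<in> carrier ?R" if "j \<in> ?J" for j using f[OF that] by (simp add: good_def)
    have sc: "s b \<in> carrier ?R" using Pb by (simp add: good_def)
    define S where "S = finsum ?R f ?J"
    have Sc: "S \<in> carrier ?R" unfolding S_def using fc by (intro R.finsum_closed) auto
    \<comment> \<open>What is still missing to 1. It is zero on the neighbourhoods of the points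
      treated before.\<close>
    define e where "e = \<one>\<^bsub>?R\<^esub> \<ominus>\<^bsub>?R\<^esub> S"
    have ec: "e \<in> carrier ?R" unfolding e_def using Sc by simp
    have Se: "S \<oplus>\<^bsub>?R\<^esub> e = \<one>\<^bsub>?R\<^esub>"
    proof -
      have "e \<oplus>\<^bsub>?R\<^esub> S = \<one>\<^bsub>?R\<^esub>" unfolding e_def using Sc by (simp add: R.minus_eq R.a_assoc R.l_neg)
      then show ?thesis using R.a_comm[OF Sc ec] by simp
    qed
    define x where "x = e \<otimes>\<^bsub>?R\<^esub> s b"
    have xc: "x \<in> carrier ?R" unfolding x_def using ec sc by simp
    define g where "g = f(i b := f (i b) \<oplus>\<^bsub>?R\<^esub> x)"
    define M' where "M' = M(i b := M (i b) \<union> L b)"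
    have g: "finsum ?R g ?J = S \<oplus>\<^bsub>?R\<^esub> x"
      unfolding g_def S_def by (rule finsum_update[OF T finite_imageI[OF F(1)] imageI[OF b(1)] fc xc])
    have "good (g j) (M' j) (A j)" if j: "j \<in> ?J" for j
    proof (cases "j = i b")
      case False
      then show ?thesis using f[OF j] by (simp add: g_def M'_def)
    next
      case True
      have M: "good (f j) (M j) (A j)" using f[OF j] .
      have M'j: "M' j = M j \<union> L b" and gj: "g j = f j \<oplus>\<^bsub>?R\<^esub> x" using True by (simp_all add: M'_def g_def)
      have comp: "compactin X (M' j)" unfolding M'j using M Pb(1) by (intro compactin_Un) (auto simp: good_def)
      have sub: "M' j \<subseteq> A j" unfolding M'j using M Pb(1) True by (auto simp: good_def)
      let ?D = "?T - M' j"
      interpret D: cring "sections \<O> ?D" using cring_O open_diff[OF comp] by blast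
      have oD: "openin X ?D" using open_diff[OF comp] .
      have oM: "openin X (?T - M j)" "openin X (?T - L b)" using open_diff M Pb(1) by (auto simp: good_def)
      have sD: "?D \<subseteq> ?T - M j" "?D \<subseteq> ?T - L b" "?D \<subseteq> ?T" by (auto simp: M'j)
      have "restr \<O> ?T ?D (f j) = restr \<O> (?T - M j) ?D (restr \<O> ?T (?T - M j) (f j))"
        using restr_restr[OF T oM(1) oD sD(1) Diff_subset fc[OF j]] by simp
      also have "\<dots> = \<zero>\<^bsub>sections \<O> ?D\<^esub>" using M restr_zero[OF oM(1) oD sD(1)] by (simp add: good_def)
      finally have 1: "restr \<O> ?T ?D (f j) = \<zero>\<^bsub>sections \<O> ?D\<^esub>" .
      have "restr \<O> ?T ?D (s b) = restr \<O> (?T - L b) ?D (restr \<O> ?T (?T - L b) (s b))"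
        using restr_restr[OF T oM(2) oD sD(2) Diff_subset sc] by simp
      also have "\<dots> = \<zero>\<^bsub>sections \<O> ?D\<^esub>" using Pb(1) restr_zero[OF oM(2) oD sD(2)] by (simp add: good_def)
      finally have 2: "restr \<O> ?T ?D (s b) = \<zero>\<^bsub>sections \<O> ?D\<^esub>" .
      have "restr \<O> ?T ?D x = \<zero>\<^bsub>sections \<O> ?D\<^esub>"
        unfolding x_def restr_mult[OF T oD sD(3) ec sc] 2 using restr_closed[OF T oD sD(3) ec] by simp
      then have "restr \<O> ?T ?D (g j) = \<zero>\<^bsub>sections \<O> ?D\<^esub>"
        unfolding gj restr_add[OF T oD sD(3) fc[OF j] xc] 1 by simp
      then show ?thesis using comp sub fc[OF j] xc unfolding good_def gj by simp
    qed
    moreover have "restr \<O> ?T (N a) (finsum ?R g ?J) = \<one>\<^bsub>sections \<O> (N a)\<^esub>" if a: "a \<in> insert b G" for a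
    proof -
      have "a \<in> K" using a insert.prems F by auto
      then have oN: "openin X (N a)" using P by (simp add: P_def)
      have sN: "N a \<subseteq> ?T" using openin_subset[OF oN] .
      interpret N: cring "sections \<O> (N a)" using cring_O oN by blast
      have rS: "restr \<O> ?T (N a) S \<in> carrier (sections \<O> (N a))" and re: "restr \<O> ?T (N a) e \<in> carrier (sections \<O> (N a))"
        using restr_closed[OF T oN sN] Sc ec by auto
      have sum: "restr \<O> ?T (N a) S \<oplus>\<^bsub>sections \<O> (N a)\<^esub> restr \<O> ?T (N a) e = \<one>\<^bsub>sections \<O> (N a)\<^esub>"
        using restr_add[OF T oN sN Sc ec] Se restr_one[OF T oN sN] by simp
      have x: "restr \<O> ?T (N a) x = restr \<O> ?T (N a) e \<otimes>\<^bsub>sections \<O> (N a)\<^esub> restr \<O> ?T (N a) (s b)"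
        unfolding x_def by (rule restr_mult[OF T oN sN ec sc])
      show ?thesis
      \<comment> \<open>On the new neighbourhood \<open>s b\<close> is 1, so \<open>x\<close> is the
        whole remainder and the sum becomes 1. On the earlier ones the remainder is 0, so
        \<open>x\<close> changes nothing.\<close>
      proof (cases "a = b")
        case True
        then have "restr \<O> ?T (N a) (s b) = \<one>\<^bsub>sections \<O> (N a)\<^esub>" using Pb(3) by simp
        then have "restr \<O> ?T (N a) x = restr \<O> ?T (N a) e" using x N.r_one[OF re] by simp
        then show ?thesis unfolding g restr_add[OF T oN sN Sc xc] using sum by simp
      next
        case False
        then have S1: "restr \<O> ?T (N a) S = \<one>\<^bsub>sections \<O> (N a)\<^esub>" using one a unfolding S_def by blast
        then have "restr \<O> ?T (N a) e = \<zero>\<^bsub>sections \<O> (N a)\<^esub>"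
          using sum re by (simp add: N.add.r_cancel_one)
        then have "restr \<O> ?T (N a) x = \<zero>\<^bsub>sections \<O> (N a)\<^esub>"
          using x restr_closed[OF T oN sN sc] by simp
        then show ?thesis unfolding g restr_add[OF T oN sN Sc xc] using S1 by simp
      qed
    qed
    ultimately show ?case by (intro exI[of _ g] exI[of _ M']) simp
  qed
  from this[OF subset_refl] obtain f M where f: "\<And>j. j \<in> ?J \<Longrightarrow> good (f j) (M j) (A j)"
    and one: "\<And>a. a \<in> F \<Longrightarrow> restr \<O> ?T (N a) (finsum ?R f ?J) = \<one>\<^bsub>sections \<O> (N a)\<^esub>" by blast
  show thesis
  proof (rule that[of ?J f M])
    show "finite ?J" using F(1) by simp
    show "?J \<subseteq> I" using P F(2) by (auto simp: P_def)
    fix a assume "a \<in> K"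
    then obtain b where b: "b \<in> F" "a \<in> N b" using F(3) by blast
    then have "openin X (N b)" using P F(2) by (auto simp: P_def)
    then show "\<exists>N. openin X N \<and> a \<in> N \<and> restr \<O> ?T N (finsum ?R f ?J) = \<one>\<^bsub>sections \<O> N\<^esub>"
      using b one by blast
  qed (use f in \<open>auto simp: good_def\<close>)
qed

end

section \<open>Cutting operators into pieces\<close>

context formal_module begin

lemma hom_on_zero:
  assumes D: "hom_on U D" and V: "openin X V" "V \<subseteq> U"
  shows "D V \<zero>\<^bsub>sections \<F> V\<^esub> = (\<lambda>c a. 0)"
proof -
  interpret abelian_group "sections \<F> V" by (rule abelian_group_F[OF V(1)])
  have "D V (\<zero>\<^bsub>sections \<F> V\<^esub> \<oplus>\<^bsub>sections \<F> V\<^esub> \<zero>\<^bsub>sections \<F> V\<^esub>) = (\<lambda>c a. D V \<zero>\<^bsub>sections \<F> V\<^esub> c a + D V \<zero>\<^bsub>sections \<F> V\<^esub> c a)"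
    by (rule hom_onD(2)[OF D V]) auto
  then show ?thesis by (simp add: fun_eq_iff)
qed

lemma hom_on_finsum_smult:
  assumes D: "hom_on U D" and V: "openin X V" "V \<subseteq> U" and u: "u \<in> F_carrier V"
    and J: "finite J" and g: "\<And>j. j \<in> J \<Longrightarrow> g j \<in> carrier (sections \<O> V)"
  shows "D V (finsum (sections \<O> V) g J \<odot>\<^bsub>sections \<F> V\<^esub> u) = (\<lambda>c a. \<Sum>j\<in>J. D V (g j \<odot>\<^bsub>sections \<F> V\<^esub> u) c a)"
  using J g
proof (induction J)
  case empty
  interpret module "sections \<O> V" "sections \<F> V" by (rule module_F[OF V(1)])
  show ?case using hom_on_zero[OF D V] u by simp
next
  case (insert j J)
  interpret module "sections \<O> V" "sections \<F> V" by (rule module_F[OF V(1)])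
  have c: "g \<in> J \<rightarrow> carrier (sections \<O> V)" "g j \<in> carrier (sections \<O> V)" using insert by auto
  have "finsum (sections \<O> V) g (insert j J) \<odot>\<^bsub>sections \<F> V\<^esub> u =
    (g j \<odot>\<^bsub>sections \<F> V\<^esub> u) \<oplus>\<^bsub>sections \<F> V\<^esub> (finsum (sections \<O> V) g J \<odot>\<^bsub>sections \<F> V\<^esub> u)"
    using R.finsum_insert[OF insert(1,2) c] smult_l_distr[OF c(2) R.finsum_closed[OF c(1)] u] by simp
  then show ?case
    using hom_onD(2)[OF D V smult_F_closed[OF V(1) c(2) u] smult_F_closed[OF V(1) R.finsum_closed[OF c(1)] u]] insert
    by simp
qed

lemma hom_on_local_eq:
  assumes D: "hom_on U D" and V: "openin X V" "V \<subseteq> U" and u: "u \<in> F_carrier V" "v \<in> F_carrier V"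
    and W: "openin X W" "W \<subseteq> V" "a \<in> W" "restr \<F> V W u = restr \<F> V W v"
  shows "D V u c a = D V v c a"
proof -
  have "(if a \<in> W then D V u c a else 0) = (if a \<in> W then D V v c a else 0)"
    using fun_cong[OF fun_cong[OF hom_onD(4)[OF D V(1) W(1,2) V(2) u(1)], of c], of a]
      fun_cong[OF fun_cong[OF hom_onD(4)[OF D V(1) W(1,2) V(2) u(2)], of c], of a] W(4) by simp
  then show ?thesis using W(3) by simp
qed

text \<open>Off \<open>L\<close> the section \<open>f\<close> is zero in \<O>, hence annihilates
  \<F>; zero residues alone would not give this.\<close>

lemma smult_vanishing:
  assumes V: "openin X V" and u: "u \<in> F_carrier V" and f: "f \<in> carrier (sections \<O> (topspace X))"
    and L: "compactin X L" "restr \<O> (topspace X) (topspace X - L) f = \<zero>\<^bsub>sections \<O> (topspace X - L)\<^esub>"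
  shows "restr \<F> V (V - L) (restr \<O> (topspace X) V f \<odot>\<^bsub>sections \<F> V\<^esub> u) = \<zero>\<^bsub>sections \<F> (V - L)\<^esub>"
proof -
  have T: "openin X (topspace X)" by simp
  have Lc: "closedin X L" by (rule compactin_imp_closedin[OF Hausdorff L(1)])
  have o: "openin X (V - L)" "openin X (topspace X - L)" using V Lc by blast+
  have Vt: "V \<subseteq> topspace X" using openin_subset[OF V] .
  then have VL: "V - L \<subseteq> topspace X - L" by blast
  interpret module "sections \<O> (V - L)" "sections \<F> (V - L)" by (rule module_F[OF o(1)])
  have "restr \<O> V (V - L) (restr \<O> (topspace X) V f) = restr \<O> (topspace X - L) (V - L) (restr \<O> (topspace X) (topspace X - L) f)"
    using restr_restr[OF T V o(1) Diff_subset Vt f] restr_restr[OF T o(2,1) VL Diff_subset f] by simp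
  also have "\<dots> = \<zero>\<^bsub>sections \<O> (V - L)\<^esub>" unfolding L(2) by (rule restr_zero[OF o(2,1) VL])
  finally show ?thesis
    unfolding restr_F_smult[OF V o(1) Diff_subset restr_closed[OF T V Vt f] u]
    using smult_l_null[OF restr_F_closed[OF V o(1) Diff_subset u]] by simp
qed

text \<open>By additivity the sum is \<open>D\<close> applied to S u, where S is the sum of the
  functions. Near a point of \<open>K\<close> the section S is 1, so S u and u have the same values
  under \<open>D\<close> there; off \<open>K\<close> all values are 0.\<close>

lemma hom_on_partition:
  assumes D: "diff_op U K D" and J: "finite J" and f: "\<And>j. j \<in> J \<Longrightarrow> f j \<in> carrier (sections \<O> (topspace X))"
    and one: "\<And>a. a \<in> K \<Longrightarrow> \<exists>N. openin X N \<and> a \<in> N \<and>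
       restr \<O> (topspace X) N (finsum (sections \<O> (topspace X)) f J) = \<one>\<^bsub>sections \<O> N\<^esub>"
    and V: "openin X V" "V \<subseteq> U" and u: "u \<in> F_carrier V"
  shows "(\<lambda>c a. \<Sum>j\<in>J. D V (restr \<O> (topspace X) V (f j) \<odot>\<^bsub>sections \<F> V\<^esub> u) c a) = D V u"
proof -
  let ?T = "topspace X"
  let ?S = "finsum (sections \<O> ?T) f J"
  have T: "openin X ?T" by simp
  have Vt: "V \<subseteq> ?T" using openin_subset[OF V(1)] .
  interpret T: cring "sections \<O> ?T" using cring_O T by blast
  note hom = diff_opD(1)[OF D]
  have S: "?S \<in> carrier (sections \<O> ?T)" using f by (intro T.finsum_closed) auto
  have rf: "restr \<O> ?T V (f j) \<in> carrier (sections \<O> V)" if "j \<in> J" for j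
    by (rule restr_closed[OF T V(1) Vt f[OF that]])
  have rS: "restr \<O> ?T V ?S \<in> carrier (sections \<O> V)" by (rule restr_closed[OF T V(1) Vt S])
  have rfs: "restr \<O> ?T V ?S = finsum (sections \<O> V) (\<lambda>j. restr \<O> ?T V (f j)) J"
    by (rule restr_finsum[OF T V(1) Vt _ J]) (rule f)
  have Su: "restr \<O> ?T V ?S \<odot>\<^bsub>sections \<F> V\<^esub> u \<in> F_carrier V" by (rule smult_F_closed[OF V(1) rS u])
  have "(\<lambda>c a. \<Sum>j\<in>J. D V (restr \<O> ?T V (f j) \<odot>\<^bsub>sections \<F> V\<^esub> u) c a) = D V (restr \<O> ?T V ?S \<odot>\<^bsub>sections \<F> V\<^esub> u)"
    unfolding rfs using hom_on_finsum_smult[OF hom V u J, of "\<lambda>j. restr \<O> ?T V (f j)"] rf by simp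
  also have "\<dots> = D V u"
  proof (intro ext)
    fix c a
    show "D V (restr \<O> ?T V ?S \<odot>\<^bsub>sections \<F> V\<^esub> u) c a = D V u c a"
    proof (cases "a \<in> K \<and> a \<in> V")
      case True
      then obtain N where N: "openin X N" "a \<in> N" "restr \<O> ?T N ?S = \<one>\<^bsub>sections \<O> N\<^esub>" using one by blast
      let ?W = "V \<inter> N"
      have W: "openin X ?W" using V N by blast
      interpret W: module "sections \<O> ?W" "sections \<F> ?W" by (rule module_F[OF W])
      have "restr \<O> V ?W (restr \<O> ?T V ?S) = restr \<O> N ?W (restr \<O> ?T N ?S)"
        using restr_restr[OF T V(1) W Int_lower1 Vt S] restr_restr[OF T N(1) W Int_lower2 openin_subset[OF N(1)] S] by simp
      also have "\<dots> = \<one>\<^bsub>sections \<O> ?W\<^esub>" unfolding N(3) by (rule restr_one[OF N(1) W Int_lower2])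
      finally have "restr \<F> V ?W (restr \<O> ?T V ?S \<odot>\<^bsub>sections \<F> V\<^esub> u) = restr \<F> V ?W u"
        unfolding restr_F_smult[OF V(1) W Int_lower1 rS u]
        using W.smult_one[OF restr_F_closed[OF V(1) W Int_lower1 u]] by simp
      then show ?thesis using hom_on_local_eq[OF hom V Su u W Int_lower1] True N(2) by blast
    next
      case False
      have "D V w c a = 0" if "w \<in> F_carrier V" for w
        using False diff_opD(5)[OF D V that, of c a] densities_onD(2)[OF hom_onD(1)[OF hom V that], of a c] by blast
      then show ?thesis using Su u by simp
    qed
  qed
  finally show ?thesis .
qed


section \<open>The cosheaf property\<close>

abbreviation G :: "('m, 'f \<Rightarrow> complex) precosheaf" where
  "G \<equiv> Dc_infty X \<O> \<F>"

abbreviation Dc :: "'m set \<Rightarrow> ('f \<Rightarrow> complex) set" where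
  "Dc U \<equiv> carrier (cosections G U)"

abbreviation rho_F :: "'m set \<Rightarrow> ('m set \<Rightarrow> 'f \<Rightarrow> 'm chart \<Rightarrow> 'm \<Rightarrow> complex) \<Rightarrow> 'f \<Rightarrow> complex" where
  "rho_F \<equiv> rho X \<O> \<F>"

lemma Dc_simps:
  "\<zero>\<^bsub>cosections G U\<^esub> = (\<lambda>u. 0)"
  "\<eta> \<oplus>\<^bsub>cosections G U\<^esub> \<theta> = (\<lambda>u. \<eta> u + \<theta> u)"
  "z \<odot>\<^bsub>cosections G U\<^esub> \<eta> = (\<lambda>u. z * \<eta> u)"
  "ext G U V \<eta> = (\<lambda>u. if u \<in> F_carrier U then \<eta> (restr \<F> U V u) else 0)"
  by (simp_all add: Dc_infty_def)

lemma Dc_iff: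
  assumes U: "openin X U"
  shows "\<eta> \<in> Dc U \<longleftrightarrow> (\<exists>K D. diff_op U K D \<and> \<eta> = rho_F U D)"
proof -
  have "Dc U = rho_F U ` Diff_c (subtopology X U) \<O> \<F> (densities X \<O>)" by (simp add: Dc_infty_def)
  also have "Diff_c (subtopology X U) \<O> \<F> (densities X \<O>) = {D. \<exists>K. diff_op U K D}"
    using Diff_c_iff[OF U] by blast
  finally show ?thesis by blast
qed

lemma Dc_outside: "\<eta> \<in> Dc U \<Longrightarrow> u \<notin> F_carrier U \<Longrightarrow> \<eta> u = 0"
  by (auto simp: Dc_infty_def rho_def)

lemma rho_add:
  assumes U: "openin X U" and D: "diff_op U K D" and E: "diff_op U L E"
  shows "rho_F U (\<lambda>V u c a. D V u c a + E V u c a) = (\<lambda>u. rho_F U D u + rho_F U E u)"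
  using density_integral_add[OF U diff_op_compact_density[OF U D] diff_op_compact_density[OF U E]]
  by (auto simp: rho_def fun_eq_iff)

lemma rho_scale:
  assumes U: "openin X U" and D: "diff_op U K D"
  shows "rho_F U (\<lambda>V u c a. z * D V u c a) = (\<lambda>u. z * rho_F U D u)"
  using density_integral_scale[OF U diff_op_compact_density[OF U D]] by (auto simp: rho_def fun_eq_iff)

lemma Dc_zero:
  assumes U: "openin X U"
  shows "(\<lambda>u. 0) \<in> Dc U"
proof -
  have "rho_F U (\<lambda>V u c a. 0) = (\<lambda>u. 0)" by (simp add: rho_def density_integral_zero fun_eq_iff)
  then show ?thesis unfolding Dc_iff[OF U] using diff_op_zero[OF U] by metis
qed

lemma Dc_add:
  assumes U: "openin X U" and \<eta>: "\<eta> \<in> Dc U" "\<theta> \<in> Dc U"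
  shows "(\<lambda>u. \<eta> u + \<theta> u) \<in> Dc U"
proof -
  obtain K D L E where D: "diff_op U K D" "\<eta> = rho_F U D" and E: "diff_op U L E" "\<theta> = rho_F U E"
    using \<eta> unfolding Dc_iff[OF U] by blast
  show ?thesis
    unfolding Dc_iff[OF U] D(2) E(2)
    by (intro exI conjI) (rule diff_op_add[OF U D(1) E(1)], rule rho_add[OF U D(1) E(1), symmetric])
qed

lemma Dc_scale:
  assumes U: "openin X U" and \<eta>: "\<eta> \<in> Dc U"
  shows "(\<lambda>u. z * \<eta> u) \<in> Dc U"
proof -
  obtain K D where D: "diff_op U K D" "\<eta> = rho_F U D" using \<eta> unfolding Dc_iff[OF U] by blast
  show ?thesis
    unfolding Dc_iff[OF U] D(2)
    by (intro exI conjI) (rule diff_op_scale[OF U D(1)], rule rho_scale[OF U D(1), symmetric])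
qed

lemma Dc_abelian_group:
  assumes U: "openin X U"
  shows "abelian_group (cosections G U)"
proof (rule abelian_groupI)
  fix x assume x: "x \<in> Dc U"
  show "\<exists>y\<in>Dc U. y \<oplus>\<^bsub>cosections G U\<^esub> x = \<zero>\<^bsub>cosections G U\<^esub>"
    using Dc_scale[OF U x, of "-1"] by (intro bexI[of _ "\<lambda>u. (-1) * x u"]) (auto simp: Dc_simps)
qed (auto simp: Dc_simps ac_simps intro: Dc_add[OF U] Dc_zero[OF U])

lemma Dc_module:
  assumes U: "openin X U"
  shows "Module.module complex_field (cosections G U)"
  by (rule moduleI[OF cring_complex_field Dc_abelian_group[OF U]])
    (auto simp: Dc_simps complex_field_def algebra_simps fun_eq_iff intro: Dc_scale[OF U])

lemma Dc_minus:
  assumes U: "openin X U" and x: "x \<in> Dc U" "y \<in> Dc U"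
  shows "x \<ominus>\<^bsub>cosections G U\<^esub> y = (\<lambda>u. x u - y u)"
proof -
  interpret abelian_group "cosections G U" by (rule Dc_abelian_group[OF U])
  have "\<ominus>\<^bsub>cosections G U\<^esub> y = (\<lambda>u. (-1) * y u)"
    by (rule minus_equality) (use x Dc_scale[OF U x(2), of "-1"] in \<open>auto simp: Dc_simps\<close>)
  then show ?thesis by (simp add: a_minus_def Dc_simps)
qed

lemma Dc_finsum:
  assumes U: "openin X U" and S: "finite S" and g: "\<And>i. i \<in> S \<Longrightarrow> g i \<in> Dc U"
  shows "finsum (cosections G U) g S = (\<lambda>u. \<Sum>i\<in>S. g i u)" "(\<lambda>u. \<Sum>i\<in>S. g i u) \<in> Dc U"
proof -
  interpret abelian_group "cosections G U" by (rule Dc_abelian_group[OF U])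
  show 1: "finsum (cosections G U) g S = (\<lambda>u. \<Sum>i\<in>S. g i u)"
    using S g
  proof (induction S)
    case (insert i S)
    have c: "g \<in> S \<rightarrow> Dc U" "g i \<in> Dc U" using insert.prems by auto
    then show ?case using finsum_insert[OF insert(1,2) c] insert by (simp add: Dc_simps)
  qed (simp add: Dc_simps)
  show "(\<lambda>u. \<Sum>i\<in>S. g i u) \<in> Dc U" unfolding 1[symmetric] using g by (intro finsum_closed) auto
qed

text \<open>The functional is represented by the extended operator: over \<open>U\<close> that
  operator produces the density of \<open>D\<close> on the restricted section, already extended by
  zero, and the integral does not refer to the open set.\<close>

lemma ext_Dc:
  assumes U: "openin X U" and V: "openin X V" "V \<subseteq> U" and \<eta>: "\<eta> \<in> Dc V"
  shows "ext G U V \<eta> \<in> Dc U"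
proof -
  obtain K D where D: "diff_op V K D" "\<eta> = rho_F V D" using \<eta> unfolding Dc_iff[OF V(1)] by blast
  have "ext G U V \<eta> = rho_F U (\<lambda>W u. D (W \<inter> V) (restr \<F> W (W \<inter> V) u))"
    using V restr_F_closed[OF U V] by (auto simp: Dc_simps D(2) rho_def fun_eq_iff Int_absorb1)
  then show ?thesis unfolding Dc_iff[OF U] using diff_op_extend[OF V U D(1)] by blast
qed

lemma precosheaf: "precosheaf_on X G"
  unfolding precosheaf_on_def
proof (intro conjI allI impI ballI)
  fix U assume "openin X U"
  then show "Module.module complex_field (cosections G U)" by (rule Dc_module)
next
  fix U V assume "openin X U \<and> openin X V \<and> V \<subseteq> U"
  then have o: "openin X U" "openin X V" "V \<subseteq> U" by auto
  show "ext G U V \<in> Dc V \<rightarrow> Dc U" using ext_Dc[OF o] by blast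
  show "ext G U V (\<eta> \<oplus>\<^bsub>cosections G V\<^esub> \<theta>) = ext G U V \<eta> \<oplus>\<^bsub>cosections G U\<^esub> ext G U V \<theta>" for \<eta> \<theta>
    by (auto simp: Dc_simps)
  show "ext G U V (c \<odot>\<^bsub>cosections G V\<^esub> \<eta>) = c \<odot>\<^bsub>cosections G U\<^esub> ext G U V \<eta>" for c \<eta>
    by (auto simp: Dc_simps)
next
  fix U \<eta> assume "openin X U \<and> \<eta> \<in> Dc U"
  \<comment> \<open>Off the sections over \<open>U\<close> the extension is 0 by definition, and
    functionals in \<open>Dc U\<close> vanish there too.\<close>
  then show "ext G U U \<eta> = \<eta>" using Dc_outside restr_F_self by (auto simp: Dc_simps fun_eq_iff)
next
  fix U V W \<eta> assume "openin X U \<and> openin X V \<and> openin X W \<and> W \<subseteq> V \<and> V \<subseteq> U \<and> \<eta> \<in> Dc W"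
  then show "ext G U V (ext G V W \<eta>) = ext G U W \<eta>"
    using restr_F_closed restr_F_restr by (auto simp: Dc_simps fun_eq_iff)
qed

text \<open>Both claims go through one induction, because additivity of the integral requires the
  partial sum to be a compactly supported density.\<close>

lemma density_integral_sum:
  assumes U: "openin X U" and K: "compactin X K" "K \<subseteq> U" and J: "finite J"
    and \<mu>: "\<And>j. j \<in> J \<Longrightarrow> compact_density U K (\<mu> j)"
  shows "compact_density U K (\<lambda>c a. \<Sum>j\<in>J. \<mu> j c a) \<and>
    density_integral X \<O> (\<lambda>c a. \<Sum>j\<in>J. \<mu> j c a) = (\<Sum>j\<in>J. density_integral X \<O> (\<mu> j))"
  using J \<mu>
proof (induction J)
  case empty
  then show ?case
    using K densities_on_zero[OF U] by (simp add: compact_density_def density_integral_zero)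
next
  case (insert j J)
  have 1: "compact_density U K (\<mu> j)" and 2: "compact_density U K (\<lambda>c a. \<Sum>j\<in>J. \<mu> j c a)"
    and 3: "density_integral X \<O> (\<lambda>c a. \<Sum>j\<in>J. \<mu> j c a) = (\<Sum>j\<in>J. density_integral X \<O> (\<mu> j))"
    using insert by auto
  have "compact_density U K (\<lambda>c a. \<mu> j c a + (\<Sum>j\<in>J. \<mu> j c a))"
    unfolding compact_density_def
  proof (intro conjI K allI impI)
    show "(\<lambda>c a. \<mu> j c a + (\<Sum>j\<in>J. \<mu> j c a)) \<in> densities_on X \<O> U"
      using 1 2 unfolding compact_density_def by (intro densities_on_add[OF U]) auto
    fix c a assume "\<mu> j c a + (\<Sum>j\<in>J. \<mu> j c a) \<noteq> 0"
    then have "\<mu> j c a \<noteq> 0 \<or> (\<Sum>j\<in>J. \<mu> j c a) \<noteq> 0" by auto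
    then show "a \<in> K" using 1 2 unfolding compact_density_def by meson
  qed
  then show ?case using density_integral_add[OF U 1 2] 3 insert(1,2) by simp
qed

text \<open>This is \<open>hom_on_partition\<close> under the integral. It recovers a functional as
  the sum of its products with the members of a partition of unity.\<close>

lemma rho_partition:
  assumes A: "openin X A" and D: "diff_op A K D" and J: "finite J"
    and f: "\<And>j. j \<in> J \<Longrightarrow> f j \<in> carrier (sections \<O> (topspace X))"
    and one: "\<And>a. a \<in> K \<Longrightarrow> \<exists>N. openin X N \<and> a \<in> N \<and>
       restr \<O> (topspace X) N (finsum (sections \<O> (topspace X)) f J) = \<one>\<^bsub>sections \<O> N\<^esub>"
    and u: "u \<in> F_carrier A"
  shows "(\<Sum>j\<in>J. rho_F A D (restr \<O> (topspace X) A (f j) \<odot>\<^bsub>sections \<F> A\<^esub> u)) = rho_F A D u"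
proof -
  let ?w = "\<lambda>j. restr \<O> (topspace X) A (f j) \<odot>\<^bsub>sections \<F> A\<^esub> u"
  have w: "?w j \<in> F_carrier A" if "j \<in> J" for j
    using smult_F_closed[OF A restr_closed[OF _ A openin_subset[OF A] f[OF that]] u] by simp
  have "(\<Sum>j\<in>J. density_integral X \<O> (D A (?w j))) = density_integral X \<O> (\<lambda>c a. \<Sum>j\<in>J. D A (?w j) c a)"
    using density_integral_sum[OF A diff_opD(3,4)[OF D] J, of "\<lambda>j. D A (?w j)"] diff_op_compact_density[OF A D w] by simp
  also have "(\<lambda>c a. \<Sum>j\<in>J. D A (?w j) c a) = D A u"
    by (rule hom_on_partition[OF D J f one A subset_refl u])
  finally show ?thesis using w u by (simp add: rho_def)
qed

text \<open>A value at a point off \<open>L\<close> can be computed after restriction to the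
  complement of \<open>L\<close>, where the section f v is zero.\<close>

lemma compose_support:
  assumes D: "diff_op A K D" and f: "f \<in> carrier (sections \<O> (topspace X))"
    and L: "compactin X L" "restr \<O> (topspace X) (topspace X - L) f = \<zero>\<^bsub>sections \<O> (topspace X - L)\<^esub>"
    and V: "openin X V" "V \<subseteq> A" and v: "v \<in> F_carrier V"
    and nz: "D V (restr \<O> (topspace X) V f \<odot>\<^bsub>sections \<F> V\<^esub> v) c a \<noteq> 0"
  shows "a \<in> K \<inter> L"
proof -
  note hom = diff_opD(1)[OF D]
  have w: "restr \<O> (topspace X) V f \<odot>\<^bsub>sections \<F> V\<^esub> v \<in> F_carrier V"
    using smult_F_closed[OF V(1) restr_closed[OF _ V(1) openin_subset[OF V(1)] f] v] by simp
  have aV: "a \<in> V" using densities_onD(2)[OF hom_onD(1)[OF hom V w], of a c] nz by blast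
  have "a \<in> L"
  proof (rule ccontr)
    assume aL: "a \<notin> L"
    have o: "openin X (V - L)" using V(1) compactin_imp_closedin[OF Hausdorff L(1)] by blast
    have "D (V - L) \<zero>\<^bsub>sections \<F> (V - L)\<^esub> = (\<lambda>c a. 0)"
      by (rule hom_on_zero[OF hom o]) (use V in blast)
    then have "(if a \<in> V - L then D V (restr \<O> (topspace X) V f \<odot>\<^bsub>sections \<F> V\<^esub> v) c a else 0) = 0"
      using fun_cong[OF fun_cong[OF hom_onD(4)[OF hom V(1) o Diff_subset V(2) w], of c], of a]
        smult_vanishing[OF V(1) v f L] by simp
    then show False using aV aL nz by simp
  qed
  moreover have "a \<in> K" by (rule diff_opD(5)[OF D V w nz])
  ultimately show ?thesis by blast
qed

text \<open>\<open>\<zeta>\<close> is the functional \<open>u \<mapsto> \<eta> (f u)\<close>, moved to an open set that contains its support; \<open>\<eta>\<close> is \<open>\<rho>(D)\<close>.\<close>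

lemma cut_functional:
  assumes A: "openin X A" and B: "openin X B" "B \<subseteq> A" and D: "diff_op A K D"
    and f: "f \<in> carrier (sections \<O> (topspace X))"
    and L: "compactin X L" "restr \<O> (topspace X) (topspace X - L) f = \<zero>\<^bsub>sections \<O> (topspace X - L)\<^esub>"
    and KL: "K \<inter> L \<subseteq> B"
  shows "\<exists>\<zeta>\<in>Dc B. (\<forall>v\<in>F_carrier B. \<zeta> v = density_integral X \<O> (D B (restr \<O> (topspace X) B f \<odot>\<^bsub>sections \<F> B\<^esub> v))) \<and>
    (\<forall>u\<in>F_carrier A. \<zeta> (restr \<F> A B u) = rho_F A D (restr \<O> (topspace X) A f \<odot>\<^bsub>sections \<F> A\<^esub> u))"
proof -
  let ?T = "topspace X"
  have T: "openin X ?T" by simp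
  have At: "A \<subseteq> ?T" using openin_subset[OF A] .
  have fA: "restr \<O> ?T A f \<in> carrier (sections \<O> A)" by (rule restr_closed[OF T A At f])
  define E where "E V u = D V (restr \<O> A V (restr \<O> ?T A f) \<odot>\<^bsub>sections \<F> V\<^esub> u)" for V u
  have rr: "restr \<O> A V (restr \<O> ?T A f) = restr \<O> ?T V f" if "openin X V" "V \<subseteq> A" for V
    by (rule restr_restr[OF T A that At f])
  have "diff_op A K E" unfolding E_def[abs_def] by (rule diff_op_compose[OF A D fA])
  moreover have "compactin X (K \<inter> L)"
    by (rule closed_Int_compactin[OF compactin_imp_closedin[OF Hausdorff diff_opD(3)[OF D]] L(1)])
  moreover have "K \<inter> L \<subseteq> A" using KL B by blast
  ultimately have "diff_op A (K \<inter> L) E"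
  proof (rule diff_op_support)
    fix V u c a assume V: "openin X V" "V \<subseteq> A" "u \<in> F_carrier V" and nz: "E V u c a \<noteq> 0"
    show "a \<in> K \<inter> L"
      by (rule compose_support[OF D f L V]) (use nz in \<open>simp add: E_def rr[OF V(1,2)]\<close>)
  qed
  from diff_op_restrict[OF this B KL] have "rho_F B E \<in> Dc B" unfolding Dc_iff[OF B(1)] by blast
  \<comment> \<open>A formula on all sections over \<open>B\<close>, not only on those that come
    from \<open>A\<close>. In the proof of exactness the argument is a restriction from another
    member of the cover.\<close>
  moreover have val: "rho_F B E v = density_integral X \<O> (D B (restr \<O> ?T B f \<odot>\<^bsub>sections \<F> B\<^esub> v))" if "v \<in> F_carrier B" for v
    using that by (simp add: rho_def E_def rr[OF B])
  moreover have "rho_F B E (restr \<F> A B u) = rho_F A D (restr \<O> ?T A f \<odot>\<^bsub>sections \<F> A\<^esub> u)" if u: "u \<in> F_carrier A" for u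
  proof -
    let ?w = "restr \<O> ?T A f \<odot>\<^bsub>sections \<F> A\<^esub> u"
    have w: "?w \<in> F_carrier A" by (rule smult_F_closed[OF A fA u])
    have "restr \<O> ?T B f \<odot>\<^bsub>sections \<F> B\<^esub> restr \<F> A B u = restr \<F> A B ?w"
      using restr_F_smult[OF A B fA u] rr[OF B] by simp
    then have "D B (restr \<O> ?T B f \<odot>\<^bsub>sections \<F> B\<^esub> restr \<F> A B u) = (\<lambda>c a. if a \<in> B then D A ?w c a else 0)"
      using hom_onD(4)[OF diff_opD(1)[OF D] A B subset_refl w] by simp
    \<comment> \<open>Restriction to \<open>B\<close> loses nothing, since the density vanishes off
      the intersection of \<open>K\<close> and \<open>L\<close>, which is contained in
      \<open>B\<close>.\<close>
    also have "\<dots> = D A ?w"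
      using compose_support[OF D f L A subset_refl u] KL by (intro ext) auto
    finally show ?thesis using val[OF restr_F_closed[OF A B u]] w by (simp add: rho_def)
  qed
  ultimately show ?thesis by (intro bexI[of _ "rho_F B E"]) auto
qed

lemma restr_F_zero:
  assumes "openin X U" "openin X V" "V \<subseteq> U"
  shows "restr \<F> U V \<zero>\<^bsub>sections \<F> U\<^esub> = \<zero>\<^bsub>sections \<F> V\<^esub>"
proof -
  interpret U: abelian_group "sections \<F> U" by (rule abelian_group_F[OF assms(1)])
  interpret V: abelian_group "sections \<F> V" by (rule abelian_group_F[OF assms(2)])
  have "restr \<F> U V (\<zero>\<^bsub>sections \<F> U\<^esub> \<oplus>\<^bsub>sections \<F> U\<^esub> \<zero>\<^bsub>sections \<F> U\<^esub>) =
    restr \<F> U V \<zero>\<^bsub>sections \<F> U\<^esub> \<oplus>\<^bsub>sections \<F> V\<^esub> restr \<F> U V \<zero>\<^bsub>sections \<F> U\<^esub>"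
    by (rule restr_F_add[OF assms]) auto
  then show ?thesis
    using restr_F_closed[OF assms U.zero_closed] by (simp add: V.add.r_cancel_one')
qed

text \<open>The section f v is zero on \<open>B\<close> minus \<open>L\<close>, so it glues with the
  zero section on \<open>U\<close> minus \<open>L\<close>. Only the sheaf axiom of \<F> for two sets
  enters, together with closedness of \<open>L\<close>.\<close>

lemma extend_section:
  assumes U: "openin X U" and B: "openin X B" "B \<subseteq> U" and f: "f \<in> carrier (sections \<O> (topspace X))"
    and L: "compactin X L" "restr \<O> (topspace X) (topspace X - L) f = \<zero>\<^bsub>sections \<O> (topspace X - L)\<^esub>" "L \<subseteq> B"
    and v: "v \<in> F_carrier B"
  shows "\<exists>w\<in>F_carrier U. restr \<F> U B w = restr \<O> (topspace X) B f \<odot>\<^bsub>sections \<F> B\<^esub> v \<and>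
    restr \<F> U (U - L) w = \<zero>\<^bsub>sections \<F> (U - L)\<^esub>"
proof -
  have o: "openin X (U - L)" using U compactin_imp_closedin[OF Hausdorff L(1)] by blast
  have BL: "B \<inter> (U - L) = B - L" "B \<union> (U - L) = U" using B L by auto
  have BU: "B - L \<subseteq> U - L" using B(2) by blast
  have oB: "openin X (B - L)" using B(1) compactin_imp_closedin[OF Hausdorff L(1)] by blast
  have w: "restr \<O> (topspace X) B f \<odot>\<^bsub>sections \<F> B\<^esub> v \<in> F_carrier B"
    using smult_F_closed[OF B(1) restr_closed[OF _ B(1) openin_subset[OF B(1)] f] v] by simp
  have "restr \<F> B (B \<inter> (U - L)) (restr \<O> (topspace X) B f \<odot>\<^bsub>sections \<F> B\<^esub> v) =
    restr \<F> (U - L) (B \<inter> (U - L)) \<zero>\<^bsub>sections \<F> (U - L)\<^esub>"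
    unfolding BL smult_vanishing[OF B(1) v f L(1,2)] by (rule restr_F_zero[OF o oB BU, symmetric])
  from sheaf_glue_two[OF sheaf_F B(1) o w zero_F_closed[OF o] this] show ?thesis unfolding BL .
qed

section \<open>Exactness of the cosheaf sequence\<close>

text \<open>\<open>cosheaf_sum\<close> runs over exactly the nonzero components. Allowing any finite
  set that contains them makes sums coming from different families comparable.\<close>

lemma cosheaf_sum_eq:
  assumes U: "openin X U" and A: "\<And>i. i \<in> I \<Longrightarrow> openin X (A i) \<and> A i \<subseteq> U"
    and \<eta>: "\<eta> \<in> direct_sum I (\<lambda>i. cosections G (A i))"
    and S: "finite S" "S \<subseteq> I" "{i \<in> I. \<eta> i \<noteq> (\<lambda>u. 0)} \<subseteq> S"
  shows "cosheaf_sum G I A U \<eta> = (\<lambda>u. if u \<in> F_carrier U then \<Sum>i\<in>S. \<eta> i (restr \<F> U (A i) u) else 0)"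
    "cosheaf_sum G I A U \<eta> \<in> Dc U"
proof -
  let ?S = "{i \<in> I. \<eta> i \<noteq> (\<lambda>u. 0)}"
  have fin: "finite ?S" by (rule finite_subset[OF S(3,1)])
  have e: "ext G U (A i) (\<eta> i) \<in> Dc U" if "i \<in> ?S" for i
    using ext_Dc[OF U, of "A i" "\<eta> i"] A[of i] \<eta> that by (auto simp: direct_sum_def)
  have eq: "cosheaf_sum G I A U \<eta> = (\<lambda>u. \<Sum>i\<in>?S. ext G U (A i) (\<eta> i) u)"
    unfolding cosheaf_sum_def Dc_simps(1) by (rule Dc_finsum(1)[OF U fin e])
  show "cosheaf_sum G I A U \<eta> \<in> Dc U" unfolding eq by (rule Dc_finsum(2)[OF U fin e])
  show "cosheaf_sum G I A U \<eta> = (\<lambda>u. if u \<in> F_carrier U then \<Sum>i\<in>S. \<eta> i (restr \<F> U (A i) u) else 0)"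
  proof
    fix u
    have "(\<Sum>i\<in>?S. ext G U (A i) (\<eta> i) u) = (\<Sum>i\<in>S. ext G U (A i) (\<eta> i) u)"
      by (rule sum.mono_neutral_left[OF S(1,3)]) (use S(2) in \<open>auto simp: Dc_simps\<close>)
    then show "cosheaf_sum G I A U \<eta> u = (if u \<in> F_carrier U then \<Sum>i\<in>S. \<eta> i (restr \<F> U (A i) u) else 0)"
      unfolding eq by (simp add: Dc_simps)
  qed
qed

lemma cosheaf_diff_eq:
  assumes A: "\<And>i. i \<in> I \<Longrightarrow> openin X (A i)"
    and \<zeta>: "\<zeta> \<in> direct_sum (I \<times> I) (\<lambda>(i, j). cosections G (A i \<inter> A j))"
    and S: "finite S" "S \<subseteq> I" "{p \<in> I \<times> I. \<zeta> p \<noteq> (\<lambda>u. 0)} \<subseteq> S \<times> S" and k: "k \<in> I"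
  shows "cosheaf_diff G I A \<zeta> k = (\<lambda>u. if u \<in> F_carrier (A k) then
      (\<Sum>j\<in>S. \<zeta> (k, j) (restr \<F> (A k) (A k \<inter> A j) u)) - (\<Sum>i\<in>S. \<zeta> (i, k) (restr \<F> (A k) (A i \<inter> A k) u)) else 0)"
    "cosheaf_diff G I A \<zeta> k \<in> Dc (A k)"
proof -
  have z: "\<zeta> (i, j) \<in> Dc (A i \<inter> A j)" if "i \<in> I" "j \<in> I" for i j
    using \<zeta> that by (auto simp: direct_sum_def PiE_iff)
  let ?S1 = "{j \<in> I. \<zeta> (k, j) \<noteq> (\<lambda>u. 0)}" and ?S2 = "{i \<in> I. \<zeta> (i, k) \<noteq> (\<lambda>u. 0)}"
  have S12: "?S1 \<subseteq> S" "?S2 \<subseteq> S" using S(3) k by auto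
  then have fin: "finite ?S1" "finite ?S2" using S(1) finite_subset by blast+
  have o: "openin X (A i \<inter> A j)" if "i \<in> I" "j \<in> I" for i j using A that by blast
  have e1: "ext G (A k) (A k \<inter> A j) (\<zeta> (k, j)) \<in> Dc (A k)" if "j \<in> ?S1" for j
    using ext_Dc[OF A[OF k] o[OF k] Int_lower1 z[OF k]] that by blast
  have e2: "ext G (A k) (A i \<inter> A k) (\<zeta> (i, k)) \<in> Dc (A k)" if "i \<in> ?S2" for i
    using ext_Dc[OF A[OF k] o[OF _ k] Int_lower2 z[OF _ k]] that by blast
  have f1: "finsum (cosections G (A k)) (\<lambda>j. ext G (A k) (A k \<inter> A j) (\<zeta> (k, j))) ?S1 =
      (\<lambda>u. \<Sum>j\<in>?S1. ext G (A k) (A k \<inter> A j) (\<zeta> (k, j)) u)"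
    "(\<lambda>u. \<Sum>j\<in>?S1. ext G (A k) (A k \<inter> A j) (\<zeta> (k, j)) u) \<in> Dc (A k)"
    by (rule Dc_finsum(1)[OF A[OF k] fin(1)], erule e1) (rule Dc_finsum(2)[OF A[OF k] fin(1)], erule e1)
  have f2: "finsum (cosections G (A k)) (\<lambda>i. ext G (A k) (A i \<inter> A k) (\<zeta> (i, k))) ?S2 =
      (\<lambda>u. \<Sum>i\<in>?S2. ext G (A k) (A i \<inter> A k) (\<zeta> (i, k)) u)"
    "(\<lambda>u. \<Sum>i\<in>?S2. ext G (A k) (A i \<inter> A k) (\<zeta> (i, k)) u) \<in> Dc (A k)"
    by (rule Dc_finsum(1)[OF A[OF k] fin(2)], erule e2) (rule Dc_finsum(2)[OF A[OF k] fin(2)], erule e2)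
  have eq: "cosheaf_diff G I A \<zeta> k = (\<lambda>u. (\<Sum>j\<in>?S1. ext G (A k) (A k \<inter> A j) (\<zeta> (k, j)) u) -
      (\<Sum>i\<in>?S2. ext G (A k) (A i \<inter> A k) (\<zeta> (i, k)) u))"
    unfolding cosheaf_diff_def Dc_simps(1) restrict_apply'[OF k] f1(1) f2(1)
    by (rule Dc_minus[OF A[OF k] f1(2) f2(2)])
  show "cosheaf_diff G I A \<zeta> k \<in> Dc (A k)"
  proof -
    have "(\<lambda>u. (\<Sum>j\<in>?S1. ext G (A k) (A k \<inter> A j) (\<zeta> (k, j)) u) +
      (-1) * (\<Sum>i\<in>?S2. ext G (A k) (A i \<inter> A k) (\<zeta> (i, k)) u)) \<in> Dc (A k)"
      by (rule Dc_add[OF A[OF k] f1(2) Dc_scale[OF A[OF k] f2(2)]])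
    then show ?thesis unfolding eq by simp
  qed
  show "cosheaf_diff G I A \<zeta> k = (\<lambda>u. if u \<in> F_carrier (A k) then
      (\<Sum>j\<in>S. \<zeta> (k, j) (restr \<F> (A k) (A k \<inter> A j) u)) - (\<Sum>i\<in>S. \<zeta> (i, k) (restr \<F> (A k) (A i \<inter> A k) u)) else 0)"
  proof
    fix u
    have 1: "(\<Sum>j\<in>?S1. ext G (A k) (A k \<inter> A j) (\<zeta> (k, j)) u) = (\<Sum>j\<in>S. ext G (A k) (A k \<inter> A j) (\<zeta> (k, j)) u)"
      by (rule sum.mono_neutral_left[OF S(1) S12(1)]) (use S(2) in \<open>auto simp: Dc_simps\<close>)
    have 2: "(\<Sum>i\<in>?S2. ext G (A k) (A i \<inter> A k) (\<zeta> (i, k)) u) = (\<Sum>i\<in>S. ext G (A k) (A i \<inter> A k) (\<zeta> (i, k)) u)"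
      by (rule sum.mono_neutral_left[OF S(1) S12(2)]) (use S(2) in \<open>auto simp: Dc_simps\<close>)
    show "cosheaf_diff G I A \<zeta> k u = (if u \<in> F_carrier (A k) then
      (\<Sum>j\<in>S. \<zeta> (k, j) (restr \<F> (A k) (A k \<inter> A j) u)) - (\<Sum>i\<in>S. \<zeta> (i, k) (restr \<F> (A k) (A i \<inter> A k) u)) else 0)"
      unfolding eq 1 2 by (simp add: Dc_simps)
  qed
qed

text \<open>The component at \<open>i\<close> is \<eta> multiplied by the member \<open>f i\<close>
  of a partition of unity near the support of one representing operator; indices outside
  \<open>J\<close> get the zero functional.\<close>

lemma cosheaf_surjective:
  assumes A: "\<And>i. i \<in> I \<Longrightarrow> openin X (A i)" and U: "openin X U" "(\<Union>i\<in>I. A i) = U"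
    and \<eta>: "\<eta> \<in> Dc U"
  shows "\<exists>\<theta>\<in>direct_sum I (\<lambda>i. cosections G (A i)). cosheaf_sum G I A U \<theta> = \<eta>"
proof -
  let ?T = "topspace X"
  obtain K D where D: "diff_op U K D" "\<eta> = rho_F U D" using \<eta> unfolding Dc_iff[OF U(1)] by blast
  have KU: "K \<subseteq> (\<Union>i\<in>I. A i)" using diff_opD(4)[OF D(1)] U(2) by simp
  obtain f L J where J: "finite J" "J \<subseteq> I" and f: "\<And>j. j \<in> J \<Longrightarrow> f j \<in> carrier (sections \<O> ?T)"
    and L: "\<And>j. j \<in> J \<Longrightarrow> compactin X (L j)" "\<And>j. j \<in> J \<Longrightarrow> L j \<subseteq> A j"
    and f0: "\<And>j. j \<in> J \<Longrightarrow> restr \<O> ?T (?T - L j) (f j) = \<zero>\<^bsub>sections \<O> (?T - L j)\<^esub>"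
    and one: "\<And>a. a \<in> K \<Longrightarrow> \<exists>N. openin X N \<and> a \<in> N \<and> restr \<O> ?T N (finsum (sections \<O> ?T) f J) = \<one>\<^bsub>sections \<O> N\<^esub>"
    by (rule sections_partition[OF diff_opD(3)[OF D(1)] KU]) (rule A, assumption, (rule that; assumption))
  have AU: "A i \<subseteq> U" if "i \<in> I" for i using U(2) that by blast
  define P where "P i \<zeta> \<longleftrightarrow> \<zeta> \<in> Dc (A i) \<and>
    (\<forall>u\<in>F_carrier U. \<zeta> (restr \<F> U (A i) u) = rho_F U D (restr \<O> ?T U (f i) \<odot>\<^bsub>sections \<F> U\<^esub> u))" for i \<zeta>
  have "\<exists>\<zeta>. P i \<zeta>" if i: "i \<in> J" for i
  proof -
    have iI: "i \<in> I" using i J by blast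
    have "K \<inter> L i \<subseteq> A i" using L(2)[OF i] by blast
    from cut_functional[OF U(1) A[OF iI] AU[OF iI] D(1) f[OF i] L(1)[OF i] f0[OF i] this]
    show ?thesis unfolding P_def by blast
  qed
  then obtain \<zeta> where \<zeta>: "\<And>i. i \<in> J \<Longrightarrow> P i (\<zeta> i)" by metis
  define \<theta> where "\<theta> = (\<lambda>i\<in>I. if i \<in> J then \<zeta> i else (\<lambda>u. 0))"
  have sub: "{i \<in> I. \<theta> i \<noteq> (\<lambda>u. 0)} \<subseteq> J" by (auto simp: \<theta>_def)
  have \<theta>: "\<theta> \<in> direct_sum I (\<lambda>i. cosections G (A i))"
    unfolding direct_sum_def Dc_simps(1)
    using \<zeta> Dc_zero[OF A] finite_subset[OF sub J(1)] by (auto simp: \<theta>_def P_def)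
  have "cosheaf_sum G I A U \<theta> = (\<lambda>u. if u \<in> F_carrier U then \<Sum>i\<in>J. \<theta> i (restr \<F> U (A i) u) else 0)"
    by (rule cosheaf_sum_eq(1)[OF U(1) _ \<theta> J sub]) (use A AU in blast)
  also have "\<dots> = \<eta>"
  proof
    fix u
    have "(\<Sum>i\<in>J. \<theta> i (restr \<F> U (A i) u)) = \<eta> u" if u: "u \<in> F_carrier U"
    proof -
      have "(\<Sum>i\<in>J. \<theta> i (restr \<F> U (A i) u)) = (\<Sum>i\<in>J. rho_F U D (restr \<O> ?T U (f i) \<odot>\<^bsub>sections \<F> U\<^esub> u))"
        by (rule sum.cong) (use \<zeta> u J(2) in \<open>auto simp: \<theta>_def P_def\<close>)
      also have "\<dots> = \<eta> u" unfolding D(2) by (rule rho_partition[OF U(1) D(1) J(1) f one u])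
      finally show ?thesis .
    qed
    then show "(if u \<in> F_carrier U then \<Sum>i\<in>J. \<theta> i (restr \<F> U (A i) u) else 0) = \<eta> u"
      using Dc_outside[OF \<eta>] by simp
  qed
  finally show ?thesis using \<theta> by blast
qed

text \<open>Extended to \<open>U\<close>, each \<open>\<zeta> (i, j)\<close> is evaluated on the
  restriction to the intersection of \<open>A i\<close> and \<open>A j\<close> twice, once through
  either set, with opposite signs.\<close>

lemma cosheaf_complex:
  assumes A: "\<And>i. i \<in> I \<Longrightarrow> openin X (A i)" and U: "openin X U" "(\<Union>i\<in>I. A i) = U"
    and \<zeta>: "\<zeta> \<in> direct_sum (I \<times> I) (\<lambda>(i, j). cosections G (A i \<inter> A j))"
  shows "cosheaf_diff G I A \<zeta> \<in> direct_sum I (\<lambda>i. cosections G (A i))"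
    "cosheaf_sum G I A U (cosheaf_diff G I A \<zeta>) = (\<lambda>u. 0)"
proof -
  let ?Z = "{p \<in> I \<times> I. \<zeta> p \<noteq> (\<lambda>u. 0)}"
  \<comment> \<open>Both coordinates of the nonzero pairs are collected, so that the two sums in the
    difference run over the same finite set and can be interchanged.\<close>
  define S where "S = fst ` ?Z \<union> snd ` ?Z"
  have "finite ?Z" using \<zeta> by (auto simp: direct_sum_def case_prod_unfold Dc_simps)
  then have S: "finite S" "S \<subseteq> I" "?Z \<subseteq> S \<times> S"
  proof -
    have "p \<in> S \<times> S" if "p \<in> ?Z" for p
      using imageI[OF that, of fst] imageI[OF that, of snd] unfolding S_def mem_Times_iff by blast
    then show "?Z \<subseteq> S \<times> S" by blast
  qed (auto simp: S_def)
  have z0: "\<zeta> (i, j) = (\<lambda>u. 0)" if "i \<in> I" "j \<in> I" "i \<notin> S \<or> j \<notin> S" for i j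
    using S(3) that by blast
  let ?d = "cosheaf_diff G I A \<zeta>"
  have eq: "?d k = (\<lambda>u. if u \<in> F_carrier (A k) then
      (\<Sum>j\<in>S. \<zeta> (k, j) (restr \<F> (A k) (A k \<inter> A j) u)) - (\<Sum>i\<in>S. \<zeta> (i, k) (restr \<F> (A k) (A i \<inter> A k) u)) else 0)"
    "?d k \<in> Dc (A k)" if "k \<in> I" for k
    by (rule cosheaf_diff_eq(1)[OF _ \<zeta> S that], erule A) (rule cosheaf_diff_eq(2)[OF _ \<zeta> S that], erule A)
  have sub: "{k \<in> I. ?d k \<noteq> (\<lambda>u. 0)} \<subseteq> S"
  proof (rule ccontr)
    assume "\<not> ?thesis"
    then obtain k where k: "k \<in> I" "k \<notin> S" "?d k \<noteq> (\<lambda>u. 0)" by blast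
    have "\<zeta> (k, j) = (\<lambda>u. 0)" "\<zeta> (j, k) = (\<lambda>u. 0)" if "j \<in> S" for j
      using z0[of k j] z0[of j k] k S(2) that by auto
    then have "?d k = (\<lambda>u. 0)" unfolding eq(1)[OF k(1)] by auto
    then show False using k(3) by blast
  qed
  have "?d \<in> extensional I" by (simp add: cosheaf_diff_def)
  then show d: "?d \<in> direct_sum I (\<lambda>i. cosections G (A i))"
    unfolding direct_sum_def Dc_simps(1) using eq(2) finite_subset[OF sub S(1)] by (auto simp: PiE_iff)
  have AU: "A i \<subseteq> U" if "i \<in> I" for i using U(2) that by blast
  have sum: "cosheaf_sum G I A U ?d = (\<lambda>u. if u \<in> F_carrier U then \<Sum>k\<in>S. ?d k (restr \<F> U (A k) u) else 0)"
    by (rule cosheaf_sum_eq(1)[OF U(1) _ d S(1,2) sub]) (use A AU in blast)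
  have "(\<Sum>k\<in>S. ?d k (restr \<F> U (A k) u)) = 0" if u: "u \<in> F_carrier U" for u
  proof -
    have "?d k (restr \<F> U (A k) u) = (\<Sum>j\<in>S. \<zeta> (k, j) (restr \<F> U (A k \<inter> A j) u)) - (\<Sum>i\<in>S. \<zeta> (i, k) (restr \<F> U (A i \<inter> A k) u))"
      if k: "k \<in> S" for k
    proof -
      have kI: "k \<in> I" using k S by blast
      have r: "restr \<F> (A k) W (restr \<F> U (A k) u) = restr \<F> U W u" if "openin X W" "W \<subseteq> A k" for W
        by (rule restr_F_restr[OF U(1) A[OF kI] that AU[OF kI] u])
      have r1: "restr \<F> (A k) (A k \<inter> A j) (restr \<F> U (A k) u) = restr \<F> U (A k \<inter> A j) u" if "j \<in> S" for j
        by (rule r) (use A kI that S(2) in auto)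
      have r2: "restr \<F> (A k) (A i \<inter> A k) (restr \<F> U (A k) u) = restr \<F> U (A i \<inter> A k) u" if "i \<in> S" for i
        by (rule r) (use A kI that S(2) in auto)
      show ?thesis
        unfolding eq(1)[OF kI] using restr_F_closed[OF U(1) A[OF kI] AU[OF kI] u] r1 r2 by simp
    qed
    then have "(\<Sum>k\<in>S. ?d k (restr \<F> U (A k) u)) =
      (\<Sum>k\<in>S. \<Sum>j\<in>S. \<zeta> (k, j) (restr \<F> U (A k \<inter> A j) u)) - (\<Sum>k\<in>S. \<Sum>i\<in>S. \<zeta> (i, k) (restr \<F> U (A i \<inter> A k) u))"
      by (simp add: sum_subtractf)
    also have "\<dots> = 0" by (subst sum.swap) simp
    finally show ?thesis .
  qed
  then show "cosheaf_sum G I A U ?d = (\<lambda>u. 0)" unfolding sum by auto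
qed

text \<open>
  The preimage is \<open>\<zeta>\<^sub>i\<^sub>j = f\<^sub>j \<eta>\<^sub>i\<close>. The sum over \<open>j\<close> restores \<open>\<eta>\<^sub>i\<close>. The sum over \<open>i\<close> vanishes:
  for a section \<open>v\<close> over \<open>A k\<close>, the section \<open>f\<^sub>k v\<close> extends by zero to a section \<open>w\<close> over \<open>U\<close>, so
  its value at \<open>v\<close> is the value of \<open>\<Sum>\<^sub>i \<eta>\<^sub>i = 0\<close> at \<open>w\<close>.
\<close>

lemma cosheaf_exact:
  assumes A: "\<And>i. i \<in> I \<Longrightarrow> openin X (A i)" and U: "openin X U" "(\<Union>i\<in>I. A i) = U"
    and \<eta>: "\<eta> \<in> direct_sum I (\<lambda>i. cosections G (A i))" and \<eta>0: "cosheaf_sum G I A U \<eta> = (\<lambda>u. 0)"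
  shows "\<exists>\<zeta>\<in>direct_sum (I \<times> I) (\<lambda>(i, j). cosections G (A i \<inter> A j)). cosheaf_diff G I A \<zeta> = \<eta>"
proof -
  let ?T = "topspace X"
  have AU: "A i \<subseteq> U" if "i \<in> I" for i using U(2) that by blast
  define H where "H = {i \<in> I. \<eta> i \<noteq> (\<lambda>u. 0)}"
  have H: "finite H" "H \<subseteq> I" "{i \<in> I. \<eta> i \<noteq> (\<lambda>u. 0)} \<subseteq> H" and \<eta>I: "\<And>i. i \<in> I \<Longrightarrow> \<eta> i \<in> Dc (A i)"
    and \<eta>ext: "\<eta> \<in> extensional I"
    using \<eta> by (auto simp: direct_sum_def H_def Dc_simps PiE_iff)
  have "\<exists>K D. diff_op (A i) K D \<and> \<eta> i = rho_F (A i) D" if "i \<in> I" for i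
    using \<eta>I[OF that] unfolding Dc_iff[OF A[OF that]] .
  then obtain K D where D: "\<And>i. i \<in> I \<Longrightarrow> diff_op (A i) (K i) (D i)" "\<And>i. i \<in> I \<Longrightarrow> \<eta> i = rho_F (A i) (D i)"
    by metis
  \<comment> \<open>Only finitely many components are nonzero, so one compact set carries the
    representing operators of all of them, and one partition of unity serves for every
    index.\<close>
  have K: "compactin X (\<Union>i\<in>H. K i)" "(\<Union>i\<in>H. K i) \<subseteq> (\<Union>i\<in>I. A i)"
  proof -
    show "compactin X (\<Union>i\<in>H. K i)"
      by (rule compactin_Union) (use H diff_opD(3)[OF D(1)] in auto)
    show "(\<Union>i\<in>H. K i) \<subseteq> (\<Union>i\<in>I. A i)" using H(2) diff_opD(4)[OF D(1)] by blast
  qed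
  obtain f L J where J: "finite J" "J \<subseteq> I" and f: "\<And>j. j \<in> J \<Longrightarrow> f j \<in> carrier (sections \<O> ?T)"
    and L: "\<And>j. j \<in> J \<Longrightarrow> compactin X (L j)" "\<And>j. j \<in> J \<Longrightarrow> L j \<subseteq> A j"
    and f0: "\<And>j. j \<in> J \<Longrightarrow> restr \<O> ?T (?T - L j) (f j) = \<zero>\<^bsub>sections \<O> (?T - L j)\<^esub>"
    and one: "\<And>a. a \<in> (\<Union>i\<in>H. K i) \<Longrightarrow> \<exists>N. openin X N \<and> a \<in> N \<and> restr \<O> ?T N (finsum (sections \<O> ?T) f J) = \<one>\<^bsub>sections \<O> N\<^esub>"
    by (rule sections_partition[OF K]) (rule A, assumption, (rule that; assumption))
  define P where "P i j \<zeta> \<longleftrightarrow> \<zeta> \<in> Dc (A i \<inter> A j) \<and>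
    (\<forall>v\<in>F_carrier (A i \<inter> A j). \<zeta> v = density_integral X \<O> (D i (A i \<inter> A j) (restr \<O> ?T (A i \<inter> A j) (f j) \<odot>\<^bsub>sections \<F> (A i \<inter> A j)\<^esub> v))) \<and>
    (\<forall>u\<in>F_carrier (A i). \<zeta> (restr \<F> (A i) (A i \<inter> A j) u) = rho_F (A i) (D i) (restr \<O> ?T (A i) (f j) \<odot>\<^bsub>sections \<F> (A i)\<^esub> u))" for i j \<zeta>
  have oA: "openin X (A i \<inter> A j)" if "i \<in> I" "j \<in> I" for i j using A that by blast
  have "\<exists>\<zeta>. P i j \<zeta>" if i: "i \<in> I" and j: "j \<in> J" for i j
  proof -
    have jI: "j \<in> I" using j J by blast
    have "K i \<inter> L j \<subseteq> A i \<inter> A j" using L(2)[OF j] diff_opD(4)[OF D(1)[OF i]] by blast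
    from cut_functional[OF A[OF i] oA[OF i jI] Int_lower1 D(1)[OF i] f[OF j] L(1)[OF j] f0[OF j] this]
    show ?thesis unfolding P_def by blast
  qed
  then obtain \<xi> where \<xi>: "\<And>i j. i \<in> I \<Longrightarrow> j \<in> J \<Longrightarrow> P i j (\<xi> i j)" by metis
  \<comment> \<open>Cut down to \<open>H\<close> times \<open>J\<close>, so that only finitely many
    components are nonzero, as the direct sum demands.\<close>
  define \<zeta> where "\<zeta> = (\<lambda>p\<in>I \<times> I. if fst p \<in> H \<and> snd p \<in> J then \<xi> (fst p) (snd p) else (\<lambda>u. 0))"
  have \<zeta>_eq: "\<zeta> (i, j) = (if i \<in> H \<and> j \<in> J then \<xi> i j else (\<lambda>u. 0))" if "i \<in> I" "j \<in> I" for i j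
    using that by (simp add: \<zeta>_def)
  define S where "S = H \<union> J"
  have S: "finite S" "S \<subseteq> I" "{p \<in> I \<times> I. \<zeta> p \<noteq> (\<lambda>u. 0)} \<subseteq> S \<times> S"
    using H(1,2) J by (auto simp: S_def \<zeta>_eq split: if_splits)
  have \<zeta>: "\<zeta> \<in> direct_sum (I \<times> I) (\<lambda>(i, j). cosections G (A i \<inter> A j))"
  proof -
    have "\<zeta> (i, j) \<in> Dc (A i \<inter> A j)" if "i \<in> I" "j \<in> I" for i j
      using \<xi>[OF that(1), of j] Dc_zero[OF oA[OF that]] by (auto simp: \<zeta>_eq[OF that] P_def)
    moreover have "\<zeta> \<in> extensional (I \<times> I)" by (simp add: \<zeta>_def)
    moreover have "finite {p \<in> I \<times> I. \<zeta> p \<noteq> (\<lambda>u. 0)}"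
      by (rule finite_subset[OF S(3)]) (use S(1) in simp)
    ultimately show ?thesis by (auto simp: direct_sum_def PiE_iff Dc_simps case_prod_unfold)
  qed
  have "cosheaf_diff G I A \<zeta> k = \<eta> k" if k: "k \<in> I" for k
  proof
    fix u
    have "(\<Sum>j\<in>S. \<zeta> (k, j) (restr \<F> (A k) (A k \<inter> A j) u)) = \<eta> k u" if u: "u \<in> F_carrier (A k)"
    proof (cases "k \<in> H")
      case False
      then have "\<eta> k = (\<lambda>u. 0)" using k by (simp add: H_def)
      then show ?thesis using False k S(2) by (auto simp: \<zeta>_eq intro!: sum.neutral)
    next
      case True
      have one': "\<exists>N. openin X N \<and> a \<in> N \<and> restr \<O> ?T N (finsum (sections \<O> ?T) f J) = \<one>\<^bsub>sections \<O> N\<^esub>" if "a \<in> K k" for a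
        using one True that by blast
      have "(\<Sum>j\<in>S. \<zeta> (k, j) (restr \<F> (A k) (A k \<inter> A j) u)) = (\<Sum>j\<in>J. \<zeta> (k, j) (restr \<F> (A k) (A k \<inter> A j) u))"
        by (rule sum.mono_neutral_right[OF S(1)]) (use k S(2) in \<open>auto simp: S_def \<zeta>_eq\<close>)
      also have "\<dots> = (\<Sum>j\<in>J. rho_F (A k) (D k) (restr \<O> ?T (A k) (f j) \<odot>\<^bsub>sections \<F> (A k)\<^esub> u))"
      proof (rule sum.cong[OF refl])
        fix j assume j: "j \<in> J"
        then have "j \<in> I" using J by blast
        then show "\<zeta> (k, j) (restr \<F> (A k) (A k \<inter> A j) u) = rho_F (A k) (D k) (restr \<O> ?T (A k) (f j) \<odot>\<^bsub>sections \<F> (A k)\<^esub> u)"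
          using \<xi>[OF k j] True j u k by (simp add: \<zeta>_eq P_def)
      qed
      also have "\<dots> = \<eta> k u"
        unfolding D(2)[OF k] by (rule rho_partition[OF A[OF k] D(1)[OF k] J(1) f one' u])
      finally show ?thesis .
    qed
    moreover have "(\<Sum>i\<in>S. \<zeta> (i, k) (restr \<F> (A k) (A i \<inter> A k) u)) = 0" if u: "u \<in> F_carrier (A k)"
    proof (cases "k \<in> J")
      case False
      then show ?thesis using k S(2) by (auto simp: \<zeta>_eq intro!: sum.neutral)
    next
      case True
      obtain w where w: "w \<in> F_carrier U" "restr \<F> U (A k) w = restr \<O> ?T (A k) (f k) \<odot>\<^bsub>sections \<F> (A k)\<^esub> u"
        "restr \<F> U (U - L k) w = \<zero>\<^bsub>sections \<F> (U - L k)\<^esub>"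
        using extend_section[OF U(1) A[OF k] AU[OF k] f[OF True] L(1)[OF True] f0[OF True] L(2)[OF True] u] by blast
      have "(\<Sum>i\<in>S. \<zeta> (i, k) (restr \<F> (A k) (A i \<inter> A k) u)) = (\<Sum>i\<in>H. \<zeta> (i, k) (restr \<F> (A k) (A i \<inter> A k) u))"
        by (rule sum.mono_neutral_right[OF S(1)]) (use k S(2) in \<open>auto simp: S_def \<zeta>_eq\<close>)
      also have "\<dots> = (\<Sum>i\<in>H. \<eta> i (restr \<F> U (A i) w))"
      proof (rule sum.cong[OF refl])
        fix i assume i: "i \<in> H"
        then have iI: "i \<in> I" using H by blast
        note oik = oA[OF iI k] and hom = diff_opD(1)[OF D(1)[OF iI]]
        let ?B = "A i \<inter> A k"
        have wA: "restr \<F> U (A i) w \<in> F_carrier (A i)" by (rule restr_F_closed[OF U(1) A[OF iI] AU[OF iI] w(1)])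
        have fk: "restr \<O> ?T (A k) (f k) \<in> carrier (sections \<O> (A k))"
          using restr_closed[OF _ A[OF k] openin_subset[OF A[OF k]] f[OF True]] by simp
        have "restr \<O> ?T ?B (f k) \<odot>\<^bsub>sections \<F> ?B\<^esub> restr \<F> (A k) ?B u =
            restr \<F> (A k) ?B (restr \<O> ?T (A k) (f k) \<odot>\<^bsub>sections \<F> (A k)\<^esub> u)"
          using restr_F_smult[OF A[OF k] oik Int_lower2 fk u]
            restr_restr[OF _ A[OF k] oik Int_lower2 openin_subset[OF A[OF k]] f[OF True]] by simp
        also have "\<dots> = restr \<F> U ?B w"
          using restr_F_restr[OF U(1) A[OF k] oik Int_lower2 AU[OF k] w(1)] unfolding w(2) .
        also have "\<dots> = restr \<F> (A i) ?B (restr \<F> U (A i) w)"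
          using restr_F_restr[OF U(1) A[OF iI] oik Int_lower1 AU[OF iI] w(1)] by simp
        finally have eq: "restr \<O> ?T ?B (f k) \<odot>\<^bsub>sections \<F> ?B\<^esub> restr \<F> (A k) ?B u = restr \<F> (A i) ?B (restr \<F> U (A i) w)" .
        \<comment> \<open>The section \<open>w\<close> is zero off \<open>L k\<close>, which lies in
          \<open>A k\<close>. So the density over \<open>A i\<close> is already supported in the
          intersection, and its integral can be taken over either set.\<close>
        have supp: "a \<in> ?B" if nz: "D i (A i) (restr \<F> U (A i) w) c a \<noteq> 0" for c a
        proof (rule ccontr)
          assume a: "a \<notin> ?B"
          have aA: "a \<in> A i"
            using densities_onD(2)[OF hom_onD(1)[OF hom A[OF iI] subset_refl wA], of a c] nz by blast
          then have aL: "a \<in> A i - L k" using a L(2)[OF True] by blast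
          have o: "openin X (A i - L k)" "openin X (U - L k)"
            using A[OF iI] U(1) compactin_imp_closedin[OF Hausdorff L(1)[OF True]] by blast+
          have s: "A i - L k \<subseteq> U - L k" using AU[OF iI] by blast
          have "restr \<F> (A i) (A i - L k) (restr \<F> U (A i) w) = restr \<F> (U - L k) (A i - L k) (restr \<F> U (U - L k) w)"
            using restr_F_restr[OF U(1) A[OF iI] o(1) Diff_subset AU[OF iI] w(1)] restr_F_restr[OF U(1) o(2,1) s Diff_subset w(1)]
            by simp
          also have "\<dots> = \<zero>\<^bsub>sections \<F> (A i - L k)\<^esub>" unfolding w(3) by (rule restr_F_zero[OF o(2,1) s])
          finally have z: "restr \<F> (A i) (A i - L k) (restr \<F> U (A i) w) = \<zero>\<^bsub>sections \<F> (A i - L k)\<^esub>" .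
          have "(if a \<in> A i - L k then D i (A i) (restr \<F> U (A i) w) c a else 0) = 0"
            using fun_cong[OF fun_cong[OF hom_onD(4)[OF hom A[OF iI] o(1) Diff_subset subset_refl wA], of c], of a]
              hom_on_zero[OF hom o(1) Diff_subset] unfolding z by simp
          then show False using aL nz by simp
        qed
        have "D i ?B (restr \<O> ?T ?B (f k) \<odot>\<^bsub>sections \<F> ?B\<^esub> restr \<F> (A k) ?B u) = D i (A i) (restr \<F> U (A i) w)"
          unfolding eq hom_onD(4)[OF hom A[OF iI] oik Int_lower1 subset_refl wA] using supp by (intro ext) auto
        then show "\<zeta> (i, k) (restr \<F> (A k) ?B u) = \<eta> i (restr \<F> U (A i) w)"
          using \<xi>[OF iI True] restr_F_closed[OF A[OF k] oik Int_lower2 u] i True wA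
          by (simp add: \<zeta>_eq[OF iI k] P_def D(2)[OF iI] rho_def)
      qed
      also have "\<dots> = cosheaf_sum G I A U \<eta> w"
        using cosheaf_sum_eq(1)[OF U(1) _ \<eta> H] A AU w(1) by simp
      also have "\<dots> = 0" unfolding \<eta>0 by simp
      finally show ?thesis .
    qed
    moreover have "cosheaf_diff G I A \<zeta> k = (\<lambda>u. if u \<in> F_carrier (A k) then
      (\<Sum>j\<in>S. \<zeta> (k, j) (restr \<F> (A k) (A k \<inter> A j) u)) - (\<Sum>i\<in>S. \<zeta> (i, k) (restr \<F> (A k) (A i \<inter> A k) u)) else 0)"
      by (rule cosheaf_diff_eq(1)[OF _ \<zeta> S k], erule A)
    ultimately show "cosheaf_diff G I A \<zeta> k u = \<eta> k u"
      using Dc_outside[OF \<eta>I[OF k]] by simp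
  qed
  moreover have "cosheaf_diff G I A \<zeta> \<in> extensional I" by (simp add: cosheaf_diff_def)
  ultimately have "cosheaf_diff G I A \<zeta> = \<eta>" using extensionalityI[OF _ \<eta>ext] by blast
  then show ?thesis using \<zeta> by blast
qed

end

theorem proposition2p3:
  fixes X :: "'m topology"
    and \<O> :: "('m, complex, 'o) presheaf"
    and \<F> :: "('m, 'o, 'f) presheaf"
  assumes "formal_manifold X \<O>"
    and "sheaf_of_modules X \<O> \<F>"
  shows "cosheaf_on TYPE('i) X (Dc_infty X \<O> \<F>)"
proof -
  interpret formal_module X \<O> \<F>
    by unfold_locales (rule assms)+
  show ?thesis
    unfolding cosheaf_on_def
  proof (intro conjI allI impI precosheaf)
    fix U and I :: "'i set" and A
    assume "openin X U \<and> (\<forall>i\<in>I. openin X (A i)) \<and> (\<Union>i\<in>I. A i) = U"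
    then have A: "\<And>i. i \<in> I \<Longrightarrow> openin X (A i)" and U: "openin X U" "(\<Union>i\<in>I. A i) = U" by auto
    have AU: "A i \<subseteq> U" if "i \<in> I" for i using U(2) that by blast
    show "cosheaf_diff G I A ` direct_sum (I \<times> I) (\<lambda>(i, j). cosections G (A i \<inter> A j)) =
      {\<eta> \<in> direct_sum I (\<lambda>i. cosections G (A i)). cosheaf_sum G I A U \<eta> = \<zero>\<^bsub>cosections G U\<^esub>}"
      using cosheaf_complex[OF A U] cosheaf_exact[OF A U] unfolding Dc_simps(1) by blast
    have "cosheaf_sum G I A U \<eta> \<in> Dc U" if \<eta>: "\<eta> \<in> direct_sum I (\<lambda>i. cosections G (A i))" for \<eta>
      by (rule cosheaf_sum_eq(2)[OF U(1) _ \<eta>, of "{i \<in> I. \<eta> i \<noteq> (\<lambda>u. 0)}"])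
        (use A AU \<eta> in \<open>auto simp: direct_sum_def Dc_simps\<close>)
    then show "cosheaf_sum G I A U ` direct_sum I (\<lambda>i. cosections G (A i)) = Dc U"
      using cosheaf_surjective[OF A U] by blast
  qed
qed

end
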